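(* Let $N\ge2$ and consider the random graph $\mathcal G_N$ on $\Omega_N$ in which distinct $x,y$ with $d(x,y)=k$ are joined by an edge independently with probability $\min(c_k/N^{2k},1)$, where $$c_k=C_0+C_1\log k+C_2k^\alpha,\qquad \alpha\ge 0,\ C_0\ge0,\ C_1\ge0,\ C_2\ge 0.$$ (a) If $\alpha>2$, then for any $C_1$ there exist $C_0^*>0$ and $C_2^*>0$ such that if $C_0>C_0^*$ and $C_2>C_2^*$, percolation occurs and the percolation cluster (infinite cluster) is unique. (b) If $C_2=0$ and $C_1<N$, then percolation does not occur, for any $C_0$. (c) If $\alpha>2$, there exists $C_*>0$ such that if $\max(C_0,C_1,C_2)<C_*$, then percolation does not occur.
   Context: $\Omega_N$ is the set of sequences $x=(x_1,x_2,\dots)$ with $x_i\in\{0,\dots,N-1\}$ and only finitely many $x_i\ne0$. The hierarchical distance is $d(x,y)=0$ if $x=y$ and $d(x,y)=\max\{i:x_i\ne y_i\}$ otherwise (an ultrametric). $\mathbf 0$ is the zero sequence. All edges are independent. A cluster is a connected component. Percolation occurs if, with positive probability, $\mathbf 0$ belongs to an infinite cluster. *)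

theory Defs
  imports "HOL-Probability.Probability"
begin

text \<open>The hierarchical space Omega_N: sequences x_1, x_2, ... with values in {0..N-1},
  finitely many nonzero. We index by nat and force x 0 = 0 (position 0 is unused).\<close>
definition Omega :: "nat \<Rightarrow> (nat \<Rightarrow> nat) set" where
  "Omega N = {x. x 0 = 0 \<and> (\<forall>i. x i < N) \<and> finite {i. x i \<noteq> 0}}"

definition zero_seq :: "nat \<Rightarrow> nat" where
  "zero_seq = (\<lambda>_. 0)"

definition hdist :: "(nat \<Rightarrow> nat) \<Rightarrow> (nat \<Rightarrow> nat) \<Rightarrow> nat" where
  "hdist x y = (if x = y then 0 else Max {i. x i \<noteq> y i})"

definition edges :: "nat \<Rightarrow> (nat \<Rightarrow> nat) set set" where
  "edges N = {{x, y} | x y. x \<in> Omega N \<and> y \<in> Omega N \<and> x \<noteq> y}"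

text \<open>Distance between the two endpoints of an edge (hdist is symmetric).\<close>
definition edist :: "(nat \<Rightarrow> nat) set \<Rightarrow> nat" where
  "edist e = (SOME k. \<exists>x y. e = {x, y} \<and> k = hdist x y)"

definition ck :: "real \<Rightarrow> real \<Rightarrow> real \<Rightarrow> real \<Rightarrow> nat \<Rightarrow> real" where
  "ck C0 C1 C2 \<alpha> k = C0 + C1 * ln (real k) + C2 * real k powr \<alpha>"

definition edge_prob :: "nat \<Rightarrow> (nat \<Rightarrow> real) \<Rightarrow> nat \<Rightarrow> real" where
  "edge_prob N c k = min (c k / real N ^ (2 * k)) 1"

definition perc_space :: "nat \<Rightarrow> (nat \<Rightarrow> real) \<Rightarrow> ((nat \<Rightarrow> nat) set \<Rightarrow> bool) measure" where
  "perc_space N c = PiM (edges N) (\<lambda>e. measure_pmf (bernoulli_pmf (edge_prob N c (edist e))))"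

definition adjacent :: "nat \<Rightarrow> ((nat \<Rightarrow> nat) set \<Rightarrow> bool) \<Rightarrow> (nat \<Rightarrow> nat) \<Rightarrow> (nat \<Rightarrow> nat) \<Rightarrow> bool" where
  "adjacent N \<omega> x y \<longleftrightarrow> x \<noteq> y \<and> x \<in> Omega N \<and> y \<in> Omega N \<and> \<omega> {x, y}"

definition cluster :: "nat \<Rightarrow> ((nat \<Rightarrow> nat) set \<Rightarrow> bool) \<Rightarrow> (nat \<Rightarrow> nat) \<Rightarrow> (nat \<Rightarrow> nat) set" where
  "cluster N \<omega> x = {y. (x, y) \<in> {(a, b). adjacent N \<omega> a b}\<^sup>*}"

definition percolates :: "nat \<Rightarrow> (nat \<Rightarrow> real) \<Rightarrow> bool" where
  "percolates N c \<longleftrightarrow>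
     (let M = perc_space N c; A = {\<omega> \<in> space M. infinite (cluster N \<omega> zero_seq)}
      in A \<in> sets M \<and> measure M A > 0)"

definition no_percolation :: "nat \<Rightarrow> (nat \<Rightarrow> real) \<Rightarrow> bool" where
  "no_percolation N c \<longleftrightarrow> (AE \<omega> in perc_space N c. finite (cluster N \<omega> zero_seq))"

definition unique_infinite_cluster :: "nat \<Rightarrow> (nat \<Rightarrow> real) \<Rightarrow> bool" where
  "unique_infinite_cluster N c \<longleftrightarrow>
     (AE \<omega> in perc_space N c. \<forall>x\<in>Omega N. \<forall>y\<in>Omega N.
        infinite (cluster N \<omega> x) \<and> infinite (cluster N \<omega> y) \<longrightarrow> cluster N \<omega> x = cluster N \<omega> y)"

end

theory Submission
  imports Defs "HOL-Real_Asymp.Real_Asymp"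
begin

text \<open>
  Write $B_k$ for the ball of radius $k$ around $\mathbf 0$, which has $N^k$ points.

  For small constants the mean degree $\sum_j c_j N^{-j}$ is below one, so the expected size of a
  cluster inside $B_k$ is bounded uniformly in $k$, while the probability that a given point of
  $B_k$ has an open edge leaving $B_k$ tends to zero.

  For $C_2 = 0$ the expected number of open edges leaving $B_k$ is $(C_1/N) \log k + O(1)$, hence
  $B_k$ is isolated with probability of order $k^{-C_1/N}$, which is not summable if $C_1 < N$.
  Along the radii $g, 2g, \dots, g^P g$ the isolation events are independent up to edges that skip
  a whole annulus, and those have exponentially small probability in $g$.

  For $\alpha > 2$ one renormalises along scales $K_n$ with $N^{K_{n+1}-K_n}$ of order $n^a$,
  $1 < a < \alpha/2$. A ball of radius $K_{n+1}$ is good if at most one of its subballs of radius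
  $K_n$ is bad and the cores of all good subballs are pairwise joined by an open edge; its core is
  then the union of these cores. Since $\sum n^{-a} < \infty$ a core keeps at least half of its
  ball, so two cores miss each other with probability at most $\exp(-b\, n^{\alpha-2a})$, and the
  probability of being bad decays like a power of $n$. For uniqueness, the part of an infinite
  cluster inside $B_{K_n}$ must have an open edge leaving $B_{K_n}$; conditionally on the edges in
  $B_{K_n}$ it avoids the core of a neighbouring ball with probability at most some $\rho < 1$,
  because either few edges leave it on average, or a fixed proportion of them is expected to hit
  that core. Repeating this over widely separated scales shows that every infinite cluster
  contains the cores of all large balls around $\mathbf 0$.
\<close>

section \<open>Balls, spheres and edges of the hierarchical space\<close>

text \<open>Probabilities are computed for predicates of finitely many edges: there measurability is
  automatic, disjoint edge sets give independence, and conditioning is a finite sum over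
  configurations. Edges have unbounded range, so arguments about leaving a ball split the outgoing
  edges into those ending in a larger finite ball, treated by independence, and longer ones, removed
  by a union bound. The exceptional sets are only covered by events of small probability and need
  not be shown measurable.

  The condition \<open>\<alpha> > 2\<close> resolves a conflict: cores stay large if a > 1, and
  cores see each other if 2a < \<alpha>. In (a) the lower bound on C_0 makes every edge up to the
  initial radius open almost surely, which gives the recursion a deterministic start; this radius
  depends on N and \<alpha> but not on C_1. In (b) the threshold N appears because the sphere of
  radius k + i is the fraction 1 - 1/N of its ball, and the sum over i of (1 - 1/N) / N^i is
  1/N.\<close>

definition hball :: "nat \<Rightarrow> nat \<Rightarrow> (nat \<Rightarrow> nat) \<Rightarrow> (nat \<Rightarrow> nat) set" where
  "hball N k x = {y \<in> Omega N. \<forall>i>k. y i = x i}"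

text \<open>The points of the ball of radius $l$ around $x$ whose first $k$ coordinates vanish: one
  representative for each subball of radius $k$.\<close>

definition ball_reps :: "nat \<Rightarrow> nat \<Rightarrow> nat \<Rightarrow> (nat \<Rightarrow> nat) \<Rightarrow> (nat \<Rightarrow> nat) set" where
  "ball_reps N k l x = {z \<in> hball N l x. \<forall>i\<le>k. z i = 0}"

lemma zero_seq_Omega: "N \<ge> 1 \<Longrightarrow> zero_seq \<in> Omega N"
  by (auto simp: Omega_def zero_seq_def)

text \<open>Restriction to the free coordinates \<open>J\<close> is a bijection onto
  \<open>PiE J (\<lambda>_. {..<N})\<close>. Coordinate 0 is not free because it vanishes on
  \<open>Omega N\<close>. Balls and sets \<open>ball_reps\<close> are both boxes with an interval
  for \<open>J\<close>.\<close>

lemma card_box: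
  assumes x: "x \<in> Omega N" and J: "finite J" "0 \<notin> J"
  shows "finite {y \<in> Omega N. \<forall>i. i \<notin> J \<longrightarrow> y i = x i}"
    and "card {y \<in> Omega N. \<forall>i. i \<notin> J \<longrightarrow> y i = x i} = N ^ card J"
proof -
  let ?X = "{y \<in> Omega N. \<forall>i. i \<notin> J \<longrightarrow> y i = x i}"
  let ?P = "PiE J (\<lambda>_. {..<N})"
  have "bij_betw (\<lambda>y. restrict y J) ?X ?P"
  proof (rule bij_betw_byWitness[where f' = "\<lambda>f i. if i \<in> J then f i else x i"])
    show "\<forall>y\<in>?X. (\<lambda>i. if i \<in> J then restrict y J i else x i) = y" by auto
    show "\<forall>f\<in>?P. restrict (\<lambda>i. if i \<in> J then f i else x i) J = f"
      by (simp add: fun_eq_iff PiE_def extensional_def)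
    show "(\<lambda>y. restrict y J) ` ?X \<subseteq> ?P" by (rule image_subsetI) (simp add: Omega_def)
    show "(\<lambda>f i. if i \<in> J then f i else x i) ` ?P \<subseteq> ?X"
    proof (rule image_subsetI)
      fix f assume f: "f \<in> ?P"
      have "{i. (if i \<in> J then f i else x i) \<noteq> 0} \<subseteq> J \<union> {i. x i \<noteq> 0}" by auto
      then have "finite {i. (if i \<in> J then f i else x i) \<noteq> 0}"
        by (rule finite_subset) (use J(1) x in \<open>simp add: Omega_def\<close>)
      moreover have "f i < N" if "i \<in> J" for i using PiE_mem[OF f that] by simp
      ultimately show "(\<lambda>i. if i \<in> J then f i else x i) \<in> ?X"
        using x J(2) unfolding Omega_def by simp
    qed
  qed
  moreover have "finite ?P" "card ?P = N ^ card J" using J by (auto simp: card_PiE finite_PiE)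
  ultimately show "finite ?X" "card ?X = N ^ card J"
    by (auto simp: bij_betw_finite bij_betw_same_card)
qed

lemma assumes "x \<in> Omega N" shows finite_hball [simp]: "finite (hball N k x)"
  and card_hball: "card (hball N k x) = N ^ k"
proof -
  have "hball N k x = {y \<in> Omega N. \<forall>i. i \<notin> {1..k} \<longrightarrow> y i = x i}"
  proof -
    have "(\<forall>i>k. y i = x i) \<longleftrightarrow> (\<forall>i. i \<notin> {1..k} \<longrightarrow> y i = x i)" if "y \<in> Omega N" for y
    proof safe
      fix i assume *: "\<forall>i>k. y i = x i" "i \<notin> {1..k}"
      show "y i = x i"
      proof (cases "i = 0")
        case True then show ?thesis using that assms by (simp add: Omega_def)
      next
        case False then show ?thesis using * by simp
      qed
    qed simp
    then show ?thesis unfolding hball_def by blast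
  qed
  then show "finite (hball N k x)" "card (hball N k x) = N ^ k"
    using card_box[OF assms, of "{1..k}"] by auto
qed

lemma hball_sub_Omega: "hball N k x \<subseteq> Omega N" by (auto simp: hball_def)

lemma hball_self: "x \<in> Omega N \<Longrightarrow> x \<in> hball N k x" by (auto simp: hball_def)

lemma hball_mono: "k \<le> l \<Longrightarrow> hball N k x \<subseteq> hball N l x" by (auto simp: hball_def)

lemma hball_eq: "y \<in> hball N k x \<Longrightarrow> hball N k y = hball N k x" by (auto simp: hball_def)

lemma hball_sub: "k \<le> l \<Longrightarrow> y \<in> hball N l x \<Longrightarrow> hball N k y \<subseteq> hball N l x"
  using hball_eq hball_mono by blast

lemma ball_reps_sub: "ball_reps N k l x \<subseteq> hball N l x" by (auto simp: ball_reps_def)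

lemma trunc_Omega: "x \<in> Omega N \<Longrightarrow> (\<lambda>i. if i \<le> k then 0 else x i) \<in> Omega N"
proof -
  assume x: "x \<in> Omega N"
  have "{i. (if i \<le> k then 0 else x i) \<noteq> 0} \<subseteq> {i. x i \<noteq> 0}" by auto
  then have "finite {i. (if i \<le> k then 0 else x i) \<noteq> 0}"
    by (rule finite_subset) (use x in \<open>simp add: Omega_def\<close>)
  moreover have "x 0 < N" using x unfolding Omega_def by blast
  then have "0 < N" by simp
  ultimately show ?thesis using x unfolding Omega_def by simp
qed

lemma finite_ball_reps [simp]: "x \<in> Omega N \<Longrightarrow> finite (ball_reps N k l x)"
  by (rule finite_subset[OF ball_reps_sub]) simp

lemma card_ball_reps: assumes x: "x \<in> Omega N" and "k \<le> l" shows "card (ball_reps N k l x) = N ^ (l - k)"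
proof -
  let ?x = "\<lambda>i. if i \<le> k then 0 else x i"
  have "ball_reps N k l x = {y \<in> Omega N. \<forall>i. i \<notin> {k<..l} \<longrightarrow> y i = ?x i}"
    using \<open>k \<le> l\<close> unfolding ball_reps_def hball_def set_eq_iff mem_Collect_eq greaterThanAtMost_iff
    by (smt (verit) le_trans not_le)
  then show ?thesis using card_box(2)[OF trunc_Omega[OF x], of "{k<..l}" k] by auto
qed

lemma ball_reps_disjoint: assumes "z \<in> ball_reps N k l x" "z' \<in> ball_reps N k l x" "z \<noteq> z'"
  shows "hball N k z \<inter> hball N k z' = {}"
proof (rule ccontr)
  assume "hball N k z \<inter> hball N k z' \<noteq> {}"
  then obtain y where "y \<in> hball N k z" "y \<in> hball N k z'" by auto
  then have "z i = z' i" for i using assms by (cases "i \<le> k") (auto simp: ball_reps_def hball_def)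
  with assms(3) show False by auto
qed

lemma diff_finite: assumes "x \<in> Omega N" "y \<in> Omega N" shows "finite {i. x i \<noteq> y i}"
proof -
  have "{i. x i \<noteq> y i} \<subseteq> {i. x i \<noteq> 0} \<union> {i. y i \<noteq> 0}" by auto
  then show ?thesis by (rule finite_subset) (use assms in \<open>simp add: Omega_def\<close>)
qed

text \<open>Trades the maximum in \<open>hdist\<close> for agreement of the coordinates beyond k.
  The ultrametric property then takes the form \<open>hball_eq\<close>: every point of a ball is a
  centre of it.\<close>

lemma hdist_le_iff: assumes "x \<in> Omega N" "y \<in> Omega N"
  shows "hdist x y \<le> k \<longleftrightarrow> y \<in> hball N k x"
proof (cases "x = y")
  case True then show ?thesis using assms by (auto simp: hdist_def hball_def)
next
  case False
  then have "{i. x i \<noteq> y i} \<noteq> {}" by auto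
  then show ?thesis using False assms Max_le_iff[OF diff_finite[OF assms], of k]
    unfolding hdist_def hball_def by (auto simp: not_less) (metis not_less)
qed

lemma hdist_commute: "hdist x y = hdist y x"
  by (auto simp: hdist_def eq_commute)

lemma hdist_pos: assumes "x \<in> Omega N" "y \<in> Omega N" "x \<noteq> y" shows "1 \<le> hdist x y"
proof (rule ccontr)
  assume "\<not> 1 \<le> hdist x y"
  then have "hdist x y \<le> 0" by auto
  then have "y \<in> hball N 0 x" using hdist_le_iff assms by blast
  then have "y i = x i" for i using assms by (cases "i = 0") (auto simp: hball_def Omega_def)
  with assms(3) show False by auto
qed

lemma edist_pair: "edist {x, y} = hdist x y"
  unfolding edist_def
  by (rule some_equality) (auto simp: doubleton_eq_iff hdist_commute)

definition hsphere :: "nat \<Rightarrow> nat \<Rightarrow> (nat \<Rightarrow> nat) \<Rightarrow> (nat \<Rightarrow> nat) set" where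
  "hsphere N j a = {y \<in> Omega N. hdist a y = j}"

lemma finite_hsphere [simp]: assumes "a \<in> Omega N" shows "finite (hsphere N j a)"
proof -
  have "hsphere N j a \<subseteq> hball N j a" unfolding hsphere_def using hdist_le_iff[OF assms] by auto
  then show ?thesis by (rule finite_subset) (rule finite_hball[OF assms])
qed

lemma card_hsphere: assumes a: "a \<in> Omega N"
  shows "card (hsphere N (Suc j) a) = N ^ Suc j - N ^ j"
proof -
  have "hsphere N (Suc j) a = hball N (Suc j) a - hball N j a"
    unfolding hsphere_def using hdist_le_iff[OF a] hball_sub_Omega[of N _ a]
    by (auto simp: set_eq_iff) (metis le_antisym not_less_eq_eq subsetD order_refl)+
  then show ?thesis using card_Diff_subset[OF finite_hball[OF a] hball_mono[of j "Suc j"]]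
    by (simp add: card_hball[OF a])
qed

lemma Omega_UN_hball: assumes "N \<ge> 1" shows "Omega N = (\<Union>k. hball N k zero_seq)"
proof -
  have "x \<in> hball N (hdist zero_seq x) zero_seq" if "x \<in> Omega N" for x
    using hdist_le_iff[OF zero_seq_Omega[OF assms] that] by auto
  then show ?thesis using hball_sub_Omega by blast
qed

lemma countable_Omega: assumes "N \<ge> 1" shows "countable (Omega N)"
  unfolding Omega_UN_hball[OF assms]
  by (rule countable_UN) (simp_all add: countable_finite zero_seq_Omega[OF assms])

lemma countable_edges: assumes "N \<ge> 1" shows "countable (edges N)"
proof -
  have "edges N \<subseteq> (\<lambda>(x,y). {x,y}) ` (Omega N \<times> Omega N)" by (auto simp: edges_def)
  then show ?thesis
    by (rule countable_subset) (intro countable_image countable_SIGMA countable_Omega[OF assms])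
qed

section \<open>Edge sets inside one vertex set and between two vertex sets\<close>

definition inner_edges :: "(nat \<Rightarrow> nat) set \<Rightarrow> (nat \<Rightarrow> nat) set set" where
  "inner_edges V = {{a, b} | a b. a \<in> V \<and> b \<in> V \<and> a \<noteq> b}"

definition cross_edges :: "(nat \<Rightarrow> nat) set \<Rightarrow> (nat \<Rightarrow> nat) set \<Rightarrow> (nat \<Rightarrow> nat) set set" where
  "cross_edges D T = (\<lambda>(a, b). {a, b}) ` (D \<times> T)"

lemma cross_edges_E: "e \<in> cross_edges D T \<Longrightarrow> \<exists>a\<in>D. \<exists>b\<in>T. e = {a, b}" by (auto simp: cross_edges_def)
lemma cross_edges_I: "a \<in> D \<Longrightarrow> b \<in> T \<Longrightarrow> {a, b} \<in> cross_edges D T" by (auto simp: cross_edges_def)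

lemma finite_inner_edges: "finite V \<Longrightarrow> finite (inner_edges V)"
proof -
  assume "finite V"
  moreover have "inner_edges V \<subseteq> Pow V" by (auto simp: inner_edges_def)
  ultimately show ?thesis by (simp add: finite_subset)
qed
lemma finite_cross_edges: "finite D \<Longrightarrow> finite T \<Longrightarrow> finite (cross_edges D T)" by (auto simp: cross_edges_def)
lemma inner_edges_edges: "V \<subseteq> Omega N \<Longrightarrow> inner_edges V \<subseteq> edges N" unfolding inner_edges_def edges_def by blast
lemma cross_edges_edges: "D \<subseteq> Omega N \<Longrightarrow> T \<subseteq> Omega N \<Longrightarrow> D \<inter> T = {} \<Longrightarrow> cross_edges D T \<subseteq> edges N"
  unfolding cross_edges_def edges_def by clarsimp blast
lemma inner_edges_mono: "V \<subseteq> W \<Longrightarrow> inner_edges V \<subseteq> inner_edges W" unfolding inner_edges_def by blast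
lemma inner_edges_sub: "e \<in> inner_edges V \<Longrightarrow> e \<subseteq> V \<and> e \<noteq> {}"
  unfolding inner_edges_def by auto
lemma inner_edges_cross_edges_disj: assumes "T \<inter> V = {}" shows "inner_edges V \<inter> cross_edges D T = {}"
proof (rule equals0I)
  fix e assume "e \<in> inner_edges V \<inter> cross_edges D T"
  then have "e \<subseteq> V" "e \<inter> T \<noteq> {}" using inner_edges_sub[of e V] by (auto simp: cross_edges_def)
  then show False using assms by blast
qed
lemma inner_edges_cross_edges_disj': assumes "D \<inter> V = {}" shows "inner_edges V \<inter> cross_edges D T = {}"
proof (rule equals0I)
  fix e assume "e \<in> inner_edges V \<inter> cross_edges D T"
  then have "e \<subseteq> V" "e \<inter> D \<noteq> {}" using inner_edges_sub[of e V] by (auto simp: cross_edges_def)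
  then show False using assms by blast
qed
lemma inner_edges_inner_edges_disj: assumes "V \<inter> W = {}" shows "inner_edges V \<inter> inner_edges W = {}"
proof (rule equals0I)
  fix e assume "e \<in> inner_edges V \<inter> inner_edges W"
  then have "e \<subseteq> V" "e \<subseteq> W" "e \<noteq> {}" using inner_edges_sub[of e V] inner_edges_sub[of e W] by blast+
  then show False using assms by blast
qed
lemma cross_edges_inner_edges: "D \<subseteq> V \<Longrightarrow> T \<subseteq> V \<Longrightarrow> D \<inter> T = {} \<Longrightarrow> cross_edges D T \<subseteq> inner_edges V"
  unfolding cross_edges_def inner_edges_def by clarsimp blast
lemma inj_cross_edges: "D \<inter> T = {} \<Longrightarrow> inj_on (\<lambda>(a, b). {a, b}) (D \<times> T)"
  by (auto simp: inj_on_def doubleton_eq_iff)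
lemma card_cross_edges: "D \<inter> T = {} \<Longrightarrow> card (cross_edges D T) = card D * card T"
  unfolding cross_edges_def by (simp add: card_image[OF inj_cross_edges] card_cartesian_product)

section \<open>Independence of events depending on disjoint edge sets\<close>

text \<open>The value type is arbitrary, so that set-valued objects such as cores and local clusters
  are covered as well as events. The condition ranges over all configurations and mentions no
  sigma-algebra; for finite edge sets, measurability of events follows from it.\<close>

definition depends_on :: "'e set \<Rightarrow> (('e \<Rightarrow> bool) \<Rightarrow> 'b) \<Rightarrow> bool" where
  "depends_on E X \<longleftrightarrow> (\<forall>\<omega> \<omega>'. (\<forall>e\<in>E. \<omega> e = \<omega>' e) \<longrightarrow> X \<omega> = X \<omega>')"

lemma depends_onI:
  assumes "\<And>\<omega> \<omega>'. (\<And>e. e \<in> E \<Longrightarrow> \<omega> e = \<omega>' e) \<Longrightarrow> X \<omega> = X \<omega>'"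
  shows "depends_on E X"
  unfolding depends_on_def by (intro allI impI, rule assms) simp
lemma depends_onD:
  assumes "depends_on E X" "\<And>e. e \<in> E \<Longrightarrow> \<omega> e = \<omega>' e" shows "X \<omega> = X \<omega>'"
  by (rule assms(1)[unfolded depends_on_def, rule_format]) (rule assms(2))
lemma depends_on_restrict: "depends_on E X \<Longrightarrow> X (restrict \<omega> E) = X \<omega>"
  by (erule depends_onD) simp
lemma depends_on_of_restrict: "depends_on E (\<lambda>\<omega>. f (restrict \<omega> E))"
proof (rule depends_onI)
  fix \<omega> \<omega>' :: "'a \<Rightarrow> bool" assume "\<And>e. e \<in> E \<Longrightarrow> \<omega> e = \<omega>' e"
  then have "restrict \<omega> E = restrict \<omega>' E" by (rule restrict_ext)
  then show "f (restrict \<omega> E) = f (restrict \<omega>' E)" by simp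
qed
lemma depends_on_mono:
  assumes "depends_on E X" "E \<subseteq> F" shows "depends_on F X"
  by (rule depends_onI, rule depends_onD[OF assms(1)]) (use assms(2) in auto)
lemma depends_on_edge: "e \<in> E \<Longrightarrow> depends_on E (\<lambda>\<omega>. \<omega> e)" by (simp add: depends_on_def)
lemma depends_on_comp:
  assumes "depends_on E X" shows "depends_on E (\<lambda>\<omega>. f (X \<omega>))"
  by (rule depends_onI, rule arg_cong[where f=f], rule depends_onD[OF assms])
lemma depends_on_comp2:
  assumes "depends_on E X" "depends_on E Y" shows "depends_on E (\<lambda>\<omega>. f (X \<omega>) (Y \<omega>))"
  by (rule depends_onI, rule arg_cong2[where f=f], rule depends_onD[OF assms(1)], assumption, rule depends_onD[OF assms(2)])
lemmas depends_on_conj = depends_on_comp2[where f = "(\<and>)"]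
lemmas depends_on_not = depends_on_comp[where f = Not]
lemma depends_on_all:
  assumes "\<And>i. i \<in> I \<Longrightarrow> depends_on E (X i)" shows "depends_on E (\<lambda>\<omega>. \<forall>i\<in>I. X i \<omega>)"
  by (rule depends_onI, rule ball_cong[OF refl], rule depends_onD[OF assms])
lemma depends_on_ex:
  assumes "\<And>i. i \<in> I \<Longrightarrow> depends_on E (X i)" shows "depends_on E (\<lambda>\<omega>. \<exists>i\<in>I. X i \<omega>)"
  by (rule depends_onI, rule bex_cong[OF refl], rule depends_onD[OF assms])

section \<open>The product measure on edge configurations\<close>

locale hperc =
  fixes N :: nat and c :: "nat \<Rightarrow> real"
  assumes N2: "N \<ge> 2" and c_nonneg: "\<And>k. 1 \<le> k \<Longrightarrow> 0 \<le> c k"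
begin

abbreviation "p e \<equiv> edge_prob N c (edist e)"

sublocale prob_space "perc_space N c"
  unfolding perc_space_def by (rule prob_space_PiM) (rule measure_pmf.prob_space_axioms)

lemma N1: "N \<ge> 1" using N2 by simp
lemma zero_seq_in [simp]: "zero_seq \<in> Omega N" using zero_seq_Omega[OF N1] .

lemma edist_pos: "e \<in> edges N \<Longrightarrow> 1 \<le> edist e"
  using hdist_pos unfolding edges_def by (clarsimp simp: edist_pair)

lemma p_range: "e \<in> edges N \<Longrightarrow> 0 \<le> p e \<and> p e \<le> 1"
  using c_nonneg[OF edist_pos] by (auto simp: edge_prob_def)

lemma measurable_edge [measurable]:
  "e \<in> edges N \<Longrightarrow> Measurable.pred (perc_space N c) (\<lambda>\<omega>. \<omega> e)"
  unfolding perc_space_def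
  using measurable_component_singleton[of e "edges N" "\<lambda>e. measure_pmf (bernoulli_pmf (p e))"] by simp

lemma prob_edge:
  assumes "e \<in> edges N"
  shows "prob {\<omega> \<in> space (perc_space N c). \<omega> e} = p e"
proof -
  have *: "distr (perc_space N c) (measure_pmf (bernoulli_pmf (p e))) (\<lambda>\<omega>. \<omega> e) = measure_pmf (bernoulli_pmf (p e))"
    unfolding perc_space_def
    by (rule distr_PiM_component) (auto simp: assms measure_pmf.prob_space_axioms)
  have "p e = measure (measure_pmf (bernoulli_pmf (p e))) {True}"
    using p_range[OF assms] by (simp add: measure_pmf_single)
  also have "\<dots> = prob ((\<lambda>\<omega>. \<omega> e) -` {True} \<inter> space (perc_space N c))"
    by (subst *[symmetric], subst measure_distr) (use measurable_edge[OF assms] in auto)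
  finally show ?thesis by (simp add: vimage_def Int_def conj_commute)
qed

text \<open>On the product space the map to all coordinates is the identity, and each marginal is
  the corresponding factor; hence the joint law is the product of the marginals.\<close>

lemma indep_edges: "indep_vars (\<lambda>e. measure_pmf (bernoulli_pmf (p e))) (\<lambda>e \<omega>. \<omega> e) (edges N)"
proof (cases "edges N = {}")
  case True then show ?thesis by (simp add: indep_vars_def indep_sets_def)
next
  case False
  have *: "distr (perc_space N c) (measure_pmf (bernoulli_pmf (p e))) (\<lambda>\<omega>. \<omega> e) = measure_pmf (bernoulli_pmf (p e))"
    if "e \<in> edges N" for e
    unfolding perc_space_def
    by (rule distr_PiM_component) (auto simp: that measure_pmf.prob_space_axioms)
  have "distr (perc_space N c) (PiM (edges N) (\<lambda>e. measure_pmf (bernoulli_pmf (p e)))) (\<lambda>x. restrict x (edges N))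
     = distr (perc_space N c) (perc_space N c) (\<lambda>x. x)"
    by (rule distr_cong) (auto simp: perc_space_def space_PiM PiE_restrict)
  also have "\<dots> = PiM (edges N) (\<lambda>e. distr (perc_space N c) (measure_pmf (bernoulli_pmf (p e))) (\<lambda>\<omega>. \<omega> e))"
  proof -
    have "PiM (edges N) (\<lambda>e. distr (perc_space N c) (measure_pmf (bernoulli_pmf (p e))) (\<lambda>\<omega>. \<omega> e)) = perc_space N c"
      unfolding perc_space_def[of N c] by (rule PiM_cong) (simp_all add: *[unfolded perc_space_def])
    then show ?thesis by (simp add: distr_id)
  qed
  finally show ?thesis
    using measurable_edge by (subst indep_vars_iff_distr_eq_PiM'[OF False]) (auto simp: restrict_def)
qed

text \<open>Over a finite edge set there are finitely many configurations and each singleton is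
  measurable, so an arbitrary predicate is measurable.\<close>

lemma depends_on_sets_PiM:
  assumes "finite E" 
  shows "{f \<in> space (PiM E (\<lambda>e. measure_pmf (bernoulli_pmf (p e)))). P f} \<in> sets (PiM E (\<lambda>e. measure_pmf (bernoulli_pmf (p e))))"
proof -
  let ?M = "PiM E (\<lambda>e. measure_pmf (bernoulli_pmf (p e)))"
  have sp: "space ?M = PiE E (\<lambda>_. UNIV)" by (simp add: space_PiM)
  have fin: "finite (PiE E (\<lambda>_. UNIV :: bool set))" using assms by (simp add: finite_PiE)
  have sing: "{f} \<in> sets ?M" if "f \<in> PiE E (\<lambda>_. UNIV)" for f
  proof -
    have "PiE E (\<lambda>e. {f e}) \<in> sets ?M" using assms by (intro sets_PiM_I_finite) auto
    then show ?thesis using that PiE_singleton[of f E] by (auto simp: PiE_def)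
  qed
  have "{f \<in> space ?M. P f} = (\<Union>f\<in>{f \<in> PiE E (\<lambda>_. UNIV). P f}. {f})" by (auto simp: sp)
  also have "\<dots> \<in> sets ?M" using fin sing by (intro sets.finite_UN) auto
  finally show ?thesis .
qed

lemma indep_depends_on:
  assumes "depends_on E P" "depends_on F Q" "finite E" "finite F" "E \<subseteq> edges N" "F \<subseteq> edges N" "E \<inter> F = {}"
  shows "prob {\<omega> \<in> space (perc_space N c). P \<omega> \<and> Q \<omega>} =
    prob {\<omega> \<in> space (perc_space N c). P \<omega>} * prob {\<omega> \<in> space (perc_space N c). Q \<omega>}"
proof -
  let ?M' = "\<lambda>e. measure_pmf (bernoulli_pmf (p e))"
  have iv: "indep_var (PiM E ?M') (\<lambda>\<omega>. restrict (\<lambda>e. \<omega> e) E) (PiM F ?M') (\<lambda>\<omega>. restrict (\<lambda>e. \<omega> e) F)"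
    using assms by (intro indep_var_restrict[OF indep_edges]) auto
  have P: "P (restrict \<omega> E) = P \<omega>" and Q: "Q (restrict \<omega> F) = Q \<omega>" for \<omega>
    using assms(1,2) by (simp_all add: depends_on_restrict)
  show ?thesis
    using indep_varD[OF iv depends_on_sets_PiM[OF assms(3), of P] depends_on_sets_PiM[OF assms(4), of Q]]
    by (simp add: vimage_def Int_def P Q space_PiM conj_commute)
qed

lemma depends_on_measurable [intro]:
  assumes "depends_on E P" "finite E" "E \<subseteq> edges N"
  shows "{\<omega> \<in> space (perc_space N c). P \<omega>} \<in> events"
proof -
  let ?M' = "\<lambda>e. measure_pmf (bernoulli_pmf (p e))"
  have m: "(\<lambda>\<omega>. restrict \<omega> E) \<in> measurable (perc_space N c) (PiM E ?M')"
    unfolding perc_space_def by (rule measurable_restrict_subset) fact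
  have P: "P (restrict \<omega> E) = P \<omega>" for \<omega>
    using assms(1) by (rule depends_on_restrict)
  show ?thesis
    using measurable_sets[OF m depends_on_sets_PiM[OF assms(2), of P]]
    by (simp add: vimage_def Int_def P space_PiM conj_commute)
qed

text \<open>Conditioning on the edges in $E$: the random object $X$ is frozen while the edges in $F$ stay random.\<close>

lemma cond_bound:
  assumes A: "depends_on E A" and X: "depends_on E X" and Q: "\<And>\<omega>. A \<omega> \<Longrightarrow> depends_on F (Q (X \<omega>))"
    and fin: "finite E" "finite F" "E \<subseteq> edges N" "F \<subseteq> edges N" "E \<inter> F = {}"
    and r: "\<And>\<omega>. A \<omega> \<Longrightarrow> prob {\<omega>' \<in> space (perc_space N c). Q (X \<omega>) \<omega>'} \<le> r"
  shows "prob {\<omega> \<in> space (perc_space N c). A \<omega> \<and> Q (X \<omega>) \<omega>} \<le> r * prob {\<omega> \<in> space (perc_space N c). A \<omega>}"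
proof -
  let ?S = "space (perc_space N c)"
  \<comment> \<open>The finitely many configurations on \<open>E\<close> that satisfy
    \<open>A\<close>. On each of them \<open>X\<close> is constant, so the event splits into
    disjoint pieces whose probabilities factor.\<close>
  define K where "K = {f \<in> PiE E (\<lambda>_. UNIV :: bool set). A f}"
  have K: "finite K" unfolding K_def using fin(1) by (simp add: finite_PiE)
  have d: "depends_on E (\<lambda>\<omega>. restrict \<omega> E = f)" for f by (rule depends_on_of_restrict)
  have Ar: "A (restrict \<omega> E) = A \<omega>" and Xr: "X (restrict \<omega> E) = X \<omega>" for \<omega>
    using A X by (simp_all add: depends_on_restrict)
  have m1: "{\<omega> \<in> ?S. restrict \<omega> E = f} \<in> events" for f
    by (rule depends_on_measurable[OF d fin(1,3)])
  have QF: "depends_on F (Q (X f))" if "f \<in> K" for f using Q that by (auto simp: K_def)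
  have m2: "{\<omega> \<in> ?S. restrict \<omega> E = f \<and> Q (X f) \<omega>} \<in> events" if "f \<in> K" for f
    using sets.Int[OF m1[of f] depends_on_measurable[OF QF[OF that] fin(2,4)]]
    by (simp add: Int_def conj_ac cong: conj_cong)
  have "prob {\<omega> \<in> ?S. A \<omega> \<and> Q (X \<omega>) \<omega>} = prob (\<Union>f\<in>K. {\<omega> \<in> ?S. restrict \<omega> E = f \<and> Q (X f) \<omega>})"
    by (rule arg_cong[where f=prob]) (auto simp: K_def Ar Xr)
  also have "\<dots> = (\<Sum>f\<in>K. prob {\<omega> \<in> ?S. restrict \<omega> E = f \<and> Q (X f) \<omega>})"
    using m2 by (intro finite_measure_finite_Union K) (auto simp: disjoint_family_on_def)
  also have "\<dots> = (\<Sum>f\<in>K. prob {\<omega> \<in> ?S. restrict \<omega> E = f} * prob {\<omega> \<in> ?S. Q (X f) \<omega>})"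
    by (intro sum.cong refl indep_depends_on[OF d QF]) (use fin in auto)
  also have "\<dots> \<le> (\<Sum>f\<in>K. prob {\<omega> \<in> ?S. restrict \<omega> E = f} * r)"
    by (intro sum_mono mult_left_mono r) (auto simp: K_def)
  also have "\<dots> = r * (\<Sum>f\<in>K. prob {\<omega> \<in> ?S. restrict \<omega> E = f})"
    by (simp add: sum_distrib_left mult.commute)
  also have "(\<Sum>f\<in>K. prob {\<omega> \<in> ?S. restrict \<omega> E = f}) = prob (\<Union>f\<in>K. {\<omega> \<in> ?S. restrict \<omega> E = f})"
    using m1 by (intro finite_measure_finite_Union[symmetric] K) (auto simp: disjoint_family_on_def)
  also have "(\<Union>f\<in>K. {\<omega> \<in> ?S. restrict \<omega> E = f}) = {\<omega> \<in> ?S. A \<omega>}"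
    by (auto simp: K_def Ar)
  finally show ?thesis .
qed

lemma prob_no_edge:
  assumes "finite F" "F \<subseteq> edges N"
  shows "prob {\<omega> \<in> space (perc_space N c). \<forall>e\<in>F. \<not> \<omega> e} = (\<Prod>e\<in>F. 1 - p e)"
  using assms
proof (induction F rule: finite_induct)
  case empty then show ?case by (simp add: prob_space)
next
  case (insert e F)
  have "prob {\<omega> \<in> space (perc_space N c). \<forall>e\<in>insert e F. \<not> \<omega> e}
    = prob {\<omega> \<in> space (perc_space N c). \<not> \<omega> e \<and> (\<forall>e\<in>F. \<not> \<omega> e)}" by simp
  also have "\<dots> = prob {\<omega> \<in> space (perc_space N c). \<not> \<omega> e} * prob {\<omega> \<in> space (perc_space N c). \<forall>e\<in>F. \<not> \<omega> e}"
    using insert by (intro indep_depends_on[of "{e}" _ F]) (auto simp: depends_on_def)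
  also have "prob {\<omega> \<in> space (perc_space N c). \<not> \<omega> e} = 1 - p e"
    using prob_neg[OF depends_on_measurable[OF depends_on_edge], of e "{e}"] insert prob_edge[of e] by simp
  finally show ?case using insert by simp
qed

text \<open>The usual bound 1 - x \<le> exp(-x) survives the truncation at 1, because then the left
  side is zero.\<close>

lemma p_exp: "1 - edge_prob N c k \<le> exp (- (c k / real N ^ (2 * k)))"
  using exp_ge_add_one_self[of "- (c k / real N ^ (2 * k))"]
  by (cases "c k / real N ^ (2 * k) \<le> 1") (auto simp: edge_prob_def min_def)

lemma prob_no_edge_le:
  assumes "finite F" "F \<subseteq> edges N" "\<And>e. e \<in> F \<Longrightarrow> q \<le> c (edist e) / real N ^ (2 * edist e)"
  shows "prob {\<omega> \<in> space (perc_space N c). \<forall>e\<in>F. \<not> \<omega> e} \<le> exp (- (q * card F))"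
proof -
  have "(\<Prod>e\<in>F. 1 - p e) \<le> (\<Prod>e\<in>F. exp (- q))"
  proof (rule prod_mono, intro conjI)
    fix e assume e: "e \<in> F"
    show "0 \<le> 1 - p e" using p_range assms e by auto
    have "1 - p e \<le> exp (- (c (edist e) / real N ^ (2 * edist e)))" by (rule p_exp)
    also have "\<dots> \<le> exp (- q)" using assms(3)[OF e] by simp
    finally show "1 - p e \<le> exp (- q)" .
  qed
  also have "\<dots> = exp (- (q * card F))" by (simp add: exp_of_nat_mult[symmetric] mult.commute)
  finally show ?thesis using prob_no_edge[OF assms(1,2)] by simp
qed

end

section \<open>Open connections inside a finite vertex set\<close>

text \<open>The shell is a disjoint union of spheres, and the sphere of radius j has N^j - N^(j-1)
  points. This is the common source of the degree bounds and of the isolation estimate.\<close>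

lemma sum_shell:
  fixes h :: "nat \<Rightarrow> real"
  assumes a: "a \<in> Omega N"
  shows "(\<Sum>b\<in>hball N l a - hball N k a. h (hdist a b)) = (\<Sum>j\<in>{k<..l}. real (N ^ j - N ^ (j - 1)) * h j)"
proof -
  have "hball N l a - hball N k a = (\<Union>j\<in>{k<..l}. hsphere N j a)"
  proof (intro equalityI subsetI)
    fix b assume "b \<in> hball N l a - hball N k a"
    then have b: "b \<in> Omega N" "b \<in> hball N l a" "b \<notin> hball N k a" using hball_sub_Omega by auto
    then have "k < hdist a b" "hdist a b \<le> l" using hdist_le_iff[OF a b(1)] by (auto simp: not_le[symmetric])
    then show "b \<in> (\<Union>j\<in>{k<..l}. hsphere N j a)" using b by (auto simp: hsphere_def)
  next
    fix b assume "b \<in> (\<Union>j\<in>{k<..l}. hsphere N j a)"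
    then have b: "b \<in> Omega N" "k < hdist a b" "hdist a b \<le> l" by (auto simp: hsphere_def)
    then show "b \<in> hball N l a - hball N k a" using hdist_le_iff[OF a b(1)] by (auto simp: not_le[symmetric])
  qed
  then have "(\<Sum>b\<in>hball N l a - hball N k a. h (hdist a b)) = (\<Sum>j\<in>{k<..l}. \<Sum>b\<in>hsphere N j a. h (hdist a b))"
    by (simp only:) (rule sum.UNION_disjoint, simp, use finite_hsphere[OF a] in blast, auto simp: hsphere_def)
  also have "\<dots> = (\<Sum>j\<in>{k<..l}. real (N ^ j - N ^ (j - 1)) * h j)"
  proof (rule sum.cong[OF refl])
    fix j assume "j \<in> {k<..l}"
    then obtain i where i: "j = Suc i" by (cases j) auto
    have "(\<Sum>b\<in>hsphere N j a. h (hdist a b)) = (\<Sum>b\<in>hsphere N j a. h j)" by (rule sum.cong) (auto simp: hsphere_def)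
    then show "(\<Sum>b\<in>hsphere N j a. h (hdist a b)) = real (N ^ j - N ^ (j - 1)) * h j"
      using card_hsphere[OF a, of i] i by simp
  qed
  finally show ?thesis .
qed

definition open_rel :: "(nat \<Rightarrow> nat) set \<Rightarrow> ((nat \<Rightarrow> nat) set \<Rightarrow> bool) \<Rightarrow> ((nat \<Rightarrow> nat) \<times> (nat \<Rightarrow> nat)) set" where
  "open_rel V \<omega> = {(a, b). a \<in> V \<and> b \<in> V \<and> a \<noteq> b \<and> \<omega> {a, b}}"

text \<open>The local substitute for \<open>cluster\<close>: for finite \<open>V\<close> it depends
  on finitely many edges. By reflexivity a point is connected to itself even outside
  \<open>V\<close>.\<close>

definition conn_in :: "(nat \<Rightarrow> nat) set \<Rightarrow> ((nat \<Rightarrow> nat) set \<Rightarrow> bool) \<Rightarrow> (nat \<Rightarrow> nat) \<Rightarrow> (nat \<Rightarrow> nat) \<Rightarrow> bool" where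
  "conn_in V \<omega> x y \<longleftrightarrow> (x, y) \<in> (open_rel V \<omega>)\<^sup>*"

lemma depends_on_open_rel: "depends_on (inner_edges V) (open_rel V)"
proof (rule depends_onI)
  fix \<omega> \<omega>' :: "(nat \<Rightarrow> nat) set \<Rightarrow> bool" assume *: "\<And>e. e \<in> inner_edges V \<Longrightarrow> \<omega> e = \<omega>' e"
  have "\<omega> {a, b} = \<omega>' {a, b}" if "a \<in> V" "b \<in> V" "a \<noteq> b" for a b
    using that by (intro *) (auto simp: inner_edges_def)
  then show "open_rel V \<omega> = open_rel V \<omega>'" by (auto simp: open_rel_def)
qed

lemma depends_on_conn_in: "depends_on (inner_edges V) (\<lambda>\<omega>. conn_in V \<omega> x y)"
  unfolding conn_in_def by (rule depends_on_comp[OF depends_on_open_rel])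

lemma conn_in_refl [simp]: "conn_in V \<omega> x x" by (simp add: conn_in_def)

lemma conn_in_start: "conn_in V \<omega> x y \<Longrightarrow> x \<noteq> y \<Longrightarrow> x \<in> V"
  unfolding conn_in_def by (erule converse_rtranclE) (auto simp: open_rel_def)

text \<open>Cutting a path at its last visit to $x$ leaves a connection that does not use the edges at $x$,
  hence is independent of them.\<close>

lemma conn_in_first_step:
  assumes "conn_in V \<omega> x y" "x \<noteq> y"
  shows "\<exists>z\<in>V - {x}. \<omega> {x, z} \<and> conn_in (V - {x}) \<omega> z y"
proof -
  \<comment> \<open>Generalised to every starting point \<open>u\<close>, for an induction backwards
    from \<open>y\<close>: either \<open>x\<close> has not been met yet, or the step after its last
    visit has been recorded.\<close>
  have "conn_in (V - {x}) \<omega> u y \<or> (\<exists>z\<in>V - {x}. \<omega> {x, z} \<and> conn_in (V - {x}) \<omega> z y)"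
    if "(u, y) \<in> (open_rel V \<omega>)\<^sup>*" for u
    using that
  proof (induction rule: converse_rtrancl_induct)
    case base then show ?case by simp
  next
    case (step u v)
    show ?case
    proof (cases "\<exists>z\<in>V - {x}. \<omega> {x, z} \<and> conn_in (V - {x}) \<omega> z y")
      case False
      with step have v: "conn_in (V - {x}) \<omega> v y" by blast
      then have "v \<noteq> x" using conn_in_start[OF v] assms(2) by auto
      with step(1) have v': "v \<in> V - {x}" "u \<in> V" "u \<noteq> v" "\<omega> {u, v}" by (auto simp: open_rel_def)
      have "u \<noteq> x" using False v v' by blast
      then have "(u, v) \<in> open_rel (V - {x}) \<omega>" using v' by (simp add: open_rel_def)
      then have "conn_in (V - {x}) \<omega> u y" using v unfolding conn_in_def by (rule converse_rtrancl_into_rtrancl)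
      then show ?thesis by simp
    qed simp
  qed
  moreover have "\<not> conn_in (V - {x}) \<omega> x y" using conn_in_start[of "V - {x}" \<omega> x y] assms(2) by auto
  ultimately show ?thesis using assms(1) unfolding conn_in_def by blast
qed

lemma open_rel_adjacent: "V \<subseteq> Omega N \<Longrightarrow> open_rel V \<omega> \<subseteq> {(a, b). adjacent N \<omega> a b}"
  by (auto simp: open_rel_def adjacent_def)

lemma conn_in_cluster: "V \<subseteq> Omega N \<Longrightarrow> conn_in V \<omega> x y \<Longrightarrow> y \<in> cluster N \<omega> x"
  unfolding conn_in_def cluster_def mem_Collect_eq by (rule subsetD[OF rtrancl_mono[OF open_rel_adjacent]])

text \<open>Otherwise every open path from \<open>x\<close> would stay in \<open>V\<close>, and the
  cluster would be contained in a finite set. The point \<open>a\<close> is reached inside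
  \<open>V\<close>, hence is determined independently of the edges leaving \<open>V\<close>.\<close>

lemma cluster_exit:
  assumes "finite V" "x \<in> V" "V \<subseteq> Omega N" "infinite (cluster N \<omega> x)"
  shows "\<exists>a\<in>V. conn_in V \<omega> x a \<and> (\<exists>b\<in>Omega N - V. \<omega> {a, b})"
proof (rule ccontr)
  assume no: "\<not> ?thesis"
  have "y \<in> V \<and> conn_in V \<omega> x y" if "(x, y) \<in> {(a, b). adjacent N \<omega> a b}\<^sup>*" for y
    using that
  proof (induction rule: rtrancl_induct)
    case base then show ?case using assms by simp
  next
    case (step y z)
    then have "adjacent N \<omega> y z" by simp
    then have *: "y \<noteq> z" "z \<in> Omega N" "\<omega> {y, z}" by (auto simp: adjacent_def)
    then have "z \<in> V" using no step by blast
    then have "(y, z) \<in> open_rel V \<omega>" using * step by (simp add: open_rel_def)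
    then show ?case using step \<open>z \<in> V\<close> unfolding conn_in_def by (auto intro: rtrancl_into_rtrancl)
  qed
  then have "cluster N \<omega> x \<subseteq> V" by (auto simp: cluster_def)
  then show False using assms finite_subset by blast
qed

context hperc begin

text \<open>The intersection of covers with probabilities at most 1/(n+1) is a null set. In this
  form an almost sure property needs no measurability of its own.\<close>

lemma AE_of_small:
  assumes "\<And>\<epsilon>::real. \<epsilon> > 0 \<Longrightarrow> \<exists>B\<in>events. prob B \<le> \<epsilon> \<and> {\<omega> \<in> space (perc_space N c). \<not> P \<omega>} \<subseteq> B"
  shows "AE \<omega> in perc_space N c. P \<omega>"
proof -
  have "\<exists>B\<in>events. prob B \<le> 1 / real (Suc n) \<and> {\<omega> \<in> space (perc_space N c). \<not> P \<omega>} \<subseteq> B" for n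
    by (rule assms) simp
  then have "\<forall>n. \<exists>B. B \<in> events \<and> prob B \<le> 1 / real (Suc n) \<and> {\<omega> \<in> space (perc_space N c). \<not> P \<omega>} \<subseteq> B"
    by blast
  from choice[OF this] obtain B where B: "\<And>n. B n \<in> events" "\<And>n. prob (B n) \<le> 1 / real (Suc n)"
    "\<And>n. {\<omega> \<in> space (perc_space N c). \<not> P \<omega>} \<subseteq> B n" by blast
  let ?I = "\<Inter>n. B n"
  have I: "?I \<in> events" using B(1) by auto
  have "prob ?I \<le> 1 / real (Suc n)" for n
    using finite_measure_mono[of ?I "B n"] B[of n] by (auto intro: order_trans)
  then have "prob ?I \<le> 0"
    using LIMSEQ_le_const[OF LIMSEQ_inverse_real_of_nat, of "prob ?I"] by (auto simp: inverse_eq_divide)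
  then have "prob ?I = 0" using measure_nonneg[of "perc_space N c" ?I] by linarith
  then have "?I \<in> null_sets (perc_space N c)" using I by (auto simp: emeasure_eq_measure)
  then show ?thesis by (rule AE_I') (use B(3) in auto)
qed

lemma prob_ex_le:
  assumes "finite I" "\<And>i. i \<in> I \<Longrightarrow> {\<omega> \<in> space (perc_space N c). P i \<omega>} \<in> events"
  shows "prob {\<omega> \<in> space (perc_space N c). \<exists>i\<in>I. P i \<omega>} \<le> (\<Sum>i\<in>I. prob {\<omega> \<in> space (perc_space N c). P i \<omega>})"
proof -
  have "{\<omega> \<in> space (perc_space N c). \<exists>i\<in>I. P i \<omega>} = (\<Union>i\<in>I. {\<omega> \<in> space (perc_space N c). P i \<omega>})" by auto
  then show ?thesis using assms by (auto intro!: finite_measure_subadditive_finite)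
qed

lemma edge_pair: "a \<in> Omega N \<Longrightarrow> b \<in> Omega N \<Longrightarrow> a \<noteq> b \<Longrightarrow> {a, b} \<in> edges N"
  unfolding edges_def by (rule CollectI, rule exI[of _ a], rule exI[of _ b]) simp

lemma edge_measurable: "e \<in> edges N \<Longrightarrow> {\<omega> \<in> space (perc_space N c). \<omega> e} \<in> events"
  by (rule depends_on_measurable[of "{e}"]) (auto simp: depends_on_edge)

end

section \<open>Expected numbers of long edges\<close>

locale hperc_sum = hperc +
  assumes summ: "summable (\<lambda>j. c j / real N ^ j)"
begin

text \<open>Bounds the expected number of open edges of length greater than \<open>m\<close> at a
  vertex: at most N^j points lie at distance j, each joined with probability at most c_j / N^(2j).
  In particular \<open>edge_tail 0\<close> bounds the mean degree.\<close>

definition edge_tail :: "nat \<Rightarrow> real" where "edge_tail m = (\<Sum>j. c (j + Suc m) / real N ^ (j + Suc m))"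

lemma edge_tail_summable: "summable (\<lambda>j. c (j + Suc m) / real N ^ (j + Suc m))"
  using summable_ignore_initial_segment[OF summ, of "Suc m"] .

lemma edge_tail_nonneg: "0 \<le> edge_tail m" unfolding edge_tail_def
  by (rule suminf_nonneg[OF edge_tail_summable]) (simp add: c_nonneg)

lemma edge_tail_tendsto: "edge_tail \<longlonglongrightarrow> 0"
proof (rule LIMSEQ_I)
  fix r :: real assume "0 < r"
  from suminf_exist_split[OF this summ] obtain n0
    where n0: "\<And>n. n \<ge> n0 \<Longrightarrow> norm (\<Sum>i. c (i + n) / real N ^ (i + n)) < r" by auto
  show "\<exists>no. \<forall>n\<ge>no. norm (edge_tail n - 0) < r"
    by (rule exI[of _ n0]) (use n0 in \<open>auto simp: edge_tail_def simp del: add_Suc_right\<close>)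
qed

lemma sum_p_le:
  assumes a: "a \<in> Omega N" and B: "finite B" "B \<subseteq> Omega N" "\<And>b. b \<in> B \<Longrightarrow> m < hdist a b"
  shows "(\<Sum>b\<in>B. p {a, b}) \<le> edge_tail m"
proof -
  obtain l where l: "\<And>b. b \<in> B \<Longrightarrow> hdist a b \<le> l"
    using B(1) finite_nat_set_iff_bounded_le[of "hdist a ` B"] by auto
  define h where "h j = c j / real N ^ (2 * j)" for j
  have sub: "B \<subseteq> hball N l a - hball N m a"
  proof
    fix b assume b: "b \<in> B"
    then have "b \<in> Omega N" using B(2) by auto
    then show "b \<in> hball N l a - hball N m a"
      using l[OF b] B(3)[OF b] hdist_le_iff[OF a, of b] by (auto simp: not_le[symmetric])
  qed
  have h0: "0 \<le> h (hdist a b)" if "b \<in> hball N l a - hball N m a" for b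
  proof -
    have "b \<in> Omega N" using that hball_sub_Omega by auto
    then have "m < hdist a b" using that hdist_le_iff[OF a, of b m] by (auto simp: not_le[symmetric])
    then show ?thesis unfolding h_def by (intro divide_nonneg_nonneg c_nonneg) auto
  qed
  have "(\<Sum>b\<in>B. p {a, b}) \<le> (\<Sum>b\<in>B. h (hdist a b))"
    unfolding edist_pair edge_prob_def h_def by (rule sum_mono) simp
  also have "\<dots> \<le> (\<Sum>b\<in>hball N l a - hball N m a. h (hdist a b))"
    using sub h0 a by (intro sum_mono2) auto
  also have "\<dots> = (\<Sum>j\<in>{m<..l}. real (N ^ j - N ^ (j - 1)) * h j)" by (rule sum_shell[OF a])
  also have "\<dots> \<le> (\<Sum>j\<in>{m<..l}. c j / real N ^ j)"
  proof (rule sum_mono)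
    fix j assume "j \<in> {m<..l}"
    then have cj: "0 \<le> c j" by (intro c_nonneg) auto
    have "real (N ^ j - N ^ (j - 1)) \<le> real N ^ j" by (metis diff_le_self of_nat_le_iff of_nat_power)
    then have "real (N ^ j - N ^ (j - 1)) * h j \<le> real N ^ j * h j"
      using cj by (intro mult_right_mono) (auto simp: h_def)
    also have "\<dots> = c j / real N ^ j" using N2 by (simp add: h_def mult_2 power_add)
    finally show "real (N ^ j - N ^ (j - 1)) * h j \<le> c j / real N ^ j" .
  qed
  also have "\<dots> = (\<Sum>j<l - m. c (j + Suc m) / real N ^ (j + Suc m))"
    by (rule sum.reindex_bij_witness[of _ "\<lambda>j. j + Suc m" "\<lambda>j. j - Suc m"]) auto
  also have "\<dots> \<le> edge_tail m" unfolding edge_tail_def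
    by (rule sum_le_suminf[OF edge_tail_summable]) (auto simp: c_nonneg)
  finally show ?thesis .
qed

lemma exit_finite:
  assumes "a \<in> Omega N" "finite B" "B \<subseteq> Omega N" "\<And>b. b \<in> B \<Longrightarrow> m < hdist a b"
  shows "prob {\<omega> \<in> space (perc_space N c). \<exists>b\<in>B. \<omega> {a, b}} \<le> edge_tail m"
proof -
  have ne: "a \<noteq> b" if "b \<in> B" for b using assms(4)[OF that] by (auto simp: hdist_def)
  have "prob {\<omega> \<in> space (perc_space N c). \<exists>b\<in>B. \<omega> {a, b}}
    \<le> (\<Sum>b\<in>B. prob {\<omega> \<in> space (perc_space N c). \<omega> {a, b}})"
    using assms ne by (intro prob_ex_le edge_measurable edge_pair) auto
  also have "\<dots> = (\<Sum>b\<in>B. p {a, b})"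
    using assms ne by (intro sum.cong refl prob_edge edge_pair) auto
  also have "\<dots> \<le> edge_tail m" by (rule sum_p_le) (use assms in auto)
  finally show ?thesis .
qed

lemma far_measurable:
  assumes "a \<in> Omega N"
  shows "{\<omega> \<in> space (perc_space N c). \<exists>b\<in>Omega N. m < hdist a b \<and> \<omega> {a, b}} \<in> events"
proof -
  let ?B = "{b \<in> Omega N. m < hdist a b}"
  have "{\<omega> \<in> space (perc_space N c). \<exists>b\<in>Omega N. m < hdist a b \<and> \<omega> {a, b}}
     = (\<Union>b\<in>?B. {\<omega> \<in> space (perc_space N c). \<omega> {a, b}})" by auto
  also have "\<dots> \<in> events"
  proof (rule sets.countable_UN')
    show "countable ?B" by (rule countable_subset[OF _ countable_Omega[OF N1]]) auto
    show "(\<lambda>b. {\<omega> \<in> space (perc_space N c). \<omega> {a, b}}) ` ?B \<subseteq> events"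
    proof (rule image_subsetI)
      fix b assume "b \<in> ?B"
      then have "b \<in> Omega N" "a \<noteq> b" by (auto simp: hdist_def)
      then show "{\<omega> \<in> space (perc_space N c). \<omega> {a, b}} \<in> events"
        using assms by (intro edge_measurable edge_pair)
    qed
  qed
  finally show ?thesis .
qed

text \<open>Continuity from below along the balls of radius l around \<open>a\<close> extends the
  finite union bound to infinitely many targets.\<close>

lemma far_prob:
  assumes a: "a \<in> Omega N"
  shows "prob {\<omega> \<in> space (perc_space N c). \<exists>b\<in>Omega N. m < hdist a b \<and> \<omega> {a, b}} \<le> edge_tail m"
proof -
  define A where "A l = {\<omega> \<in> space (perc_space N c). \<exists>b\<in>hball N l a - hball N m a. \<omega> {a, b}}" for l
  have B: "hball N l a - hball N m a \<subseteq> Omega N" for l using hball_sub_Omega by auto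
  have far: "m < hdist a b" if "b \<in> hball N l a - hball N m a" for b l
  proof -
    have "b \<in> Omega N" using that B by auto
    then show ?thesis using that hdist_le_iff[OF a, of b m] by (auto simp: not_le[symmetric])
  qed
  have meas: "A l \<in> events" for l
  proof -
    have "A l = (\<Union>b\<in>hball N l a - hball N m a. {\<omega> \<in> space (perc_space N c). \<omega> {a, b}})"
      unfolding A_def by auto
    also have "\<dots> \<in> events" using a B hball_self[OF a]
      by (intro sets.finite_UN edge_measurable edge_pair) auto
    finally show ?thesis .
  qed
  have inc: "incseq A"
  proof (rule incseq_SucI)
    fix l have "hball N l a \<subseteq> hball N (Suc l) a" by (rule hball_mono) simp
    then show "A l \<subseteq> A (Suc l)" unfolding A_def by blast
  qed
  have "{\<omega> \<in> space (perc_space N c). \<exists>b\<in>Omega N. m < hdist a b \<and> \<omega> {a, b}} = (\<Union>l. A l)"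
  proof (intro equalityI subsetI)
    fix \<omega> assume "\<omega> \<in> {\<omega> \<in> space (perc_space N c). \<exists>b\<in>Omega N. m < hdist a b \<and> \<omega> {a, b}}"
    then obtain b where b: "b \<in> Omega N" "m < hdist a b" "\<omega> {a, b}" "\<omega> \<in> space (perc_space N c)" by auto
    then have "b \<in> hball N (hdist a b) a - hball N m a" using hdist_le_iff[OF a b(1)] by (auto simp: not_le[symmetric])
    then show "\<omega> \<in> (\<Union>l. A l)" using b unfolding A_def by blast
  qed (use B far in \<open>unfold A_def, blast\<close>)
  moreover have "prob (A l) \<le> edge_tail m" for l
    unfolding A_def by (rule exit_finite[OF a]) (use B far a in auto)
  then have "prob (\<Union>l. A l) \<le> edge_tail m"
    using LIMSEQ_le_const2[OF finite_Lim_measure_incseq[OF _ inc], of "edge_tail m"] meas by blast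
  ultimately show ?thesis by simp
qed

text \<open>Comparison with a branching process. A path from \<open>x\<close> to another point
  leaves \<open>x\<close> for the last time through some \<open>z\<close>, and the edge to
  \<open>z\<close> is independent of the connections in \<open>V - {x}\<close>. With w =
  \<open>edge_tail 0\<close>, induction on the size of \<open>V\<close> gives at most 1 + w / (1 -
  w) = 1 / (1 - w).\<close>

lemma expected_cluster_bound:
  assumes w1: "edge_tail 0 < 1" and "finite V" "V \<subseteq> Omega N" "x \<in> V"
  shows "(\<Sum>y\<in>V. prob {\<omega> \<in> space (perc_space N c). conn_in V \<omega> x y}) \<le> 1 / (1 - edge_tail 0)"
  using assms(2-)
proof (induction "card V" arbitrary: V x rule: less_induct)
  case less
  let ?P = "\<lambda>V x y. prob {\<omega> \<in> space (perc_space N c). conn_in V \<omega> x y}"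
  let ?V = "V - {x}"
  have xO: "x \<in> Omega N" using less by auto
  have fV: "finite ?V" "?V \<subseteq> Omega N" using less by auto
  have cV: "card ?V < card V" using less by (meson card_Diff1_less)
  have mc: "{\<omega> \<in> space (perc_space N c). \<omega> {x, z} \<and> conn_in ?V \<omega> z y} \<in> events"
    and ic: "prob {\<omega> \<in> space (perc_space N c). \<omega> {x, z} \<and> conn_in ?V \<omega> z y} = p {x, z} * ?P ?V z y"
    if z: "z \<in> ?V" for z y
  proof -
    have e: "{x, z} \<in> edges N" using z xO fV by (intro edge_pair) auto
    have "{x, z} \<notin> inner_edges ?V" using inner_edges_sub[of "{x,z}" ?V] by auto
    then have "prob {\<omega> \<in> space (perc_space N c). \<omega> {x, z} \<and> conn_in ?V \<omega> z y}
      = prob {\<omega> \<in> space (perc_space N c). \<omega> {x, z}} * ?P ?V z y"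
      using e fV by (intro indep_depends_on[OF depends_on_edge[of _ "{{x,z}}"] depends_on_conn_in]) (auto simp: finite_inner_edges dest: inner_edges_edges)
    then show "prob {\<omega> \<in> space (perc_space N c). \<omega> {x, z} \<and> conn_in ?V \<omega> z y} = p {x, z} * ?P ?V z y"
      using prob_edge[OF e] by simp
    have "depends_on (insert {x, z} (inner_edges ?V)) (\<lambda>\<omega>. \<omega> {x, z} \<and> conn_in ?V \<omega> z y)"
      by (intro depends_on_conj depends_on_edge depends_on_mono[OF depends_on_conn_in]) auto
    then show "{\<omega> \<in> space (perc_space N c). \<omega> {x, z} \<and> conn_in ?V \<omega> z y} \<in> events"
      by (rule depends_on_measurable) (use e fV in \<open>auto simp: finite_inner_edges dest: inner_edges_edges\<close>)
  qed
  have step: "?P V x y \<le> (\<Sum>z\<in>?V. p {x, z} * ?P ?V z y)" if y: "y \<in> ?V" for y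
  proof -
    have "?P V x y \<le> prob {\<omega> \<in> space (perc_space N c). \<exists>z\<in>?V. \<omega> {x, z} \<and> conn_in ?V \<omega> z y}"
    proof (rule finite_measure_mono)
      show "{\<omega> \<in> space (perc_space N c). conn_in V \<omega> x y}
        \<subseteq> {\<omega> \<in> space (perc_space N c). \<exists>z\<in>?V. \<omega> {x, z} \<and> conn_in ?V \<omega> z y}"
        using conn_in_first_step y by blast
      have "{\<omega> \<in> space (perc_space N c). \<exists>z\<in>?V. \<omega> {x, z} \<and> conn_in ?V \<omega> z y} =
        (\<Union>z\<in>?V. {\<omega> \<in> space (perc_space N c). \<omega> {x, z} \<and> conn_in ?V \<omega> z y})" by auto
      then show "{\<omega> \<in> space (perc_space N c). \<exists>z\<in>?V. \<omega> {x, z} \<and> conn_in ?V \<omega> z y} \<in> events"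
        by (simp only:) (rule sets.finite_UN[OF fV(1)], rule mc)
    qed
    also have "\<dots> \<le> (\<Sum>z\<in>?V. prob {\<omega> \<in> space (perc_space N c). \<omega> {x, z} \<and> conn_in ?V \<omega> z y})"
      by (rule prob_ex_le) (use fV mc in auto)
    finally show ?thesis using ic by simp
  qed
  have pnn: "0 \<le> p {x, z}" if "z \<in> ?V" for z
    using p_range[OF edge_pair[OF xO, of z]] that fV by auto
  have "(\<Sum>y\<in>V. ?P V x y) = ?P V x x + (\<Sum>y\<in>?V. ?P V x y)"
    using less by (simp add: sum.remove)
  also have "\<dots> \<le> 1 + (\<Sum>y\<in>?V. \<Sum>z\<in>?V. p {x, z} * ?P ?V z y)"
    by (intro add_mono sum_mono step) auto
  also have "(\<Sum>y\<in>?V. \<Sum>z\<in>?V. p {x, z} * ?P ?V z y) = (\<Sum>z\<in>?V. p {x, z} * (\<Sum>y\<in>?V. ?P ?V z y))"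
    by (subst sum.swap) (simp add: sum_distrib_left)
  also have "\<dots> \<le> (\<Sum>z\<in>?V. p {x, z} * (1 / (1 - edge_tail 0)))"
    using less(1)[OF cV fV] pnn by (intro sum_mono mult_left_mono) auto
  also have "\<dots> = (\<Sum>z\<in>?V. p {x, z}) * (1 / (1 - edge_tail 0))" by (simp only: sum_distrib_right)
  also have "\<dots> \<le> edge_tail 0 * (1 / (1 - edge_tail 0))"
  proof (intro mult_right_mono sum_p_le xO fV)
    fix b assume b: "b \<in> ?V"
    have "1 \<le> hdist x b" by (rule hdist_pos[OF xO]) (use b fV in auto)
    then show "0 < hdist x b" by simp
  qed (use w1 in auto)
  also have "1 + edge_tail 0 * (1 / (1 - edge_tail 0)) = 1 / (1 - edge_tail 0)" using w1 by (simp add: field_simps)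
  finally show ?case by simp
qed

end

section \<open>Long edges and isolated balls\<close>

text \<open>By the ultrametric property \<open>a\<close> may serve as the centre of the
  ball.\<close>

lemma hdist_gt:
  assumes "N \<ge> 1" "a \<in> hball N m zero_seq" "b \<in> Omega N" "b \<notin> hball N m zero_seq"
  shows "m < hdist a b"
proof (rule ccontr)
  assume "\<not> m < hdist a b"
  moreover have "a \<in> Omega N" using assms(2) hball_sub_Omega by auto
  ultimately have "b \<in> hball N m a" using hdist_le_iff[of a N b m] assms(3) by simp
  then show False using hball_eq[OF assms(2)] assms(4) by simp
qed

context hperc_sum begin

lemma far_ball:
  shows "{\<omega> \<in> space (perc_space N c). \<exists>a\<in>hball N k zero_seq. \<exists>b\<in>Omega N. m < hdist a b \<and> \<omega> {a, b}} \<in> events"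
  and "prob {\<omega> \<in> space (perc_space N c). \<exists>a\<in>hball N k zero_seq. \<exists>b\<in>Omega N. m < hdist a b \<and> \<omega> {a, b}}
      \<le> real N ^ k * edge_tail m"
proof -
  have O: "a \<in> Omega N" if "a \<in> hball N k zero_seq" for a using that hball_sub_Omega by auto
  have "{\<omega> \<in> space (perc_space N c). \<exists>a\<in>hball N k zero_seq. \<exists>b\<in>Omega N. m < hdist a b \<and> \<omega> {a, b}}
    = (\<Union>a\<in>hball N k zero_seq. {\<omega> \<in> space (perc_space N c). \<exists>b\<in>Omega N. m < hdist a b \<and> \<omega> {a, b}})"
    by blast
  also have "\<dots> \<in> events" by (rule sets.finite_UN) (simp_all add: far_measurable O)
  finally show "{\<omega> \<in> space (perc_space N c). \<exists>a\<in>hball N k zero_seq. \<exists>b\<in>Omega N. m < hdist a b \<and> \<omega> {a, b}} \<in> events" .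
  have "prob {\<omega> \<in> space (perc_space N c). \<exists>a\<in>hball N k zero_seq. \<exists>b\<in>Omega N. m < hdist a b \<and> \<omega> {a, b}}
    \<le> (\<Sum>a\<in>hball N k zero_seq. prob {\<omega> \<in> space (perc_space N c). \<exists>b\<in>Omega N. m < hdist a b \<and> \<omega> {a, b}})"
    by (rule prob_ex_le) (simp_all add: far_measurable O)
  also have "\<dots> \<le> (\<Sum>a\<in>hball N k zero_seq. edge_tail m)" by (rule sum_mono) (simp add: far_prob O)
  also have "\<dots> = real N ^ k * edge_tail m" by (simp add: card_hball)
  finally show "prob {\<omega> \<in> space (perc_space N c). \<exists>a\<in>hball N k zero_seq. \<exists>b\<in>Omega N. m < hdist a b \<and> \<omega> {a, b}}
      \<le> real N ^ k * edge_tail m" .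
qed

theorem no_percolation_subcritical:
  assumes w1: "edge_tail 0 < 1"
  shows "no_percolation N c"
  unfolding no_percolation_def
proof (rule AE_of_small)
  fix \<epsilon> :: real assume \<epsilon>: "\<epsilon> > 0"
  define S where "S = space (perc_space N c)"
  \<comment> \<open>\<open>k\<close> is chosen against the bounded expected cluster size 1 / (1 -
    \<open>edge_tail 0\<close>). Only \<open>L\<close>, chosen afterwards, has to beat the full
    volume N^k.\<close>
  have "eventually (\<lambda>k. edge_tail k < (1 - edge_tail 0) * (\<epsilon> / 2)) sequentially"
    using w1 \<epsilon> by (intro order_tendstoD[OF edge_tail_tendsto]) simp
  then obtain k where k: "edge_tail k < (1 - edge_tail 0) * (\<epsilon> / 2)" by (auto simp: eventually_sequentially)
  have N0: "real N ^ k > 0" using N2 by simp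
  then have "eventually (\<lambda>L. edge_tail L < \<epsilon> / 2 / real N ^ k) sequentially"
    using \<epsilon> by (intro order_tendstoD[OF edge_tail_tendsto]) simp
  then obtain L0 where "\<And>L. L \<ge> L0 \<Longrightarrow> edge_tail L < \<epsilon> / 2 / real N ^ k" by (auto simp: eventually_sequentially)
  then obtain L where L: "k \<le> L" "edge_tail L < \<epsilon> / 2 / real N ^ k" by (meson le_cases)
  define V where "V = hball N k zero_seq"
  define U where "U = hball N L zero_seq - hball N k zero_seq"
  have V: "finite V" "V \<subseteq> Omega N" "zero_seq \<in> V" and U: "finite U" "U \<subseteq> Omega N" "U \<inter> V = {}"
    unfolding V_def U_def using hball_sub_Omega hball_self by auto
  define B1 where "B1 = {\<omega> \<in> S. \<exists>a\<in>V. conn_in V \<omega> zero_seq a \<and> (\<exists>b\<in>U. \<omega> {a, b})}"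
  define B2 where "B2 = {\<omega> \<in> S. \<exists>a\<in>V. \<exists>b\<in>Omega N. L < hdist a b \<and> \<omega> {a, b}}"
  have dU: "depends_on (cross_edges {a} U) (\<lambda>\<omega>. \<exists>b\<in>U. \<omega> {a, b})" for a
    by (intro depends_on_ex depends_on_edge) (auto simp: cross_edges_def)
  have inner_edges: "finite (inner_edges V)" "inner_edges V \<subseteq> edges N" using V by (simp_all add: finite_inner_edges inner_edges_edges)
  have cross_edges: "finite (cross_edges {a} U)" "cross_edges {a} U \<subseteq> edges N" "inner_edges V \<inter> cross_edges {a} U = {}" if "a \<in> V" for a
  proof -
    show "finite (cross_edges {a} U)" by (rule finite_cross_edges) (simp_all add: U)
    show "cross_edges {a} U \<subseteq> edges N" by (rule cross_edges_edges) (use that V U in blast)+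
    show "inner_edges V \<inter> cross_edges {a} U = {}" by (rule inner_edges_cross_edges_disj) (rule U)
  qed
  have meas: "{\<omega> \<in> S. conn_in V \<omega> zero_seq a \<and> (\<exists>b\<in>U. \<omega> {a, b})} \<in> events" if "a \<in> V" for a
  proof -
    have "depends_on (inner_edges V \<union> cross_edges {a} U) (\<lambda>\<omega>. conn_in V \<omega> zero_seq a \<and> (\<exists>b\<in>U. \<omega> {a, b}))"
      by (intro depends_on_conj depends_on_mono[OF depends_on_conn_in] depends_on_mono[OF dU]) auto
    then show ?thesis unfolding S_def by (rule depends_on_measurable) (use inner_edges cross_edges[OF that] in auto)
  qed
  have "prob B1 \<le> (\<Sum>a\<in>V. prob {\<omega> \<in> S. conn_in V \<omega> zero_seq a \<and> (\<exists>b\<in>U. \<omega> {a, b})})"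
    unfolding B1_def S_def by (rule prob_ex_le[OF V(1)]) (use meas in \<open>simp add: S_def\<close>)
  also have "\<dots> = (\<Sum>a\<in>V. prob {\<omega> \<in> S. conn_in V \<omega> zero_seq a} * prob {\<omega> \<in> S. \<exists>b\<in>U. \<omega> {a, b}})"
    unfolding S_def by (intro sum.cong refl indep_depends_on[OF depends_on_conn_in dU]) (use inner_edges cross_edges in auto)
  also have "\<dots> \<le> (\<Sum>a\<in>V. prob {\<omega> \<in> S. conn_in V \<omega> zero_seq a} * edge_tail k)"
  proof (intro sum_mono mult_left_mono)
    fix a assume a: "a \<in> V"
    have "k < hdist a b" if "b \<in> U" for b
      using hdist_gt[OF N1, of a k b] a that hball_sub_Omega unfolding U_def V_def by auto
    then show "prob {\<omega> \<in> S. \<exists>b\<in>U. \<omega> {a, b}} \<le> edge_tail k"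
      unfolding S_def using a V U by (intro exit_finite) auto
  qed simp
  also have "\<dots> = (\<Sum>a\<in>V. prob {\<omega> \<in> S. conn_in V \<omega> zero_seq a}) * edge_tail k" by (simp only: sum_distrib_right)
  also have "\<dots> \<le> 1 / (1 - edge_tail 0) * edge_tail k"
    unfolding S_def by (intro mult_right_mono expected_cluster_bound w1 V edge_tail_nonneg)
  also have "\<dots> \<le> \<epsilon> / 2" using k w1 by (simp add: field_simps)
  finally have P1: "prob B1 \<le> \<epsilon> / 2" .
  have "prob B2 \<le> real N ^ k * edge_tail L" unfolding B2_def S_def V_def by (rule far_ball(2))
  also have "\<dots> \<le> \<epsilon> / 2" using L(2) N0 by (simp add: field_simps)
  finally have P2: "prob B2 \<le> \<epsilon> / 2" .
  have B2: "B2 \<in> events" unfolding B2_def S_def V_def by (rule far_ball(1))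
  have "B1 = (\<Union>a\<in>V. {\<omega> \<in> S. conn_in V \<omega> zero_seq a \<and> (\<exists>b\<in>U. \<omega> {a, b})})" unfolding B1_def by blast
  then have B1: "B1 \<in> events" using meas V(1) by (simp only:) (rule sets.finite_UN)
  show "\<exists>B\<in>events. prob B \<le> \<epsilon> \<and> {\<omega> \<in> space (perc_space N c). \<not> finite (cluster N \<omega> zero_seq)} \<subseteq> B"
  proof (intro bexI[of _ "B1 \<union> B2"] conjI subsetI)
    show "prob (B1 \<union> B2) \<le> \<epsilon>" using measure_Un_le[OF B1 B2] P1 P2 by simp
    show "B1 \<union> B2 \<in> events" using B1 B2 by blast
    fix \<omega> assume "\<omega> \<in> {\<omega> \<in> space (perc_space N c). \<not> finite (cluster N \<omega> zero_seq)}"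
    then have \<omega>: "\<omega> \<in> S" "infinite (cluster N \<omega> zero_seq)" by (auto simp: S_def)
    obtain a b where ab: "a \<in> V" "conn_in V \<omega> zero_seq a" "b \<in> Omega N - V" "\<omega> {a, b}"
      using cluster_exit[OF V(1,3,2) \<omega>(2)] by blast
    show "\<omega> \<in> B1 \<union> B2"
    proof (cases "b \<in> U")
      case True then show ?thesis using ab \<omega> by (auto simp: B1_def)
    next
      case False
      then have "b \<notin> hball N L zero_seq" using ab by (auto simp: U_def V_def)
      then have "L < hdist a b" using ab hball_mono[OF L(1), of N zero_seq]
        by (intro hdist_gt[OF N1]) (auto simp: V_def)
      then show ?thesis using ab \<omega> by (auto simp: B2_def)
    qed
  qed
qed

text \<open>If no edge joins the ball of radius g i to the next annulus and none skips that annulus,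
  the ball is isolated and the cluster of the origin is finite. The first term bounds the
  probability (1 - q)^L that no annulus is free of such edges, the second is the union bound for the
  skipping edges.\<close>

lemma isolated_cover:
  fixes g L :: nat
  assumes q: "0 \<le> q" "\<And>i. i \<in> {1..L} \<Longrightarrow>
     q \<le> (\<Prod>e\<in>cross_edges (hball N (g * i) zero_seq) (hball N (g * Suc i) zero_seq - hball N (g * i) zero_seq). 1 - p e)"
  shows "\<exists>B\<in>events. prob B \<le> exp (- q * L) + (\<Sum>i\<in>{1..L}. real N ^ (g * i) * edge_tail (g * Suc i)) \<and>
    {\<omega> \<in> space (perc_space N c). \<not> finite (cluster N \<omega> zero_seq)} \<subseteq> B"
proof -
  define S where "S = space (perc_space N c)"
  define V where "V i = hball N (g * i) zero_seq" for i
  define X where "X i = cross_edges (V i) (V (Suc i) - V i)" for i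
  define F where "F i \<omega> \<longleftrightarrow> (\<forall>e\<in>X i. \<not> \<omega> e)" for i and \<omega> :: "(nat \<Rightarrow> nat) set \<Rightarrow> bool"
  have V: "finite (V i)" "V i \<subseteq> Omega N" "zero_seq \<in> V i" for i
    unfolding V_def using hball_sub_Omega hball_self by auto
  have Vm: "V i \<subseteq> V j" if "i \<le> j" for i j unfolding V_def by (rule hball_mono) (simp add: that)
  have X: "finite (X i)" "X i \<subseteq> edges N" "inner_edges (V i) \<inter> X i = {}" for i
  proof -
    show "finite (X i)" unfolding X_def by (rule finite_cross_edges) (simp_all add: V)
    show "X i \<subseteq> edges N" unfolding X_def by (rule cross_edges_edges) (use V in blast)+
    show "inner_edges (V i) \<inter> X i = {}" unfolding X_def by (rule inner_edges_cross_edges_disj) blast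
  qed
  have XE: "X i \<subseteq> inner_edges (V j)" if "Suc i \<le> j" for i j
    unfolding X_def using Vm[OF that] Vm[of i j] that by (intro cross_edges_inner_edges) auto
  have inner_edges: "finite (inner_edges (V i))" "inner_edges (V i) \<subseteq> edges N" for i using V by (simp_all add: finite_inner_edges inner_edges_edges)
  have dF: "depends_on (X i) (F i)" for i unfolding F_def by (intro depends_on_all depends_on_not depends_on_edge)
  \<comment> \<open>The edges used by the first \<open>n\<close> annuli lie inside
    \<open>V (Suc n)\<close>, so they are disjoint from \<open>X (Suc n)\<close>; this drives the
    product bound.\<close>
  have dn: "depends_on (inner_edges (V (Suc n))) (\<lambda>\<omega>. \<forall>i\<in>{1..n}. \<not> F i \<omega>)" for n
    by (intro depends_on_all depends_on_not depends_on_mono[OF dF] XE) auto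
  have PF: "q \<le> prob {\<omega> \<in> S. F i \<omega>}" if "i \<in> {1..L}" for i
    using q(2)[OF that] prob_no_edge[OF X(1,2), of i] by (simp add: F_def S_def X_def V_def)
  have ind: "prob {\<omega> \<in> S. \<forall>i\<in>{1..n}. \<not> F i \<omega>} \<le> exp (- q) ^ n" if "n \<le> L" for n
    using that
  proof (induction n)
    case 0 then show ?case by simp
  next
    case (Suc n)
    have m: "{\<omega> \<in> S. F (Suc n) \<omega>} \<in> events" unfolding S_def by (rule depends_on_measurable[OF dF X(1,2)])
    have "{\<omega> \<in> S. \<forall>i\<in>{1..Suc n}. \<not> F i \<omega>} = {\<omega> \<in> S. (\<forall>i\<in>{1..n}. \<not> F i \<omega>) \<and> \<not> F (Suc n) \<omega>}"
      by (auto simp: atLeastAtMostSuc_conv)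
    then have "prob {\<omega> \<in> S. \<forall>i\<in>{1..Suc n}. \<not> F i \<omega>} = prob {\<omega> \<in> S. \<forall>i\<in>{1..n}. \<not> F i \<omega>} * prob {\<omega> \<in> S. \<not> F (Suc n) \<omega>}"
      unfolding S_def
      using indep_depends_on[OF dn depends_on_not[OF dF] inner_edges(1) X(1) inner_edges(2) X(2,3), of n] by simp
    also have "prob {\<omega> \<in> S. \<not> F (Suc n) \<omega>} = 1 - prob {\<omega> \<in> S. F (Suc n) \<omega>}"
      using prob_neg m unfolding S_def by blast
    also have "prob {\<omega> \<in> S. \<forall>i\<in>{1..n}. \<not> F i \<omega>} * (1 - prob {\<omega> \<in> S. F (Suc n) \<omega>}) \<le> exp (- q) ^ n * exp (- q)"
    proof (intro mult_mono)
      show "prob {\<omega> \<in> S. \<forall>i\<in>{1..n}. \<not> F i \<omega>} \<le> exp (- q) ^ n" using Suc by simp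
      show "1 - prob {\<omega> \<in> S. F (Suc n) \<omega>} \<le> exp (- q)"
        using PF[of "Suc n"] Suc.prems exp_ge_add_one_self[of "- q"] by simp
    qed simp_all
    finally show ?case by (simp add: mult.commute)
  qed
  define B1 where "B1 = {\<omega> \<in> S. \<forall>i\<in>{1..L}. \<not> F i \<omega>}"
  define G where "G i = {\<omega> \<in> S. \<exists>a\<in>V i. \<exists>b\<in>Omega N. g * Suc i < hdist a b \<and> \<omega> {a, b}}" for i
  have B1: "B1 \<in> events" unfolding B1_def S_def by (rule depends_on_measurable[OF dn inner_edges])
  have P1: "prob B1 \<le> exp (- q * L)"
    using ind[of L] unfolding B1_def by (simp add: exp_of_nat_mult[symmetric] mult.commute)
  have G: "G i \<in> events" "prob (G i) \<le> real N ^ (g * i) * edge_tail (g * Suc i)" for i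
    unfolding G_def S_def V_def by (rule far_ball)+
  define B2 where "B2 = (\<Union>i\<in>{1..L}. G i)"
  have B2: "B2 \<in> events" unfolding B2_def by (rule sets.finite_UN) (simp_all add: G)
  have "prob B2 \<le> (\<Sum>i\<in>{1..L}. prob (G i))"
    unfolding B2_def by (rule finite_measure_subadditive_finite) (use G in auto)
  also have "\<dots> \<le> (\<Sum>i\<in>{1..L}. real N ^ (g * i) * edge_tail (g * Suc i))" by (rule sum_mono) (rule G)
  finally have P2: "prob B2 \<le> (\<Sum>i\<in>{1..L}. real N ^ (g * i) * edge_tail (g * Suc i))" .
  show ?thesis
  proof (intro bexI[of _ "B1 \<union> B2"] conjI subsetI)
    show "prob (B1 \<union> B2) \<le> exp (- q * L) + (\<Sum>i\<in>{1..L}. real N ^ (g * i) * edge_tail (g * Suc i))"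
      using measure_Un_le[OF B1 B2] P1 P2 by linarith
    show "B1 \<union> B2 \<in> events" using B1 B2 by blast
    fix \<omega> assume "\<omega> \<in> {\<omega> \<in> space (perc_space N c). \<not> finite (cluster N \<omega> zero_seq)}"
    then have \<omega>: "\<omega> \<in> S" "infinite (cluster N \<omega> zero_seq)" by (auto simp: S_def)
    show "\<omega> \<in> B1 \<union> B2"
    proof (rule ccontr)
      assume no: "\<omega> \<notin> B1 \<union> B2"
      then obtain i where i: "i \<in> {1..L}" "F i \<omega>" using \<omega> by (auto simp: B1_def)
      obtain a b where ab: "a \<in> V i" "b \<in> Omega N - V i" "\<omega> {a, b}"
        using cluster_exit[OF V(1,3,2) \<omega>(2), of i] by blast
      have "b \<notin> V (Suc i)"
      proof
        assume "b \<in> V (Suc i)"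
        then have "{a, b} \<in> X i" using ab unfolding X_def cross_edges_def by blast
        then show False using i(2) ab by (auto simp: F_def)
      qed
      then have "g * Suc i < hdist a b" using ab Vm[of i "Suc i"]
        by (intro hdist_gt[OF N1]) (auto simp: V_def)
      then have "\<omega> \<in> G i" using ab \<omega> by (auto simp: G_def)
      then show False using no i by (auto simp: B2_def)
    qed
  qed
qed

end

section \<open>Absence of percolation for the weights of the theorem\<close>

text \<open>Eventually j^\<alpha> \<le> (3/2)^j, and N \<ge> 2 leaves a geometric series of ratio
  3/4. The logarithm is dominated by j.\<close>

lemma summable_ck_aux:
  fixes N :: nat assumes "N \<ge> 2"
  shows "summable (\<lambda>j. real j powr \<alpha> / real N ^ j)" "summable (\<lambda>j. ln (real j) / real N ^ j)"
    "summable (\<lambda>j. 1 / real N ^ j)" "summable (\<lambda>j. real j / real N ^ j)"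
proof -
  show pw: "summable (\<lambda>j. real j powr \<alpha> / real N ^ j)" for \<alpha>
  proof (rule summable_comparison_test_ev)
    show "summable (\<lambda>j. (3/4::real) ^ j)" by (rule summable_geometric) simp
    have "((\<lambda>j::nat. ln (real j) / real j) \<longlongrightarrow> 0) sequentially" by real_asymp
    from tendsto_mult_left[OF this, of \<alpha>]
    have "((\<lambda>j::nat. \<alpha> * (ln (real j) / real j)) \<longlongrightarrow> 0) sequentially" by simp
    then have ev: "eventually (\<lambda>j. \<alpha> * (ln (real j) / real j) < ln (3/2)) sequentially"
      by (rule order_tendstoD) simp
    show "eventually (\<lambda>j. norm (real j powr \<alpha> / real N ^ j) \<le> (3/4) ^ j) sequentially"
    proof (rule eventually_mono[OF eventually_conj[OF ev eventually_gt_at_top[of 0]]])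
      fix j :: nat assume j: "\<alpha> * (ln (real j) / real j) < ln (3/2) \<and> 0 < j"
      then have "\<alpha> * ln (real j) \<le> real j * ln (3/2)" by (auto simp: divide_less_eq mult.commute)
      then have "real j powr \<alpha> \<le> exp (real j * ln (3/2))" using j by (simp add: powr_def)
      also have "\<dots> = (3/2) ^ j" by (simp add: exp_of_nat_mult)
      finally have "real j powr \<alpha> / real N ^ j \<le> (3/2) ^ j / 2 ^ j"
        using assms by (intro frac_le power_mono) auto
      also have "\<dots> = (3/4) ^ j" by (simp add: power_divide[symmetric])
      finally show "norm (real j powr \<alpha> / real N ^ j) \<le> (3/4) ^ j" by simp
    qed
  qed
  show s1: "summable (\<lambda>j. real j / real N ^ j)" using pw[of 1] by simp
  have "summable (\<lambda>j. (1 / real N) ^ j)" by (rule summable_geometric) (use assms in simp)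
  then show "summable (\<lambda>j. 1 / real N ^ j)" by (simp add: power_divide)
  show "summable (\<lambda>j. ln (real j) / real N ^ j)"
  proof (rule summable_comparison_test'[OF s1, of 1])
    fix j :: nat assume "1 \<le> j"
    then have "0 \<le> ln (real j)" "ln (real j) \<le> real j" using ln_le_minus_one[of "real j"] by auto
    then show "norm (ln (real j) / real N ^ j) \<le> real j / real N ^ j"
      by (simp add: divide_right_mono)
  qed
qed

lemma ck_nonneg:
  assumes "C0 \<ge> 0" "C1 \<ge> 0" "C2 \<ge> 0" "1 \<le> k" shows "0 \<le> ck C0 C1 C2 \<alpha> k"
  using assms by (auto simp: ck_def intro!: add_nonneg_nonneg mult_nonneg_nonneg)

lemma hperc_sum_ck:
  assumes "N \<ge> 2" "C0 \<ge> 0" "C1 \<ge> 0" "C2 \<ge> 0"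
  shows "hperc_sum N (ck C0 C1 C2 \<alpha>)"
proof
  show "N \<ge> 2" by fact
  show "0 \<le> ck C0 C1 C2 \<alpha> k" if "1 \<le> k" for k using ck_nonneg assms that by blast
  have "summable (\<lambda>j. C0 * (1 / real N ^ j) + C1 * (ln (real j) / real N ^ j) + C2 * (real j powr \<alpha> / real N ^ j))"
    by (intro summable_add summable_mult summable_ck_aux assms)
  then show "summable (\<lambda>j. ck C0 C1 C2 \<alpha> j / real N ^ j)"
    by (simp add: ck_def add_divide_distrib)
qed

text \<open>\<open>edge_tail 0\<close> is at most the largest of the three constants times a series
  \<open>K\<close> independent of them. The bound 1 / (K + 1) keeps the product below one and makes
  sense even if \<open>K\<close> is zero.\<close>

theorem no_percolation_small_constants:
  fixes N :: nat assumes N: "N \<ge> 2"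
  shows "\<exists>Cs>0. \<forall>C0 C1 C2::real. C0 \<ge> 0 \<and> C1 \<ge> 0 \<and> C2 \<ge> 0 \<and> max C0 (max C1 C2) < Cs \<longrightarrow>
           no_percolation N (ck C0 C1 C2 \<alpha>)"
proof -
  define f where "f j = (1 + ln (real j) + real j powr \<alpha>) / real N ^ j" for j
  have f: "summable f"
    using summable_add[OF summable_add[OF summable_ck_aux(3,2)[OF N]] summable_ck_aux(1)[OF N, of \<alpha>]]
    unfolding f_def by (simp add: add_divide_distrib)
  then have f1: "summable (\<lambda>j. f (j + Suc 0))" by (rule summable_ignore_initial_segment)
  define K where "K = (\<Sum>j. f (j + Suc 0))"
  have K: "K \<ge> 0" unfolding K_def by (rule suminf_nonneg[OF f1]) (auto simp: f_def intro!: divide_nonneg_nonneg add_nonneg_nonneg)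
  show ?thesis
  proof (intro exI[of _ "1 / (K + 1)"] conjI allI impI)
    show "0 < 1 / (K + 1)" using K by simp
    fix C0 C1 C2 :: real
    assume C: "0 \<le> C0 \<and> 0 \<le> C1 \<and> 0 \<le> C2 \<and> max C0 (max C1 C2) < 1 / (K + 1)"
    interpret hperc_sum N "ck C0 C1 C2 \<alpha>" using C N by (intro hperc_sum_ck) auto
    define D where "D = max C0 (max C1 C2)"
    have D: "C0 \<le> D" "C1 \<le> D" "C2 \<le> D" "0 \<le> D" "D < 1 / (K + 1)"
      using C by (auto simp: D_def)
    have "edge_tail 0 \<le> (\<Sum>j. D * f (j + Suc 0))"
      unfolding edge_tail_def
    proof (rule suminf_le[OF _ edge_tail_summable summable_mult[OF f1]])
      fix j :: nat
      let ?i = "j + Suc 0"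
      have "ck C0 C1 C2 \<alpha> ?i \<le> D * 1 + D * ln (real ?i) + D * real ?i powr \<alpha>"
        unfolding ck_def using D by (intro add_mono mult_right_mono) auto
      then show "ck C0 C1 C2 \<alpha> ?i / real N ^ ?i \<le> D * f ?i"
        unfolding f_def times_divide_eq_right by (intro divide_right_mono) (auto simp: algebra_simps)
    qed
    also have "\<dots> = D * K" unfolding K_def by (rule suminf_mult[OF f1])
    also have "\<dots> < 1" using D K by (simp add: field_simps)
    finally show "no_percolation N (ck C0 C1 C2 \<alpha>)" by (rule no_percolation_subcritical)
  qed
qed

text \<open>The first sum carries the sphere-to-ball ratio 1 - 1/N and telescopes. Its sharp
  constant 1/N becomes the threshold C_1 < N; for the second sum, which contributes only to bounded
  terms, the worst case N = 2 is enough.\<close>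

lemma sum_geom_bounds:
  fixes N :: nat assumes "N \<ge> 2"
  shows "(\<Sum>i=1..n. (1 - 1 / real N) / real N ^ i) \<le> 1 / real N"
    and "(\<Sum>i=1..n. real i / real N ^ i) \<le> 2"
proof -
  have "(\<Sum>i=1..n. (1 - 1 / real N) / real N ^ i) = 1 / real N - 1 / real N ^ Suc n"
  proof (induction n)
    case 0 then show ?case by simp
  next
    case (Suc n)
    then have "(\<Sum>i=1..Suc n. (1 - 1 / real N) / real N ^ i) =
      1 / real N - 1 / real N ^ Suc n + (1 - 1 / real N) / real N ^ Suc n" by simp
    then show ?case using assms by (simp add: field_simps)
  qed
  then show "(\<Sum>i=1..n. (1 - 1 / real N) / real N ^ i) \<le> 1 / real N" by simp
  have "(\<Sum>i=1..n. real i / real N ^ i) \<le> (\<Sum>i=1..n. real i / 2 ^ i)"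
    using assms power_mono[of 2 "real N"] by (intro sum_mono divide_left_mono) auto
  also have "\<dots> = 2 - (real n + 2) / 2 ^ n" by (induction n) (auto simp: field_simps)
  also have "\<dots> \<le> 2" by simp
  finally show "(\<Sum>i=1..n. real i / real N ^ i) \<le> 2" .
qed

text \<open>Reverses 1 - x \<le> exp(-x) at the price of a factor close to one in the exponent, so
  that a lower bound on the product costs only a slight change of its power of k.\<close>

lemma one_minus_exp_lower:
  fixes x \<delta> :: real assumes "0 \<le> x" "x \<le> \<delta>" "\<delta> \<le> 1/2"
  shows "exp (- (1 + 2 * \<delta>) * x) \<le> 1 - x"
proof -
  have "- x - 2 * x\<^sup>2 \<le> ln (1 - x)" using assms by (intro ln_one_minus_pos_lower_bound) auto
  moreover have "x * x \<le> \<delta> * x" using assms by (intro mult_right_mono) auto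
  ultimately have "- (1 + 2 * \<delta>) * x \<le> ln (1 - x)" by (simp add: power2_eq_square algebra_simps)
  then show ?thesis using assms by (simp add: ln_ge_iff)
qed

text \<open>The expected number of crossing edges is a sum over i of (1 - 1/N) / N^i times c at k +
  i, where the powers of N from the ball and the sphere cancel against the edge probability. The
  resulting bound does not depend on the outer radius \<open>l\<close>.\<close>

lemma isolation_product:
  fixes N k l :: nat
  assumes N: "N \<ge> 2" and C: "C0 \<ge> 0" "C1 \<ge> 0" and k: "1 \<le> k"
    and \<delta>: "\<delta> \<le> 1/2" "\<And>j. k < j \<Longrightarrow> ck C0 C1 0 \<alpha> j / real N ^ (2 * j) \<le> \<delta>"
  shows "exp (- (1 + 2 * \<delta>) * ((C0 + C1 * ln k) / N + 2 * C1))
     \<le> (\<Prod>e\<in>cross_edges (hball N k zero_seq) (hball N l zero_seq - hball N k zero_seq). 1 - edge_prob N (ck C0 C1 0 \<alpha>) (edist e))"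
proof -
  let ?c = "ck C0 C1 0 \<alpha>"
  let ?D = "hball N k zero_seq" and ?T = "hball N l zero_seq - hball N k zero_seq"
  have N1: "N \<ge> 1" using N by simp
  have z: "zero_seq \<in> Omega N" using zero_seq_Omega[OF N1] .
  define h where "h j = ?c j / real N ^ (2 * j)" for j
  have h0: "0 \<le> h j" if "1 \<le> j" for j unfolding h_def using ck_nonneg[of C0 C1 0 j \<alpha>] C that by simp
  have dist: "k < edist e" if e: "e \<in> cross_edges ?D ?T" for e
  proof -
    obtain a b where "e = {a, b}" "a \<in> ?D" "b \<in> ?T" using cross_edges_E[OF e] by blast
    then show ?thesis using hdist_gt[OF N1, of a k b] hball_sub_Omega by (auto simp: edist_pair)
  qed
  have \<delta>0: "0 \<le> \<delta>" using \<delta>(2)[of "Suc k"] h0[of "Suc k"] by (simp add: h_def)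
  have sumh: "(\<Sum>e\<in>cross_edges ?D ?T. h (edist e)) \<le> (C0 + C1 * ln k) / N + 2 * C1"
  proof -
    have "(\<Sum>e\<in>cross_edges ?D ?T. h (edist e)) = (\<Sum>x\<in>?D \<times> ?T. h (hdist (fst x) (snd x)))"
      unfolding cross_edges_def by (subst sum.reindex[OF inj_cross_edges]) (auto simp: edist_pair case_prod_beta intro!: sum.cong)
    also have "\<dots> = (\<Sum>a\<in>?D. \<Sum>b\<in>?T. h (hdist a b))"
      by (simp add: sum.cartesian_product case_prod_beta)
    also have "\<dots> = (\<Sum>a\<in>?D. \<Sum>j\<in>{k<..l}. real (N ^ j - N ^ (j - 1)) * h j)"
    proof (rule sum.cong[OF refl])
      fix a assume a: "a \<in> ?D"
      then have aO: "a \<in> Omega N" using hball_sub_Omega by auto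
      show "(\<Sum>b\<in>?T. h (hdist a b)) = (\<Sum>j\<in>{k<..l}. real (N ^ j - N ^ (j - 1)) * h j)"
      proof (cases "k \<le> l")
        case True
        then have "a \<in> hball N l zero_seq" using a hball_mono by blast
        then show ?thesis using sum_shell[OF aO, of h l k] hball_eq[OF a] hball_eq[of a N l zero_seq] by simp
      next
        case False
        then have T: "?T = {}" using hball_mono[of l k N zero_seq] by auto
        show ?thesis unfolding T using False by simp
      qed
    qed
    also have "\<dots> = (\<Sum>j\<in>{k<..l}. real N ^ k * (real (N ^ j - N ^ (j - 1)) * h j))"
      by (simp add: card_hball[OF z] sum_distrib_left)
    also have "\<dots> = (\<Sum>i=1..l-k. real N ^ k * (real (N ^ (k+i) - N ^ (k+i-1)) * h (k+i)))"
      by (rule sum.reindex_bij_witness[of _ "\<lambda>i. k + i" "\<lambda>j. j - k"]) auto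
    also have "\<dots> \<le> (\<Sum>i=1..l-k. (C0 + C1 * ln k) * ((1 - 1 / real N) / real N ^ i) + C1 * (real i / real N ^ i))"
    proof (rule sum_mono)
      fix i assume "i \<in> {1..l-k}"
      then obtain i' where i': "i = Suc i'" by (cases i) auto
      have "N ^ (k + i') \<le> N ^ (k + i)" using N i' by (intro power_increasing) auto
      then have r: "real (N ^ (k+i) - N ^ (k+i-1)) = real N ^ (k+i) * (1 - 1 / real N)"
        using N i' by (simp add: of_nat_diff field_simps)
      have eq: "real N ^ k * (real (N ^ (k+i) - N ^ (k+i-1)) * h (k+i)) = (1 - 1 / real N) / real N ^ i * ?c (k+i)"
        unfolding r using N by (simp add: h_def mult_2 power_add)
      \<comment> \<open>From k + i \<le> k (1 + i). The main part ln k is kept exactly, and only the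
        bounded correction is estimated crudely.\<close>
      have "ln (real (k + i)) \<le> ln (real k) + real i"
      proof -
        have "real (k + i) \<le> real k * (1 + real i)" using k by (simp add: algebra_simps mult_le_cancel_left1)
        then have "ln (real (k + i)) \<le> ln (real k * (1 + real i))" using k by simp
        also have "\<dots> = ln (real k) + ln (1 + real i)" using k by (simp add: ln_mult)
        also have "\<dots> \<le> ln (real k) + real i" using ln_add_one_self_le_self[of "real i"] by simp
        finally show ?thesis .
      qed
      then have "?c (k+i) \<le> (C0 + C1 * ln k) + C1 * real i"
        using C mult_left_mono[of "ln (real (k+i))" "ln (real k) + real i" C1] by (simp add: ck_def algebra_simps)
      then have "(1 - 1 / real N) / real N ^ i * ?c (k+i) \<le> (1 - 1 / real N) / real N ^ i * ((C0 + C1 * ln k) + C1 * real i)"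
        using N by (intro mult_left_mono) auto
      also have "\<dots> = (C0 + C1 * ln k) * ((1 - 1 / real N) / real N ^ i) + (1 - 1 / real N) * (C1 * (real i / real N ^ i))"
        by (simp add: algebra_simps add_divide_distrib diff_divide_distrib)
      also have "\<dots> \<le> (C0 + C1 * ln k) * ((1 - 1 / real N) / real N ^ i) + 1 * (C1 * (real i / real N ^ i))"
        using C by (intro add_left_mono mult_right_mono) auto
      finally show "real N ^ k * (real (N ^ (k+i) - N ^ (k+i-1)) * h (k+i))
        \<le> (C0 + C1 * ln k) * ((1 - 1 / real N) / real N ^ i) + C1 * (real i / real N ^ i)" using eq by simp
    qed
    also have "\<dots> = (C0 + C1 * ln k) * (\<Sum>i=1..l-k. (1 - 1 / real N) / real N ^ i) + C1 * (\<Sum>i=1..l-k. real i / real N ^ i)"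
      by (simp only: sum.distrib sum_distrib_left)
    also have "\<dots> \<le> (C0 + C1 * ln k) * (1 / real N) + C1 * 2"
      using C k by (intro add_mono mult_left_mono sum_geom_bounds N) auto
    finally show ?thesis by simp
  qed
  have "exp (- (1 + 2 * \<delta>) * ((C0 + C1 * ln k) / N + 2 * C1)) \<le> exp (- (1 + 2 * \<delta>) * (\<Sum>e\<in>cross_edges ?D ?T. h (edist e)))"
    using sumh \<delta>0 by (subst exp_le_cancel_iff, intro mult_left_mono_neg) auto
  also have "\<dots> = (\<Prod>e\<in>cross_edges ?D ?T. exp (- (1 + 2 * \<delta>) * h (edist e)))"
    using z by (subst exp_sum[symmetric]) (auto simp: sum_distrib_left intro!: finite_cross_edges)
  also have "\<dots> \<le> (\<Prod>e\<in>cross_edges ?D ?T. 1 - edge_prob N ?c (edist e))"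
  proof (rule prod_mono, intro conjI)
    fix e assume e: "e \<in> cross_edges ?D ?T"
    have hd: "h (edist e) \<le> \<delta>" unfolding h_def by (rule \<delta>(2)[OF dist[OF e]])
    then have "edge_prob N ?c (edist e) = h (edist e)" using \<delta>(1) by (simp add: edge_prob_def h_def)
    moreover have "0 \<le> h (edist e)" using dist[OF e] by (intro h0) simp
    ultimately show "exp (- (1 + 2 * \<delta>) * h (edist e)) \<le> 1 - edge_prob N ?c (edist e)"
      using one_minus_exp_lower[of "h (edist e)" \<delta>] hd \<delta>(1) by simp
  qed simp
  finally show ?thesis .
qed

text \<open>Estimating the logarithm linearly is affordable: the bound is used only after division
  by N^g, which beats any power of g.\<close>

lemma (in hperc_sum) edge_tail_log_bound:
  assumes c: "c = ck C0 C1 0 \<alpha>" and C: "C0 \<ge> 0" "C1 \<ge> 0"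
  shows "real N ^ m * edge_tail m \<le> C0 + C1 * m + 2 * C1"
proof -
  have p: "(\<Sum>j<n. c (j + Suc m) / real N ^ (j + Suc m)) \<le> (C0 + C1 * m + 2 * C1) / real N ^ m" for n
  proof -
    have "(\<Sum>j<n. c (j + Suc m) / real N ^ (j + Suc m)) \<le>
      (\<Sum>j<n. (((C0 + C1 * m) * (1 / real N ^ Suc j)) + C1 * (real (Suc j) / real N ^ Suc j)) / real N ^ m)"
    proof (rule sum_mono)
      fix j
      have "ln (real (j + Suc m)) \<le> real m + real (Suc j)"
        using ln_le_minus_one[of "real (j + Suc m)"] by simp
      then have "c (j + Suc m) \<le> C0 + C1 * (real m + real (Suc j))"
        unfolding c ck_def using C mult_left_mono[of "ln (real (j + Suc m))" "real m + real (Suc j)" C1] by simp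
      then have "c (j + Suc m) / real N ^ (j + Suc m) \<le> (C0 + C1 * (real m + real (Suc j))) / real N ^ (j + Suc m)"
        by (intro divide_right_mono) auto
      also have "\<dots> = (((C0 + C1 * m) * (1 / real N ^ Suc j)) + C1 * (real (Suc j) / real N ^ Suc j)) / real N ^ m"
        using N2 by (simp add: field_simps power_add)
      finally show "c (j + Suc m) / real N ^ (j + Suc m) \<le> \<dots>" .
    qed
    also have "\<dots> = ((C0 + C1 * m) * (\<Sum>j<n. 1 / real N ^ Suc j) + C1 * (\<Sum>j<n. real (Suc j) / real N ^ Suc j)) / real N ^ m"
      by (simp only: sum_divide_distrib[symmetric] sum.distrib sum_distrib_left)
    also have "(\<Sum>j<n. 1 / real N ^ Suc j) = (\<Sum>i=1..n. 1 / real N ^ i)"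
      by (rule sum.reindex_bij_witness[of _ "\<lambda>i. i - 1" Suc]) auto
    also have "(\<Sum>j<n. real (Suc j) / real N ^ Suc j) = (\<Sum>i=1..n. real i / real N ^ i)"
      by (rule sum.reindex_bij_witness[of _ "\<lambda>i. i - 1" Suc]) auto
    also have "((C0 + C1 * m) * (\<Sum>i=1..n. 1 / real N ^ i) + C1 * (\<Sum>i=1..n. real i / real N ^ i)) / real N ^ m
      \<le> ((C0 + C1 * m) * 1 + C1 * 2) / real N ^ m"
    proof (intro divide_right_mono add_mono mult_left_mono sum_geom_bounds N2)
      \<comment> \<open>For N \<ge> 2 one has 1/N \<le> 1 - 1/N, so the factor 1 - 1/N can be
        cancelled from the telescoped bound.\<close>
      have "(1 - 1 / real N) * (\<Sum>i=1..n. 1 / real N ^ i) \<le> 1 / real N"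
        using sum_geom_bounds(1)[OF N2, of n] by (simp add: sum_distrib_left)
      moreover have "1 / real N \<le> 1 - 1 / real N" using N2 by (simp add: field_simps)
      ultimately have "(1 - 1 / real N) * (\<Sum>i=1..n. 1 / real N ^ i) \<le> (1 - 1 / real N) * 1"
        by (simp only: mult_1_right)
      then show "(\<Sum>i=1..n. 1 / real N ^ i) \<le> 1"
        by (rule mult_left_le_imp_le) (use N2 in \<open>simp add: field_simps\<close>)
    qed (use C in auto)
    finally show ?thesis by (simp add: algebra_simps)
  qed
  have "edge_tail m \<le> (C0 + C1 * m + 2 * C1) / real N ^ m"
    unfolding edge_tail_def by (rule suminf_le_const[OF edge_tail_summable p])
  then show ?thesis using N2 by (simp add: field_simps)
qed

lemma power_over_exp2: "(\<lambda>g. real g ^ n / 2 ^ g) \<longlonglongrightarrow> 0"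
proof -
  have "(\<lambda>j. real j powr real n / real 2 ^ j) \<longlonglongrightarrow> 0"
    by (rule summable_LIMSEQ_zero[OF summable_ck_aux(1)]) simp
  then show ?thesis
    by (rule Lim_transform_eventually)
      (use eventually_gt_at_top[of 0] in \<open>rule eventually_mono, simp add: powr_realpow\<close>)
qed

theorem no_percolation_log_weights:
  fixes N :: nat assumes N: "N \<ge> 2" and C: "C0 \<ge> 0" "C1 \<ge> 0" "C1 < real N"
  shows "no_percolation N (ck C0 C1 0 \<alpha>)"
proof -
  interpret hperc_sum N "ck C0 C1 0 \<alpha>" using C N by (intro hperc_sum_ck) auto
  define \<theta> where "\<theta> = C1 / real N"
  have \<theta>: "0 \<le> \<theta>" "\<theta> < 1" using C N by (auto simp: \<theta>_def)
  \<comment> \<open>The loss in \<open>one_minus_exp_lower\<close> turns the exponent \<theta> into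
    \<theta>' = (1 + 2\<delta>) \<theta>. With this \<delta> it is at most (1 + \<theta>) / 2, still
    below one.\<close>
  define \<delta> where "\<delta> = (1 - \<theta>) / 4"
  have \<delta>: "0 < \<delta>" "\<delta> \<le> 1/2" using \<theta> by (auto simp: \<delta>_def)
  define \<theta>' where "\<theta>' = (1 + 2 * \<delta>) * \<theta>"
  have "2 * \<delta> * \<theta> \<le> 2 * \<delta> * 1" using \<theta> \<delta> by (intro mult_left_mono) auto
  then have "\<theta>' \<le> \<theta> + 2 * \<delta>" by (simp add: \<theta>'_def algebra_simps)
  then have \<theta>': "\<theta>' < 1" using \<theta> unfolding \<delta>_def by (simp add: field_simps)
  \<comment> \<open>Equivalently P - \<theta>' (P + 1) \<ge> 1. With g^P radii, the largest being
    g^(P+1), the sum of the isolation probabilities is then at least of order g.\<close>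
  obtain P :: nat where P: "1 + \<theta>' \<le> real P * (1 - \<theta>')"
    using reals_Archimedean3[of "1 - \<theta>'"] \<theta>' by (metis diff_gt_0_iff_gt less_imp_le)
  define A where "A = (1 + 2 * \<delta>) * (C0 / N + 2 * C1)"
  define bound where "bound g = exp (- exp (- A) * real g) +
    ((C0 + 2 * C1) * (real g ^ P / 2 ^ g) + C1 * (real g ^ (P + 1) / 2 ^ g) + C1 * (real g ^ (2 * P + 1) / 2 ^ g))" for g :: nat
  have "(\<lambda>g. exp (- exp (- A) * real g)) \<longlonglongrightarrow> 0"
  proof -
    have "exp (- A) > 0" by simp
    then have "filterlim (\<lambda>g. exp (- A) * real g) at_top sequentially"
      by (intro filterlim_tendsto_pos_mult_at_top[OF tendsto_const _ filterlim_real_sequentially])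
    then have "filterlim (\<lambda>g. - (exp (- A) * real g)) at_bot sequentially"
      by (simp add: filterlim_uminus_at_bot)
    then show ?thesis using filterlim_compose[OF exp_at_bot] by fastforce
  qed
  then have "bound \<longlonglongrightarrow> 0 + ((C0 + 2 * C1) * 0 + C1 * 0 + C1 * 0)"
    unfolding bound_def by (intro tendsto_add tendsto_mult tendsto_const power_over_exp2)
  then have lim: "bound \<longlonglongrightarrow> 0" by simp
  have "(\<lambda>j. ck C0 C1 0 \<alpha> j / real N ^ j) \<longlonglongrightarrow> 0" by (rule summable_LIMSEQ_zero[OF summ])
  \<comment> \<open>Beyond radius g0 every edge probability is at most \<delta>, as the exponential
    lower bound requires.\<close>
  from order_tendstoD(2)[OF this \<delta>(1)] obtain g0
    where g0: "\<And>j. j \<ge> g0 \<Longrightarrow> ck C0 C1 0 \<alpha> j / real N ^ j < \<delta>" by (auto simp: eventually_sequentially)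
  have small: "ck C0 C1 0 \<alpha> j / real N ^ (2 * j) \<le> \<delta>" if "j \<ge> g0" "1 \<le> j" for j
  proof -
    have "real N ^ j \<le> real N ^ (2 * j)" using N by (intro power_increasing) auto
    then have "ck C0 C1 0 \<alpha> j / real N ^ (2 * j) \<le> ck C0 C1 0 \<alpha> j / real N ^ j"
      using N c_nonneg[OF that(2)] by (intro divide_left_mono) auto
    then show ?thesis using g0[OF that(1)] by simp
  qed
  show ?thesis
    unfolding no_percolation_def
  proof (rule AE_of_small)
    fix \<epsilon> :: real assume "\<epsilon> > 0"
    from order_tendstoD(2)[OF lim this] obtain g1 where g1: "\<And>g. g \<ge> g1 \<Longrightarrow> bound g < \<epsilon>"
      by (auto simp: eventually_sequentially)
    define g where "g = max (max g0 g1) 1"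
    have g: "g \<ge> g0" "g \<ge> g1" "g \<ge> 1" by (auto simp: g_def)
    define L where "L = g ^ P"
    have L1: "L \<ge> 1" using g by (simp add: L_def)
    \<comment> \<open>The isolation bound at the largest radius g L. It decreases with the radius
      and so serves all of them.\<close>
    define q where "q = exp (- (1 + 2 * \<delta>) * ((C0 + C1 * ln (g * L)) / N + 2 * C1))"
    have q: "q \<le> (\<Prod>e\<in>cross_edges (hball N (g * i) zero_seq) (hball N (g * Suc i) zero_seq - hball N (g * i) zero_seq). 1 - p e)"
      if i: "i \<in> {1..L}" for i
    proof -
      have gi: "1 \<le> g * i" "g * i \<le> g * L" "g \<le> g * i" using g i by auto
      have "ln (real (g * i)) \<le> ln (real (g * L))" using gi by (subst ln_le_cancel_iff) (auto simp del: of_nat_mult)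
      then have "(C0 + C1 * ln (real (g * i))) / N + 2 * C1 \<le> (C0 + C1 * ln (real (g * L))) / N + 2 * C1"
        using C by (intro add_right_mono divide_right_mono add_left_mono mult_left_mono) auto
      then have "q \<le> exp (- (1 + 2 * \<delta>) * ((C0 + C1 * ln (g * i)) / N + 2 * C1))"
        unfolding q_def using \<delta> by (subst exp_le_cancel_iff, intro mult_left_mono_neg) auto
      also have "\<dots> \<le> (\<Prod>e\<in>cross_edges (hball N (g * i) zero_seq) (hball N (g * Suc i) zero_seq - hball N (g * i) zero_seq). 1 - p e)"
      proof (rule isolation_product[OF N C(1,2) gi(1) \<delta>(2)])
        fix j assume "g * i < j"
        then show "ck C0 C1 0 \<alpha> j / real N ^ (2 * j) \<le> \<delta>" using gi(1,3) g by (intro small) linarith+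
      qed
      finally show ?thesis .
    qed
    have qL: "exp (- A) * real g \<le> q * L"
    proof -
      have lg: "0 \<le> ln (real g)" using g by simp
      have ln: "ln (real (g * L)) = (real P + 1) * ln (real g)"
        using g by (simp add: L_def ln_mult ln_realpow algebra_simps)
      have "real L = exp (real P * ln (real g))" using g by (simp add: L_def exp_of_nat_mult)
      then have "q * L = exp (- (1 + 2 * \<delta>) * ((C0 + C1 * ((real P + 1) * ln (real g))) / N + 2 * C1) + real P * ln (real g))"
        unfolding q_def exp_add using ln by simp
      also have "- (1 + 2 * \<delta>) * ((C0 + C1 * ((real P + 1) * ln (real g))) / N + 2 * C1) + real P * ln (real g)
        = - A + (real P - \<theta>' * (real P + 1)) * ln (real g)"
        using N by (simp add: A_def \<theta>'_def \<theta>_def field_simps)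
      also have "exp \<dots> \<ge> exp (- A + 1 * ln (real g))"
        using P lg by (subst exp_le_cancel_iff, intro add_left_mono mult_right_mono) (auto simp: algebra_simps)
      finally show ?thesis using g by (simp add: exp_diff exp_minus divide_inverse mult.commute)
    qed
    have far: "real N ^ (g * i) * edge_tail (g * Suc i) \<le> (C0 + 2 * C1 + C1 * real g * (real L + 1)) / 2 ^ g"
      if i: "i \<in> {1..L}" for i
    proof -
      have "real N ^ (g * i) * edge_tail (g * Suc i) = (real N ^ (g * Suc i) * edge_tail (g * Suc i)) / real N ^ g"
        using N by (simp add: power_add)
      also have "\<dots> \<le> (C0 + C1 * real (g * Suc i) + 2 * C1) / real N ^ g"
        by (intro divide_right_mono edge_tail_log_bound C refl) simp_all
      also have "\<dots> \<le> (C0 + C1 * real (g * Suc i) + 2 * C1) / 2 ^ g"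
        using N C by (intro divide_left_mono power_mono add_nonneg_nonneg mult_nonneg_nonneg) auto
      also have "\<dots> \<le> (C0 + 2 * C1 + C1 * real g * (real L + 1)) / 2 ^ g"
      proof (intro divide_right_mono)
        have "C1 * (real g * real (Suc i)) \<le> C1 * (real g * (real L + 1))"
          using C i by (intro mult_left_mono) auto
        then show "C0 + C1 * real (g * Suc i) + 2 * C1 \<le> C0 + 2 * C1 + C1 * real g * (real L + 1)"
          by (simp add: algebra_simps)
      qed simp
      finally show ?thesis .
    qed
    have "(\<Sum>i\<in>{1..L}. real N ^ (g * i) * edge_tail (g * Suc i))
      \<le> (\<Sum>i\<in>{1..L}. (C0 + 2 * C1 + C1 * real g * (real L + 1)) / 2 ^ g)" by (rule sum_mono) (rule far)
    also have "\<dots> = real L * ((C0 + 2 * C1 + C1 * real g * (real L + 1)) / 2 ^ g)" by simp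
    also have "\<dots> = (C0 + 2 * C1) * (real g ^ P / 2 ^ g) + C1 * (real g ^ (P + 1) / 2 ^ g) + C1 * (real g ^ (2 * P + 1) / 2 ^ g)"
    proof -
      have Lr: "real L = real g ^ P" by (simp add: L_def)
      have "real L * (C0 + 2 * C1 + C1 * real g * (real L + 1))
        = (C0 + 2 * C1) * real g ^ P + C1 * real g ^ (P + 1) + C1 * real g ^ (2 * P + 1)"
      proof -
        have "real g ^ (P + 1) = real g * real L" by (simp add: Lr)
        moreover have "real g ^ (2 * P + 1) = real g * (real L * real L)"
          unfolding Lr power_add mult_2 by simp
        ultimately show ?thesis unfolding Lr[symmetric] by (simp only:) (simp add: algebra_simps)
      qed
      then show ?thesis unfolding times_divide_eq_right by (simp only: add_divide_distrib)
    qed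
    finally have "exp (- q * L) + (\<Sum>i\<in>{1..L}. real N ^ (g * i) * edge_tail (g * Suc i)) \<le> bound g"
      unfolding bound_def using qL by (intro add_mono) auto
    then have le: "exp (- q * L) + (\<Sum>i\<in>{1..L}. real N ^ (g * i) * edge_tail (g * Suc i)) \<le> \<epsilon>"
      using g1[OF g(2)] by simp
    have "0 \<le> q" by (simp add: q_def)
    from isolated_cover[OF this q] obtain B where "B \<in> events"
      "prob B \<le> exp (- q * L) + (\<Sum>i\<in>{1..L}. real N ^ (g * i) * edge_tail (g * Suc i))"
      "{\<omega> \<in> space (perc_space N (ck C0 C1 0 \<alpha>)). \<not> finite (cluster N \<omega> zero_seq)} \<subseteq> B" by blast
    then show "\<exists>B\<in>events. prob B \<le> \<epsilon> \<and> {\<omega> \<in> space (perc_space N (ck C0 C1 0 \<alpha>)). \<not> finite (cluster N \<omega> zero_seq)} \<subseteq> B"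
      using le by (intro bexI[of _ B]) auto
  qed
qed

section \<open>Renormalised cores\<close>

text \<open>The first conjunct forbids two empty cores. Required of all pairs of distinct subballs,
  it says that at most one subball is bad, and a pair with exactly one empty core counts as
  joined.\<close>

definition pair_joined :: "'a set \<Rightarrow> 'a set \<Rightarrow> ('a set \<Rightarrow> bool) \<Rightarrow> bool" where
  "pair_joined A B \<omega> \<longleftrightarrow> (A \<noteq> {} \<or> B \<noteq> {}) \<and> (A \<noteq> {} \<and> B \<noteq> {} \<longrightarrow> (\<exists>a\<in>A. \<exists>b\<in>B. \<omega> {a, b}))"

text \<open>The empty set encodes a bad ball.\<close>

fun core :: "nat \<Rightarrow> (nat \<Rightarrow> nat) \<Rightarrow> nat \<Rightarrow> (nat \<Rightarrow> nat) \<Rightarrow> ((nat \<Rightarrow> nat) set \<Rightarrow> bool) \<Rightarrow> (nat \<Rightarrow> nat) set" where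
  "core N K 0 x \<omega> = hball N (K 0) x"
| "core N K (Suc n) x \<omega> =
    (if \<forall>z\<in>ball_reps N (K n) (K (Suc n)) x. \<forall>z'\<in>ball_reps N (K n) (K (Suc n)) x.
          z \<noteq> z' \<longrightarrow> pair_joined (core N K n z \<omega>) (core N K n z' \<omega>) \<omega>
     then \<Union>z\<in>ball_reps N (K n) (K (Suc n)) x. core N K n z \<omega> else {})"

text \<open>The worst case for a nonempty core: at each level one of the N^(K (n+1) - K n) subballs
  contributes nothing.\<close>

fun core_size :: "nat \<Rightarrow> (nat \<Rightarrow> nat) \<Rightarrow> nat \<Rightarrow> nat" where
  "core_size N K 0 = N ^ K 0"
| "core_size N K (Suc n) = (N ^ (K (Suc n) - K n) - 1) * core_size N K n"

section \<open>Clusters as equivalence classes and the measurability of their being infinite\<close>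

lemma cluster_sym: "y \<in> cluster N \<omega> x \<Longrightarrow> x \<in> cluster N \<omega> y"
proof -
  have "sym {(a, b). adjacent N \<omega> a b}" by (auto simp: sym_def adjacent_def insert_commute)
  then have "sym ({(a, b). adjacent N \<omega> a b}\<^sup>*)" by (rule sym_rtrancl)
  then show "y \<in> cluster N \<omega> x \<Longrightarrow> x \<in> cluster N \<omega> y" by (auto simp: cluster_def dest: symD)
qed

lemma cluster_trans: "y \<in> cluster N \<omega> x \<Longrightarrow> z \<in> cluster N \<omega> y \<Longrightarrow> z \<in> cluster N \<omega> x"
  by (auto simp: cluster_def)

lemma cluster_self: "x \<in> cluster N \<omega> x" by (simp add: cluster_def)

lemma cluster_edge: "\<omega> {x, y} \<Longrightarrow> x \<in> Omega N \<Longrightarrow> y \<in> Omega N \<Longrightarrow> y \<in> cluster N \<omega> x"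
proof (cases "x = y")
  case False
  moreover assume "\<omega> {x, y}" "x \<in> Omega N" "y \<in> Omega N"
  ultimately have "(x, y) \<in> {(a, b). adjacent N \<omega> a b}" by (simp add: adjacent_def)
  then show ?thesis by (auto simp: cluster_def)
qed (simp add: cluster_self)

lemma cluster_eq: "y \<in> cluster N \<omega> x \<Longrightarrow> cluster N \<omega> y = cluster N \<omega> x"
  using cluster_sym cluster_trans by blast

lemma cluster_Omega: "x \<in> Omega N \<Longrightarrow> cluster N \<omega> x \<subseteq> Omega N"
proof
  fix y assume "x \<in> Omega N" "y \<in> cluster N \<omega> x"
  then have "(x, y) \<in> {(a, b). adjacent N \<omega> a b}\<^sup>*" by (simp add: cluster_def)
  then show "y \<in> Omega N" using \<open>x \<in> Omega N\<close> by (induction rule: rtrancl_induct) (auto simp: adjacent_def)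
qed

lemma conn_in_mono: "V \<subseteq> W \<Longrightarrow> conn_in V \<omega> x y \<Longrightarrow> conn_in W \<omega> x y"
proof -
  assume "V \<subseteq> W"
  then have "open_rel V \<omega> \<subseteq> open_rel W \<omega>" by (auto simp: open_rel_def)
  then show "conn_in V \<omega> x y \<Longrightarrow> conn_in W \<omega> x y" unfolding conn_in_def by (rule subsetD[OF rtrancl_mono])
qed

text \<open>A path has finitely many vertices, hence lies in some ball. This writes cluster
  membership as a countable union of events about finitely many edges.\<close>

lemma cluster_iff_conn_in:
  assumes N: "N \<ge> 1"
  shows "y \<in> cluster N \<omega> x \<longleftrightarrow> (\<exists>l. conn_in (hball N l zero_seq) \<omega> x y)"
proof
  assume "\<exists>l. conn_in (hball N l zero_seq) \<omega> x y"
  then show "y \<in> cluster N \<omega> x" using conn_in_cluster[OF hball_sub_Omega] by blast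
next
  assume "y \<in> cluster N \<omega> x"
  then have "(x, y) \<in> {(a, b). adjacent N \<omega> a b}\<^sup>*" by (simp add: cluster_def)
  then show "\<exists>l. conn_in (hball N l zero_seq) \<omega> x y"
  proof (induction rule: rtrancl_induct)
    case base then show ?case by simp
  next
    case (step y z)
    then obtain l where l: "conn_in (hball N l zero_seq) \<omega> x y" by blast
    have a: "y \<noteq> z" "y \<in> Omega N" "z \<in> Omega N" "\<omega> {y, z}" using step by (auto simp: adjacent_def)
    obtain i j where ij: "y \<in> hball N i zero_seq" "z \<in> hball N j zero_seq" using a(2,3) Omega_UN_hball[OF N] by auto
    define m where "m = max l (max i j)"
    have "l \<le> m" "i \<le> m" "j \<le> m" by (auto simp: m_def)
    then have "hball N l zero_seq \<subseteq> hball N m zero_seq" "y \<in> hball N m zero_seq" "z \<in> hball N m zero_seq"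
      using ij hball_mono by blast+
    then have "conn_in (hball N m zero_seq) \<omega> x y" "(y, z) \<in> open_rel (hball N m zero_seq) \<omega>"
      using conn_in_mono[OF _ l] a by (auto simp: open_rel_def)
    then have "conn_in (hball N m zero_seq) \<omega> x z" unfolding conn_in_def by (rule rtrancl_into_rtrancl)
    then show ?case by blast
  qed
qed

context hperc begin

text \<open>\<open>percolates\<close> asks for measurability explicitly. Since balls are finite and
  exhaust the space, the cluster is infinite exactly if it leaves every ball, which takes only
  countable operations.\<close>

lemma infinite_cluster_measurable:
  "{\<omega> \<in> space (perc_space N c). infinite (cluster N \<omega> zero_seq)} \<in> events"
proof -
  let ?B = "\<lambda>k. hball N k zero_seq"
  have iff: "infinite (cluster N \<omega> zero_seq) \<longleftrightarrow> (\<forall>k. \<exists>y\<in>Omega N - ?B k. \<exists>l. conn_in (?B l) \<omega> zero_seq y)" for \<omega>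
  proof
    assume inf: "infinite (cluster N \<omega> zero_seq)"
    show "\<forall>k. \<exists>y\<in>Omega N - ?B k. \<exists>l. conn_in (?B l) \<omega> zero_seq y"
    proof
      fix k
      have "\<not> cluster N \<omega> zero_seq \<subseteq> ?B k" using inf finite_subset[OF _ finite_hball[OF zero_seq_in]] by blast
      then obtain y where y: "y \<in> cluster N \<omega> zero_seq" "y \<notin> ?B k" by blast
      then show "\<exists>y\<in>Omega N - ?B k. \<exists>l. conn_in (?B l) \<omega> zero_seq y"
        using cluster_Omega[OF zero_seq_in] cluster_iff_conn_in[OF N1] by blast
    qed
  next
    assume *: "\<forall>k. \<exists>y\<in>Omega N - ?B k. \<exists>l. conn_in (?B l) \<omega> zero_seq y"
    show "infinite (cluster N \<omega> zero_seq)"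
    proof
      assume fin: "finite (cluster N \<omega> zero_seq)"
      define k where "k = Max (hdist zero_seq ` cluster N \<omega> zero_seq)"
      have "hdist zero_seq y \<le> k" if "y \<in> cluster N \<omega> zero_seq" for y
        unfolding k_def using fin that by (intro Max_ge) auto
      then have "y \<in> ?B k" if "y \<in> cluster N \<omega> zero_seq" for y
        using that hdist_le_iff[OF zero_seq_in, of y k] cluster_Omega[OF zero_seq_in] by blast
      moreover obtain y l where "y \<in> Omega N - ?B k" "conn_in (?B l) \<omega> zero_seq y" using * by blast
      ultimately show False using cluster_iff_conn_in[OF N1] by blast
    qed
  qed
  have m: "{\<omega> \<in> space (perc_space N c). conn_in (?B l) \<omega> zero_seq y} \<in> events" for l y
    by (rule depends_on_measurable[OF depends_on_conn_in]) (simp_all add: finite_inner_edges inner_edges_edges hball_sub_Omega)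
  have m2: "(\<Union>l. {\<omega> \<in> space (perc_space N c). conn_in (?B l) \<omega> zero_seq y}) \<in> events" for y
    by (rule sets.countable_UN) (use m in blast)
  have "countable (Omega N - ?B k)" for k using countable_Omega[OF N1] by (rule countable_Diff)
  then have m3: "(\<Union>y\<in>Omega N - ?B k. \<Union>l. {\<omega> \<in> space (perc_space N c). conn_in (?B l) \<omega> zero_seq y}) \<in> events" for k
    by (rule sets.countable_UN') (use m2 in blast)
  have "(\<Inter>k. \<Union>y\<in>Omega N - ?B k. \<Union>l. {\<omega> \<in> space (perc_space N c). conn_in (?B l) \<omega> zero_seq y}) \<in> events"
    by (rule sets.countable_INT) (use m3 in blast)+
  also have "(\<Inter>k. \<Union>y\<in>Omega N - ?B k. \<Union>l. {\<omega> \<in> space (perc_space N c). conn_in (?B l) \<omega> zero_seq y})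
    = {\<omega> \<in> space (perc_space N c). infinite (cluster N \<omega> zero_seq)}"
    unfolding iff by blast
  finally show ?thesis .
qed

end

text \<open>Collects the numerical demands on the scales. \<open>q n\<close> bounds from below the
  rates of edges between subballs of level n within a ball of level n + 1; \<open>eps n\<close> is
  the intended bound for the probability of an empty core. \<open>eps_step\<close> is the union
  bound over pairs of subballs: both cores are empty, or both are nonempty and miss each
  other.\<close>

locale renorm = hperc +
  fixes K :: "nat \<Rightarrow> nat" and eps q :: "nat \<Rightarrow> real"
  assumes K_less: "K n < K (Suc n)"
    and eps_nonneg: "0 \<le> eps n" and q_nonneg: "0 \<le> q n"
    and q_le: "K n < j \<Longrightarrow> j \<le> K (Suc n) \<Longrightarrow> q n \<le> c j / real N ^ (2 * j)"
    and eps_step: "(real N ^ (K (Suc n) - K n))\<^sup>2 * ((eps n)\<^sup>2 + exp (- (q n * (real (core_size N K n))\<^sup>2))) \<le> eps (Suc n)"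
begin

lemma K_mono: "n \<le> m \<Longrightarrow> K n \<le> K m" using K_less by (simp add: lift_Suc_mono_le less_imp_le)

abbreviation "R n x \<equiv> ball_reps N (K n) (K (Suc n)) x"

lemma R_Omega: "z \<in> R n x \<Longrightarrow> z \<in> Omega N" using ball_reps_sub hball_sub_Omega by blast

lemma R_ball: "z \<in> R n x \<Longrightarrow> hball N (K n) z \<subseteq> hball N (K (Suc n)) x"
  using hball_sub[of "K n" "K (Suc n)" z N x] K_less[of n] ball_reps_sub[of N "K n" "K (Suc n)" x] by auto

lemma R_dist:
  assumes "x \<in> Omega N" "z \<in> R n x" "z' \<in> R n x" "z \<noteq> z'" "a \<in> hball N (K n) z" "b \<in> hball N (K n) z'"
  shows "K n < hdist a b" "hdist a b \<le> K (Suc n)"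
proof -
  have O: "a \<in> Omega N" "b \<in> Omega N" using assms hball_sub_Omega by auto
  have "b \<notin> hball N (K n) a" using assms hball_eq[OF assms(5)] ball_reps_disjoint[OF assms(2-4)] by auto
  then show "K n < hdist a b" using hdist_le_iff[OF O, of "K n"] by (simp add: not_le[symmetric])
  have "a \<in> hball N (K (Suc n)) x" "b \<in> hball N (K (Suc n)) x" using R_ball assms by blast+
  then have "b \<in> hball N (K (Suc n)) a" using hball_eq by blast
  then show "hdist a b \<le> K (Suc n)" using hdist_le_iff[OF O] by simp
qed

lemma core_sub: "core N K n x \<omega> \<subseteq> hball N (K n) x"
proof (induction n arbitrary: x)
  case (Suc n)
  have "core N K n z \<omega> \<subseteq> hball N (K (Suc n)) x" if "z \<in> R n x" for z using Suc[of z] R_ball[OF that] by blast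
  then show ?case by auto
qed simp

lemma inner_edges_ball: "x \<in> Omega N \<Longrightarrow> finite (inner_edges (hball N k x)) \<and> inner_edges (hball N k x) \<subseteq> edges N"
  by (simp add: finite_inner_edges inner_edges_edges hball_sub_Omega)

lemma core_depends_on: "x \<in> Omega N \<Longrightarrow> depends_on (inner_edges (hball N (K n) x)) (core N K n x)"
proof (induction n arbitrary: x)
  case 0 show ?case by (rule depends_onI) simp
next
  case (Suc n)
  have sub: "inner_edges (hball N (K n) z) \<subseteq> inner_edges (hball N (K (Suc n)) x)" if "z \<in> R n x" for z
    using R_ball[OF that] by (rule inner_edges_mono)
  show ?case
  proof (rule depends_onI)
    fix \<omega> \<omega>' :: "(nat \<Rightarrow> nat) set \<Rightarrow> bool" assume eq: "\<And>e. e \<in> inner_edges (hball N (K (Suc n)) x) \<Longrightarrow> \<omega> e = \<omega>' e"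
    have S: "core N K n z \<omega> = core N K n z \<omega>'" if "z \<in> R n x" for z
      by (rule depends_onD[OF Suc.IH[OF R_Omega[OF that]]]) (use eq sub[OF that] in blast)
    have P: "pair_joined (core N K n z \<omega>) (core N K n z' \<omega>) \<omega> = pair_joined (core N K n z \<omega>') (core N K n z' \<omega>') \<omega>'"
      if z: "z \<in> R n x" "z' \<in> R n x" "z \<noteq> z'" for z z'
    proof -
      have "\<omega> {a, b} = \<omega>' {a, b}" if "a \<in> core N K n z \<omega>'" "b \<in> core N K n z' \<omega>'" for a b
      proof (rule eq)
        have "a \<in> hball N (K n) z" "b \<in> hball N (K n) z'" using that core_sub by blast+
        then have "a \<in> hball N (K (Suc n)) x" "b \<in> hball N (K (Suc n)) x" "a \<noteq> b"
          using R_ball z ball_reps_disjoint[OF z] by blast+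
        then show "{a, b} \<in> inner_edges (hball N (K (Suc n)) x)" unfolding inner_edges_def by blast
      qed
      then show ?thesis unfolding pair_joined_def S[OF z(1)] S[OF z(2)] by auto
    qed
    have "(\<Union>z\<in>R n x. core N K n z \<omega>) = (\<Union>z\<in>R n x. core N K n z \<omega>')" using S by auto
    moreover have "(\<forall>z\<in>R n x. \<forall>z'\<in>R n x. z \<noteq> z' \<longrightarrow> pair_joined (core N K n z \<omega>) (core N K n z' \<omega>) \<omega>)
      = (\<forall>z\<in>R n x. \<forall>z'\<in>R n x. z \<noteq> z' \<longrightarrow> pair_joined (core N K n z \<omega>') (core N K n z' \<omega>') \<omega>')" using P by auto
    ultimately show "core N K (Suc n) x \<omega> = core N K (Suc n) x \<omega>'" by (simp only: core.simps)
  qed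
qed

lemma R_card: "x \<in> Omega N \<Longrightarrow> card (R n x) = N ^ (K (Suc n) - K n)"
  using card_ball_reps[of x N "K n" "K (Suc n)"] K_less[of n] by simp

lemma R_card_ge2: "2 \<le> N ^ (K (Suc n) - K n)"
proof -
  have "N ^ 1 \<le> N ^ (K (Suc n) - K n)" using K_less[of n] N2 by (intro power_increasing) auto
  then show ?thesis using N2 by simp
qed

lemma core_okD:
  assumes "core N K (Suc n) x \<omega> \<noteq> {}"
  shows "\<forall>z\<in>R n x. \<forall>z'\<in>R n x. z \<noteq> z' \<longrightarrow> pair_joined (core N K n z \<omega>) (core N K n z' \<omega>) \<omega>"
proof (rule ccontr)
  assume "\<not> ?thesis"
  then have "core N K (Suc n) x \<omega> = {}" unfolding core.simps by (rule if_not_P)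
  with assms show False by simp
qed

text \<open>\<open>pair_joined\<close> leaves at most one empty subcore, and the others are disjoint
  because their balls are.\<close>

lemma core_card: "x \<in> Omega N \<Longrightarrow> core N K n x \<omega> \<noteq> {} \<Longrightarrow> core_size N K n \<le> card (core N K n x \<omega>)"
proof (induction n arbitrary: x)
  case 0 then show ?case by (simp add: card_hball)
next
  case (Suc n)
  let ?G = "{z \<in> R n x. core N K n z \<omega> \<noteq> {}}"
  have ok: "\<forall>z\<in>R n x. \<forall>z'\<in>R n x. z \<noteq> z' \<longrightarrow> pair_joined (core N K n z \<omega>) (core N K n z' \<omega>) \<omega>"
    using core_okD Suc.prems by blast
  then have eq: "core N K (Suc n) x \<omega> = (\<Union>z\<in>R n x. core N K n z \<omega>)" unfolding core.simps by (rule if_P)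
  have "card (R n x - ?G) \<le> 1"
  proof (rule card_le_Suc0_iff_eq[THEN iffD2, folded One_nat_def])
    show "finite (R n x - ?G)" using Suc.prems by simp
    show "\<forall>z\<in>R n x - ?G. \<forall>z'\<in>R n x - ?G. z = z'" using ok unfolding pair_joined_def by blast
  qed
  moreover have "card (R n x) = card ?G + card (R n x - ?G)"
    using Suc.prems by (subst card_Un_disjoint[symmetric]) (auto intro!: arg_cong[where f=card])
  ultimately have G: "N ^ (K (Suc n) - K n) - 1 \<le> card ?G" using R_card[OF Suc.prems(1), of n] by simp
  have "core_size N K (Suc n) \<le> card ?G * core_size N K n" using G by simp
  also have "\<dots> = (\<Sum>z\<in>?G. core_size N K n)" by simp
  also have "\<dots> \<le> (\<Sum>z\<in>?G. card (core N K n z \<omega>))"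
    by (rule sum_mono) (use Suc.IH R_Omega in blast)
  also have "\<dots> = card (\<Union>z\<in>?G. core N K n z \<omega>)"
  proof (rule card_UN_disjoint[symmetric])
    show "finite ?G" using Suc.prems by simp
    show "\<forall>z\<in>?G. finite (core N K n z \<omega>)"
      using core_sub finite_subset finite_hball R_Omega by (metis (no_types, lifting) mem_Collect_eq)
    show "\<forall>z\<in>?G. \<forall>z'\<in>?G. z \<noteq> z' \<longrightarrow> core N K n z \<omega> \<inter> core N K n z' \<omega> = {}"
      using core_sub ball_reps_disjoint by blast
  qed
  also have "(\<Union>z\<in>?G. core N K n z \<omega>) = core N K (Suc n) x \<omega>" unfolding eq by blast
  finally show ?case .
qed

lemma core_step: "core N K (Suc n) x \<omega> \<noteq> {} \<Longrightarrow> z \<in> R n x \<Longrightarrow> core N K n z \<omega> \<subseteq> core N K (Suc n) x \<omega>"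
  by (auto split: if_splits)

text \<open>At level zero the core is a full ball with all its edges open by hypothesis. At higher
  levels two nonempty subcores are bridged by the open edge that \<open>pair_joined\<close>
  provides.\<close>

lemma core_cluster:
  assumes short: "\<And>a b. a \<in> Omega N \<Longrightarrow> b \<in> Omega N \<Longrightarrow> a \<noteq> b \<Longrightarrow> hdist a b \<le> K 0 \<Longrightarrow> \<omega> {a, b}"
  shows "x \<in> Omega N \<Longrightarrow> a \<in> core N K n x \<omega> \<Longrightarrow> b \<in> core N K n x \<omega> \<Longrightarrow> b \<in> cluster N \<omega> a"
proof (induction n arbitrary: x a b)
  case 0
  then have O: "a \<in> Omega N" "b \<in> Omega N" and "b \<in> hball N (K 0) a" using hball_sub_Omega hball_eq by auto
  then have "hdist a b \<le> K 0" using hdist_le_iff[OF O] by simp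
  then show ?case using short[OF O] O cluster_edge cluster_self by (cases "a = b") auto
next
  case (Suc n)
  then have ne: "core N K (Suc n) x \<omega> \<noteq> {}" by blast
  then have ok: "\<forall>z\<in>R n x. \<forall>z'\<in>R n x. z \<noteq> z' \<longrightarrow> pair_joined (core N K n z \<omega>) (core N K n z' \<omega>) \<omega>"
    by (rule core_okD)
  then have eq: "core N K (Suc n) x \<omega> = (\<Union>z\<in>R n x. core N K n z \<omega>)" unfolding core.simps by (rule if_P)
  then obtain z z' where z: "z \<in> R n x" "a \<in> core N K n z \<omega>" "z' \<in> R n x" "b \<in> core N K n z' \<omega>"
    using Suc.prems by blast
  show ?case
  proof (cases "z = z'")
    case True then show ?thesis using Suc.IH[OF R_Omega[OF z(1)] z(2)] z by blast
  next
    case False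
    then obtain a' b' where ab: "a' \<in> core N K n z \<omega>" "b' \<in> core N K n z' \<omega>" "\<omega> {a', b'}"
      using ok z unfolding pair_joined_def by blast
    have O: "a' \<in> Omega N" "b' \<in> Omega N" using ab core_sub hball_sub_Omega by blast+
    have "a' \<in> cluster N \<omega> a" using Suc.IH[OF R_Omega[OF z(1)] z(2) ab(1)] .
    moreover have "b' \<in> cluster N \<omega> a'" using cluster_edge[OF _ O] ab by blast
    moreover have "b \<in> cluster N \<omega> b'" using Suc.IH[OF R_Omega[OF z(3)] ab(2) z(4)] .
    ultimately show ?thesis using cluster_trans by blast
  qed
qed

end

section \<open>Cores are rarely empty; percolation\<close>

context renorm begin

text \<open>Stated for fixed sets, which will be the values of two cores after conditioning. At
  least the square of \<open>core_size\<close> edges run between them, each of rate at least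
  \<open>q n\<close>.\<close>

lemma no_edge_between:
  assumes "x \<in> Omega N" "z \<in> R n x" "z' \<in> R n x" "z \<noteq> z'"
    and T: "T \<subseteq> hball N (K n) z" "T' \<subseteq> hball N (K n) z'" "core_size N K n \<le> card T" "core_size N K n \<le> card T'"
  shows "prob {\<omega> \<in> space (perc_space N c). \<forall>e\<in>cross_edges T T'. \<not> \<omega> e} \<le> exp (- (q n * (real (core_size N K n))\<^sup>2))"
proof -
  have O: "z \<in> Omega N" "z' \<in> Omega N" using assms R_Omega by blast+
  have disj: "T \<inter> T' = {}" using T ball_reps_disjoint[OF assms(2-4)] by blast
  have fin: "finite T" "finite T'" using T O finite_subset by (metis finite_hball)+
  have TO: "T \<subseteq> Omega N" "T' \<subseteq> Omega N" using T hball_sub_Omega by blast+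
  have "prob {\<omega> \<in> space (perc_space N c). \<forall>e\<in>cross_edges T T'. \<not> \<omega> e} \<le> exp (- (q n * card (cross_edges T T')))"
  proof (rule prob_no_edge_le)
    show "finite (cross_edges T T')" "cross_edges T T' \<subseteq> edges N" using fin TO disj by (auto simp: finite_cross_edges dest: cross_edges_edges)
    fix e assume "e \<in> cross_edges T T'"
    then obtain a b where ab: "a \<in> T" "b \<in> T'" "e = {a, b}" using cross_edges_E by blast
    then have "K n < hdist a b" "hdist a b \<le> K (Suc n)" using R_dist[OF assms(1-4)] T by blast+
    then show "q n \<le> c (edist e) / real N ^ (2 * edist e)" unfolding ab(3) edist_pair by (rule q_le)
  qed
  also have "\<dots> \<le> exp (- (q n * (real (core_size N K n))\<^sup>2))"
  proof -
    have "(real (core_size N K n))\<^sup>2 \<le> real (card T) * real (card T')"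
      unfolding power2_eq_square using T by (intro mult_mono) auto
    then show ?thesis using q_nonneg[of n] by (simp add: card_cross_edges[OF disj] mult_left_mono)
  qed
  finally show ?thesis .
qed

lemma core_empty_measurable: "x \<in> Omega N \<Longrightarrow> {\<omega> \<in> space (perc_space N c). core N K n x \<omega> = {}} \<in> events"
  by (rule depends_on_measurable[OF depends_on_comp[OF core_depends_on]]) (auto simp: inner_edges_ball)

text \<open>Joining fails in two ways. If both cores are empty, disjointness of their edge sets
  makes the probabilities multiply. If both are nonempty but miss each other, conditioning on the
  edges inside the two balls freezes the cores and leaves the edges between them random.\<close>

lemma bad_pair:
  assumes x: "x \<in> Omega N" and z: "z \<in> R n x" "z' \<in> R n x" "z \<noteq> z'"
    and IH: "\<And>x. x \<in> Omega N \<Longrightarrow> prob {\<omega> \<in> space (perc_space N c). core N K n x \<omega> = {}} \<le> eps n"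
  shows "{\<omega> \<in> space (perc_space N c). \<not> pair_joined (core N K n z \<omega>) (core N K n z' \<omega>) \<omega>} \<in> events"
    and "prob {\<omega> \<in> space (perc_space N c). \<not> pair_joined (core N K n z \<omega>) (core N K n z' \<omega>) \<omega>}
      \<le> (eps n)\<^sup>2 + exp (- (q n * (real (core_size N K n))\<^sup>2))"
proof -
  let ?M = "space (perc_space N c)"
  let ?S = "core N K n z" and ?S' = "core N K n z'"
  let ?B = "hball N (K n) z" and ?B' = "hball N (K n) z'"
  let ?E = "inner_edges ?B \<union> inner_edges ?B'"
  have O: "z \<in> Omega N" "z' \<in> Omega N" using z R_Omega by blast+
  have disj: "?B \<inter> ?B' = {}" by (rule ball_reps_disjoint[OF z])
  have E: "finite ?E" "?E \<subseteq> edges N" using inner_edges_ball O by auto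
  have F: "finite (cross_edges ?B ?B')" "cross_edges ?B ?B' \<subseteq> edges N"
    using O disj cross_edges_edges[OF hball_sub_Omega hball_sub_Omega disj] by (simp_all add: finite_cross_edges)
  have EF: "?E \<inter> cross_edges ?B ?B' = {}"
    using inner_edges_cross_edges_disj[of ?B' ?B ?B] inner_edges_cross_edges_disj'[of ?B ?B' ?B'] disj by blast
  have dS: "depends_on ?E ?S" "depends_on ?E ?S'" using depends_on_mono[OF core_depends_on[OF O(1)], of n ?E] depends_on_mono[OF core_depends_on[OF O(2)], of n ?E] by simp_all
  have m1: "{\<omega> \<in> ?M. ?S \<omega> = {} \<and> ?S' \<omega> = {}} \<in> events"
    by (rule depends_on_measurable[OF depends_on_conj[OF depends_on_comp[OF dS(1)] depends_on_comp[OF dS(2)]] E])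
  let ?A = "\<lambda>\<omega>. ?S \<omega> \<noteq> {} \<and> ?S' \<omega> \<noteq> {}"
  let ?X = "\<lambda>\<omega>. (?S \<omega>, ?S' \<omega>)"
  let ?Q = "\<lambda>v \<omega>. \<forall>e\<in>cross_edges (fst v) (snd v). \<not> \<omega> e"
  have dA: "depends_on ?E ?A"
    by (rule depends_on_conj[OF depends_on_comp[OF dS(1)] depends_on_comp[OF dS(2)]])
  have dX: "depends_on ?E ?X" by (rule depends_on_comp2[OF dS])
  have sub: "cross_edges (?S \<omega>) (?S' \<omega>) \<subseteq> cross_edges ?B ?B'" for \<omega>
    unfolding cross_edges_def using core_sub by (intro image_mono Sigma_mono) auto
  have dQ: "depends_on (cross_edges ?B ?B') (?Q (?X \<omega>))" for \<omega>
    by (intro depends_on_all depends_on_not depends_on_edge) (use sub in auto)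
  have p2: "prob {\<omega> \<in> ?M. ?A \<omega> \<and> ?Q (?X \<omega>) \<omega>} \<le> exp (- (q n * (real (core_size N K n))\<^sup>2)) * prob {\<omega> \<in> ?M. ?A \<omega>}"
  proof (rule cond_bound[where A = ?A and X = ?X and Q = ?Q, OF dA dX dQ E(1) F(1) E(2) F(2) EF])
    fix \<omega> assume A: "?A \<omega>"
    show "prob {\<omega>' \<in> ?M. ?Q (?X \<omega>) \<omega>'} \<le> exp (- (q n * (real (core_size N K n))\<^sup>2))"
      using no_edge_between[OF x z core_sub core_sub] core_card O A by simp
  qed
  also have "\<dots> \<le> exp (- (q n * (real (core_size N K n))\<^sup>2)) * 1" by (intro mult_left_mono) auto
  finally have P2: "prob {\<omega> \<in> ?M. ?A \<omega> \<and> ?Q (?X \<omega>) \<omega>} \<le> exp (- (q n * (real (core_size N K n))\<^sup>2))" by simp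
  have m2: "{\<omega> \<in> ?M. ?A \<omega> \<and> ?Q (?X \<omega>) \<omega>} \<in> events"
  proof (rule depends_on_measurable)
    show "depends_on (?E \<union> cross_edges ?B ?B') (\<lambda>\<omega>. ?A \<omega> \<and> ?Q (?X \<omega>) \<omega>)"
    proof (rule depends_onI)
      fix \<omega> \<omega>' :: "(nat \<Rightarrow> nat) set \<Rightarrow> bool" assume eq: "\<And>e. e \<in> ?E \<union> cross_edges ?B ?B' \<Longrightarrow> \<omega> e = \<omega>' e"
      have S: "?S \<omega> = ?S \<omega>'" "?S' \<omega> = ?S' \<omega>'" by (rule depends_onD[OF dS(1)], use eq in blast, rule depends_onD[OF dS(2)], use eq in blast)
      have "?Q (?X \<omega>') \<omega> = ?Q (?X \<omega>') \<omega>'" by (rule depends_onD[OF dQ]) (use eq in blast)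
      then show "(?A \<omega> \<and> ?Q (?X \<omega>) \<omega>) = (?A \<omega>' \<and> ?Q (?X \<omega>') \<omega>')" unfolding S by simp
    qed
  qed (use E F in auto)
  have "prob {\<omega> \<in> ?M. ?S \<omega> = {} \<and> ?S' \<omega> = {}} = prob {\<omega> \<in> ?M. ?S \<omega> = {}} * prob {\<omega> \<in> ?M. ?S' \<omega> = {}}"
    using inner_edges_ball O inner_edges_inner_edges_disj[OF disj]
    by (intro indep_depends_on[OF depends_on_comp[OF core_depends_on, where f = "\<lambda>A. A = {}"] depends_on_comp[OF core_depends_on, where f = "\<lambda>A. A = {}"]]) auto
  also have "\<dots> \<le> eps n * eps n" by (intro mult_mono IH O eps_nonneg) auto
  finally have P1: "prob {\<omega> \<in> ?M. ?S \<omega> = {} \<and> ?S' \<omega> = {}} \<le> (eps n)\<^sup>2" by (simp add: power2_eq_square)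
  have eq: "{\<omega> \<in> ?M. \<not> pair_joined (?S \<omega>) (?S' \<omega>) \<omega>} = {\<omega> \<in> ?M. ?S \<omega> = {} \<and> ?S' \<omega> = {}} \<union> {\<omega> \<in> ?M. ?A \<omega> \<and> ?Q (?X \<omega>) \<omega>}"
    unfolding pair_joined_def cross_edges_def by auto
  show "{\<omega> \<in> ?M. \<not> pair_joined (?S \<omega>) (?S' \<omega>) \<omega>} \<in> events" unfolding eq by (rule sets.Un[OF m1 m2])
  show "prob {\<omega> \<in> ?M. \<not> pair_joined (?S \<omega>) (?S' \<omega>) \<omega>} \<le> (eps n)\<^sup>2 + exp (- (q n * (real (core_size N K n))\<^sup>2))"
    unfolding eq using measure_Un_le[OF m1 m2] P1 P2 by linarith
qed

lemma prob_bad: "x \<in> Omega N \<Longrightarrow> prob {\<omega> \<in> space (perc_space N c). core N K n x \<omega> = {}} \<le> eps n"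
proof (induction n arbitrary: x)
  case 0
  then have "hball N (K 0) x \<noteq> {}" using hball_self by blast
  then show ?case using eps_nonneg[of 0] by simp
next
  case (Suc n)
  let ?M = "space (perc_space N c)"
  let ?ok = "\<lambda>z z' \<omega>. pair_joined (core N K n z \<omega>) (core N K n z' \<omega>) \<omega>"
  let ?I = "{v \<in> R n x \<times> R n x. fst v \<noteq> snd v}"
  have fin: "finite ?I" using Suc.prems by simp
  have m: "{\<omega> \<in> ?M. \<not> ?ok (fst v) (snd v) \<omega>} \<in> events" if "v \<in> ?I" for v
    using bad_pair(1)[OF Suc.prems _ _ _ Suc.IH, of "fst v" "snd v"] that by auto
  have "prob {\<omega> \<in> ?M. core N K (Suc n) x \<omega> = {}} \<le> prob {\<omega> \<in> ?M. \<exists>v\<in>?I. \<not> ?ok (fst v) (snd v) \<omega>}"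
  proof (rule finite_measure_mono)
    have "{\<omega> \<in> ?M. \<exists>v\<in>?I. \<not> ?ok (fst v) (snd v) \<omega>} = (\<Union>v\<in>?I. {\<omega> \<in> ?M. \<not> ?ok (fst v) (snd v) \<omega>})" by blast
    also have "\<dots> \<in> events" using fin m by (rule sets.finite_UN)
    finally show "{\<omega> \<in> ?M. \<exists>v\<in>?I. \<not> ?ok (fst v) (snd v) \<omega>} \<in> events" .
    show "{\<omega> \<in> ?M. core N K (Suc n) x \<omega> = {}} \<subseteq> {\<omega> \<in> ?M. \<exists>v\<in>?I. \<not> ?ok (fst v) (snd v) \<omega>}"
    proof (clarify, rule ccontr)
      fix \<omega> assume emp: "core N K (Suc n) x \<omega> = {}" and no: "\<not> (\<exists>v\<in>?I. \<not> ?ok (fst v) (snd v) \<omega>)"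
      then have ok: "\<forall>z\<in>R n x. \<forall>z'\<in>R n x. z \<noteq> z' \<longrightarrow> ?ok z z' \<omega>" by auto
      then have "core N K (Suc n) x \<omega> = (\<Union>z\<in>R n x. core N K n z \<omega>)" unfolding core.simps by (rule if_P)
      then have e: "core N K n z \<omega> = {}" if "z \<in> R n x" for z using emp that by blast
      \<comment> \<open>A core could also be empty because all subcores are. With at least two
        subballs this already violates \<open>pair_joined\<close>, so an empty core always comes
        from a failing pair.\<close>
      have "\<not> card (R n x) \<le> 1" using R_card[OF Suc.prems, of n] R_card_ge2[of n] by simp
      then obtain z z' where "z \<in> R n x" "z' \<in> R n x" "z \<noteq> z'"
        using Suc.prems by (auto simp: card_le_Suc0_iff_eq)
      then show False using ok e unfolding pair_joined_def by blast
    qed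
  qed
  also have "\<dots> \<le> (\<Sum>v\<in>?I. prob {\<omega> \<in> ?M. \<not> ?ok (fst v) (snd v) \<omega>})" using fin m by (rule prob_ex_le)
  also have "\<dots> \<le> (\<Sum>v\<in>?I. (eps n)\<^sup>2 + exp (- (q n * (real (core_size N K n))\<^sup>2)))"
    by (rule sum_mono) (use bad_pair(2)[OF Suc.prems _ _ _ Suc.IH] in auto)
  also have "\<dots> = real (card ?I) * ((eps n)\<^sup>2 + exp (- (q n * (real (core_size N K n))\<^sup>2)))" by simp
  also have "\<dots> \<le> (real N ^ (K (Suc n) - K n))\<^sup>2 * ((eps n)\<^sup>2 + exp (- (q n * (real (core_size N K n))\<^sup>2)))"
  proof (rule mult_right_mono)
    have "card ?I \<le> card (R n x \<times> R n x)" using Suc.prems by (intro card_mono) auto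
    also have "\<dots> = (N ^ (K (Suc n) - K n))\<^sup>2"
      using R_card[OF Suc.prems, of n] by (simp add: card_cartesian_product power2_eq_square)
    finally have "real (card ?I) \<le> real ((N ^ (K (Suc n) - K n))\<^sup>2)" by (rule of_nat_mono)
    then show "real (card ?I) \<le> (real N ^ (K (Suc n) - K n))\<^sup>2" by simp
  qed simp
  also have "\<dots> \<le> eps (Suc n)" by (rule eps_step)
  finally show ?case .
qed

lemma zero_R: "zero_seq \<in> R n zero_seq"
  using hball_self[OF zero_seq_in] by (auto simp: ball_reps_def zero_seq_def)

text \<open>The ball of level n around the origin is itself one of the subballs at level n + 1, so
  good levels give nested cores.\<close>

lemma core_mono_zero:
  assumes "\<And>n. n \<ge> n0 \<Longrightarrow> core N K n zero_seq \<omega> \<noteq> {}" "n0 \<le> m"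
  shows "core N K n0 zero_seq \<omega> \<subseteq> core N K m zero_seq \<omega>"
  using assms(2)
proof (induction m rule: dec_induct)
  case (step m)
  have "core N K m zero_seq \<omega> \<subseteq> core N K (Suc m) zero_seq \<omega>"
    by (rule core_step[OF assms(1) zero_R]) (use step in simp)
  then show ?case using step by blast
qed simp

end

text \<open>\<open>short\<close> forces edges of length up to \<open>K 0\<close> to have probability
  one. The sum starts at level one because the core of level zero is never empty; its being below
  one gives percolation by a union bound, and summability gives Borel-Cantelli for
  uniqueness.\<close>

locale renorm_summable = renorm +
  assumes short: "1 \<le> j \<Longrightarrow> j \<le> K 0 \<Longrightarrow> real N ^ (2 * j) \<le> c j"
    and core_size_half: "real N ^ K n / 2 \<le> real (core_size N K n)"
    and eps_sum: "summable eps" "(\<Sum>n. eps (Suc n)) < 1"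
begin

lemma AE_short:
  "AE \<omega> in perc_space N c. \<forall>a\<in>Omega N. \<forall>b\<in>Omega N. a \<noteq> b \<longrightarrow> hdist a b \<le> K 0 \<longrightarrow> \<omega> {a, b}"
proof -
  have "AE \<omega> in perc_space N c. \<forall>e\<in>{e \<in> edges N. edist e \<le> K 0}. \<omega> e"
  proof (rule AE_ball_countable[THEN iffD2])
    show "countable {e \<in> edges N. edist e \<le> K 0}"
      by (rule countable_subset[OF _ countable_edges[OF N1]]) auto
    show "\<forall>e\<in>{e \<in> edges N. edist e \<le> K 0}. AE \<omega> in perc_space N c. \<omega> e"
    proof
      fix e assume e: "e \<in> {e \<in> edges N. edist e \<le> K 0}"
      then have "real N ^ (2 * edist e) \<le> c (edist e)" using edist_pos by (intro short) auto
      then have "p e = 1" using N2 by (simp add: edge_prob_def)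
      then have "prob {\<omega> \<in> space (perc_space N c). \<omega> e} = 1" using e prob_edge by simp
      from AE_prob_1[OF this] show "AE \<omega> in perc_space N c. \<omega> e" by (rule eventually_mono) simp
    qed
  qed
  then show ?thesis
  proof (rule eventually_mono, intro ballI impI)
    fix \<omega> a b assume *: "\<forall>e\<in>{e \<in> edges N. edist e \<le> K 0}. \<omega> e"
      and "a \<in> Omega N" "b \<in> Omega N" "a \<noteq> b" "hdist a b \<le> K 0"
    then have "{a, b} \<in> {e \<in> edges N. edist e \<le> K 0}" by (simp add: edge_pair edist_pair)
    with * show "\<omega> {a, b}" by blast
  qed
qed

lemma infinite_if_good:
  assumes "\<And>a b. a \<in> Omega N \<Longrightarrow> b \<in> Omega N \<Longrightarrow> a \<noteq> b \<Longrightarrow> hdist a b \<le> K 0 \<Longrightarrow> \<omega> {a, b}"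
    and "\<And>n. core N K n zero_seq \<omega> \<noteq> {}"
  shows "infinite (cluster N \<omega> zero_seq)"
proof
  assume fin: "finite (cluster N \<omega> zero_seq)"
  have "real (2 ^ n) / 2 \<le> real (card (cluster N \<omega> zero_seq))" for n
  proof -
    have "n \<le> K n" by (induction n) (use K_less Suc_leI le_less_trans in blast)+
    then have "(2::real) ^ n \<le> real N ^ K n"
      using N2 by (intro order_trans[OF power_mono power_increasing]) auto
    then have "real (2 ^ n) / 2 \<le> real (core_size N K n)" using core_size_half[of n] by simp
    also have "\<dots> \<le> real (card (core N K n zero_seq \<omega>))" using core_card[OF zero_seq_in assms(2)] by simp
    also have "\<dots> \<le> real (card (cluster N \<omega> zero_seq))"
    proof -
      have z: "zero_seq \<in> core N K n zero_seq \<omega>"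
        using core_mono_zero[of 0 \<omega> n] assms(2) hball_self[OF zero_seq_in] by auto
      have "core N K n zero_seq \<omega> \<subseteq> cluster N \<omega> zero_seq"
        using core_cluster[of \<omega> zero_seq zero_seq n] assms(1) z by auto
      then show ?thesis using fin by (simp add: card_mono)
    qed
    finally show ?thesis .
  qed
  then have "2 ^ Suc (card (cluster N \<omega> zero_seq)) \<le> 2 * card (cluster N \<omega> zero_seq)"
    by (metis (no_types, lifting) divide_le_eq_numeral1(1) mult.commute of_nat_le_iff of_nat_mult of_nat_numeral)
  moreover have "card (cluster N \<omega> zero_seq) < 2 ^ card (cluster N \<omega> zero_seq)" by (rule less_exp)
  ultimately show False by simp
qed

theorem percolation: "percolates N c"
proof -
  let ?M = "space (perc_space N c)"
  define B where "B n = {\<omega> \<in> ?M. core N K (Suc n) zero_seq \<omega> = {}}" for n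
  define A where "A = {\<omega> \<in> ?M. infinite (cluster N \<omega> zero_seq)}"
  have B: "B n \<in> events" "prob (B n) \<le> eps (Suc n)" for n
    unfolding B_def by (rule core_empty_measurable[OF zero_seq_in], rule prob_bad[OF zero_seq_in])
  have se: "summable (\<lambda>n. eps (Suc n))" using eps_sum(1) by (simp add: summable_Suc_iff)
  have sB: "summable (\<lambda>n. prob (B n))"
    by (rule summable_comparison_test'[OF se, of 0]) (simp add: B)
  have U: "(\<Union>n. B n) \<in> events" using B by auto
  have "prob (\<Union>n. B n) \<le> (\<Sum>n. prob (B n))" using B sB by (intro finite_measure_subadditive_countably) auto
  also have "\<dots> \<le> (\<Sum>n. eps (Suc n))" using B sB se by (intro suminf_le) auto
  also have "\<dots> < 1" by (rule eps_sum)
  finally have "0 < prob (?M - (\<Union>n. B n))" using prob_compl[OF U] by simp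
  also have "\<dots> \<le> prob A"
  proof (rule finite_measure_mono_AE)
    show "A \<in> events" unfolding A_def by (rule infinite_cluster_measurable)
    show "AE \<omega> in perc_space N c. \<omega> \<in> ?M - (\<Union>n. B n) \<longrightarrow> \<omega> \<in> A"
      using AE_short
    proof (rule eventually_mono, intro impI)
      fix \<omega> assume s: "\<forall>a\<in>Omega N. \<forall>b\<in>Omega N. a \<noteq> b \<longrightarrow> hdist a b \<le> K 0 \<longrightarrow> \<omega> {a, b}"
        and \<omega>: "\<omega> \<in> ?M - (\<Union>n. B n)"
      have "core N K n zero_seq \<omega> \<noteq> {}" for n
      proof (cases n)
        case 0 then show ?thesis using hball_self[OF zero_seq_in] by auto
      next
        case (Suc m) then show ?thesis using \<omega> unfolding B_def by blast
      qed
      then have "infinite (cluster N \<omega> zero_seq)" using s by (intro infinite_if_good) auto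
      then show "\<omega> \<in> A" using \<omega> by (simp add: A_def)
    qed
  qed
  finally show ?thesis
    unfolding percolates_def Let_def using infinite_cluster_measurable by (simp add: A_def)
qed

end

section \<open>Uniqueness of the infinite cluster\<close>

text \<open>The condition on \<open>eta\<close> compares two expectations for a vertex of a ball of
  level n: edges into a core of an adjacent ball are at least a fixed fraction of all edges leaving
  the ball. This makes avoiding that core while leaving the ball costly, whatever the size of the
  part that leaves.\<close>

locale renorm_exit = renorm_summable N c K eps q + hperc_sum N c for N c K eps q +
  fixes eta :: real
  assumes eta_pos: "0 < eta"
    and eta: "eta * edge_tail (K n) \<le> real (core_size N K n) * (c (Suc (K n)) / real N ^ (2 * Suc (K n)))"
begin

text \<open>The centre of an adjacent ball at the smallest possible distance, K n + 1. It lies in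
  the ball of level n + 1 around the origin, so its nonempty core is absorbed by the next core if
  that one is good.\<close>

definition sibling :: "nat \<Rightarrow> nat \<Rightarrow> nat" where "sibling n = (\<lambda>i. if i = Suc (K n) then 1 else 0)"

abbreviation "V n \<equiv> hball N (K n) zero_seq"

definition local_cluster :: "(nat \<Rightarrow> nat) \<Rightarrow> nat \<Rightarrow> ((nat \<Rightarrow> nat) set \<Rightarrow> bool) \<Rightarrow> (nat \<Rightarrow> nat) set" where
  "local_cluster x n \<omega> = {a \<in> V n. conn_in (V n) \<omega> x a}"

text \<open>The region $W$ is a finite ball as long as finitely many edges have to determine the event, and
  the whole space in the end.\<close>

definition escapes :: "(nat \<Rightarrow> nat) \<Rightarrow> nat \<Rightarrow> (nat \<Rightarrow> nat) set \<Rightarrow> ((nat \<Rightarrow> nat) set \<Rightarrow> bool) \<Rightarrow> bool" where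
  "escapes x n W \<omega> \<longleftrightarrow> core N K n (sibling n) \<omega> \<noteq> {} \<and> (\<exists>e\<in>cross_edges (local_cluster x n \<omega>) (W - V n). \<omega> e) \<and>
     (\<forall>e\<in>cross_edges (local_cluster x n \<omega>) (core N K n (sibling n) \<omega>). \<not> \<omega> e)"

text \<open>One entry for each case of the dichotomy in \<open>escapes_bound\<close>: expected
  number of exits at most 1/2, or expected number of hits of the core at least eta / 2.\<close>

definition \<rho> :: real where "\<rho> = max (1/2) (exp (- (eta / 2)))"

lemma \<rho>: "0 \<le> \<rho>" "\<rho> < 1" using eta_pos by (auto simp: \<rho>_def)

lemma sibling_Omega: "sibling n \<in> Omega N" using N2 by (auto simp: sibling_def Omega_def)

lemma sibling_R: "sibling n \<in> R n zero_seq"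
proof -
  have "sibling n \<in> hball N (K (Suc n)) zero_seq"
    using sibling_Omega K_less[of n] unfolding hball_def sibling_def zero_seq_def by simp
  then show ?thesis unfolding ball_reps_def by (simp add: sibling_def)
qed

lemma sibling_ne: "zero_seq \<noteq> sibling n"
proof
  assume "zero_seq = sibling n"
  then have "zero_seq (Suc (K n)) = sibling n (Suc (K n))" by simp
  then show False by (simp add: zero_seq_def sibling_def)
qed

lemma sibling_disj: "V n \<inter> hball N (K n) (sibling n) = {}"
  by (rule ball_reps_disjoint[OF zero_R sibling_R sibling_ne])

lemma sibling_dist: assumes "a \<in> V n" "b \<in> hball N (K n) (sibling n)" shows "hdist a b = Suc (K n)"
proof -
  have O: "a \<in> Omega N" "b \<in> Omega N" using assms hball_sub_Omega by auto
  have "K n < hdist a b" by (rule R_dist(1)[OF zero_seq_in zero_R sibling_R sibling_ne assms])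
  moreover have "b \<in> hball N (Suc (K n)) a"
    using assms O unfolding hball_def sibling_def zero_seq_def by simp
  then have "hdist a b \<le> Suc (K n)" using hdist_le_iff[OF O] by simp
  ultimately show ?thesis by simp
qed

lemma V_props: "finite (V n)" "V n \<subseteq> Omega N" "n \<le> m \<Longrightarrow> V n \<subseteq> V m"
  by (simp_all add: hball_sub_Omega hball_mono K_mono)

lemma sibling_sub: "n < m \<Longrightarrow> hball N (K n) (sibling n) \<subseteq> V m"
  using R_ball[OF sibling_R, of n] V_props(3)[of "Suc n" m] by auto

lemma local_cluster_depends_on: "depends_on (inner_edges (V n)) (local_cluster x n)"
proof (rule depends_onI)
  fix \<omega> \<omega>' :: "(nat \<Rightarrow> nat) set \<Rightarrow> bool" assume eq: "\<And>e. e \<in> inner_edges (V n) \<Longrightarrow> \<omega> e = \<omega>' e"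
  have "open_rel (V n) \<omega> = open_rel (V n) \<omega>'" by (rule depends_onD[OF depends_on_open_rel]) (rule eq)
  then show "local_cluster x n \<omega> = local_cluster x n \<omega>'" by (simp add: local_cluster_def conn_in_def)
qed

lemma local_cluster_sub: "local_cluster x n \<omega> \<subseteq> V n" by (auto simp: local_cluster_def)

lemma escapes_depends_on: assumes "n < m" shows "depends_on (inner_edges (V m)) (escapes x n (V m))"
proof (rule depends_onI)
  fix \<omega> \<omega>' :: "(nat \<Rightarrow> nat) set \<Rightarrow> bool" assume eq: "\<And>e. e \<in> inner_edges (V m) \<Longrightarrow> \<omega> e = \<omega>' e"
  have nm: "V n \<subseteq> V m" using V_props(3) assms by simp
  have D: "local_cluster x n \<omega> = local_cluster x n \<omega>'" by (rule depends_onD[OF local_cluster_depends_on]) (use eq inner_edges_mono[OF nm] in blast)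
  have S: "core N K n (sibling n) \<omega> = core N K n (sibling n) \<omega>'"
    by (rule depends_onD[OF core_depends_on[OF sibling_Omega]]) (use eq inner_edges_mono[OF sibling_sub[OF assms]] in blast)
  have "cross_edges (local_cluster x n \<omega>') (V m - V n) \<subseteq> inner_edges (V m)" by (rule cross_edges_inner_edges) (use local_cluster_sub nm in blast)+
  then have e1: "\<omega> e = \<omega>' e" if "e \<in> cross_edges (local_cluster x n \<omega>') (V m - V n)" for e using eq that by blast
  have "cross_edges (local_cluster x n \<omega>') (core N K n (sibling n) \<omega>') \<subseteq> inner_edges (V m)"
    by (rule cross_edges_inner_edges) (use local_cluster_sub nm core_sub sibling_sub[OF assms] sibling_disj in blast)+
  then have e2: "\<omega> e = \<omega>' e" if "e \<in> cross_edges (local_cluster x n \<omega>') (core N K n (sibling n) \<omega>')" for e using eq that by blast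
  show "escapes x n (V m) \<omega> = escapes x n (V m) \<omega>'" unfolding escapes_def D S using e1 e2 by auto
qed

text \<open>The edges inside the ball and inside its sibling are frozen, including the history
  \<open>A\<close>, while the edges leaving the ball remain random.\<close>

lemma escapes_bound:
  assumes nm: "n < m" and A: "depends_on (inner_edges (V n)) A"
  shows "prob {\<omega> \<in> space (perc_space N c). A \<omega> \<and> escapes x n (V m) \<omega>} \<le> \<rho> * prob {\<omega> \<in> space (perc_space N c). A \<omega>}"
proof -
  let ?M = "space (perc_space N c)"
  let ?B = "hball N (K n) (sibling n)" and ?S = "core N K n (sibling n)"
  let ?E = "inner_edges (V n) \<union> inner_edges ?B" and ?F = "cross_edges (V n) (V m - V n)"
  let ?A = "\<lambda>\<omega>. A \<omega> \<and> ?S \<omega> \<noteq> {}"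
  let ?X = "\<lambda>\<omega>. (local_cluster x n \<omega>, ?S \<omega>)"
  let ?Q = "\<lambda>v \<omega>. (\<exists>e\<in>cross_edges (fst v) (V m - V n). \<omega> e) \<and> (\<forall>e\<in>cross_edges (fst v) (snd v). \<not> \<omega> e)"
  have BV: "?B \<subseteq> V m - V n" using sibling_sub[OF nm] sibling_disj by blast
  have E: "finite ?E" "?E \<subseteq> edges N" using inner_edges_ball sibling_Omega by auto
  have F: "finite ?F" "?F \<subseteq> edges N"
    using V_props cross_edges_edges[OF V_props(2), of "V m - V n" n] by (auto simp: finite_cross_edges)
  have EF: "?E \<inter> ?F = {}"
  proof -
    have "inner_edges (V n) \<inter> ?F = {}" by (rule inner_edges_cross_edges_disj) blast
    moreover have "inner_edges ?B \<inter> ?F = {}" by (rule inner_edges_cross_edges_disj') (rule sibling_disj)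
    ultimately show ?thesis by blast
  qed
  have dS: "depends_on ?E ?S" by (rule depends_on_mono[OF core_depends_on[OF sibling_Omega]]) blast
  have dA0: "depends_on ?E A" by (rule depends_on_mono[OF A]) blast
  have dA: "depends_on ?E ?A" by (rule depends_on_conj[OF dA0 depends_on_comp[OF dS]])
  have "depends_on ?E (local_cluster x n)" by (rule depends_on_mono[OF local_cluster_depends_on]) blast
  then have dX: "depends_on ?E ?X" by (rule depends_on_comp2[OF _ dS])
  have sub1: "cross_edges (local_cluster x n \<omega>) (V m - V n) \<subseteq> ?F" for \<omega>
    unfolding cross_edges_def using local_cluster_sub by (intro image_mono Sigma_mono) auto
  have sub2: "cross_edges (local_cluster x n \<omega>) (?S \<omega>) \<subseteq> ?F" for \<omega>
    unfolding cross_edges_def using local_cluster_sub core_sub BV by (intro image_mono Sigma_mono) blast+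
  have d1: "depends_on ?F (\<lambda>\<omega>'. \<exists>e\<in>cross_edges (local_cluster x n \<omega>) (V m - V n). \<omega>' e)" for \<omega>
    by (intro depends_on_ex depends_on_edge) (use sub1 in blast)
  have d2: "depends_on ?F (\<lambda>\<omega>'. \<forall>e\<in>cross_edges (local_cluster x n \<omega>) (?S \<omega>). \<not> \<omega>' e)" for \<omega>
    by (intro depends_on_all depends_on_not depends_on_edge) (use sub2 in blast)
  have dQ: "depends_on ?F (?Q (?X \<omega>))" for \<omega> unfolding fst_conv snd_conv by (rule depends_on_conj[OF d1 d2])
  have "prob {\<omega> \<in> ?M. ?A \<omega> \<and> ?Q (?X \<omega>) \<omega>} \<le> \<rho> * prob {\<omega> \<in> ?M. ?A \<omega>}"
  proof (rule cond_bound[where A = ?A and X = ?X and Q = ?Q, OF dA dX dQ E(1) F(1) E(2) F(2) EF])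
    fix \<omega> assume ne: "?A \<omega>"
    define D where "D = local_cluster x n \<omega>"
    define T where "T = ?S \<omega>"
    have D: "D \<subseteq> V n" "finite D" "D \<subseteq> Omega N"
      using local_cluster_sub finite_subset[OF local_cluster_sub V_props(1)] V_props(2) unfolding D_def by blast+
    have T: "T \<subseteq> ?B" "core_size N K n \<le> card T" using core_sub core_card[OF sibling_Omega] ne unfolding T_def by blast+
    then have T': "finite T" "T \<subseteq> Omega N" "D \<inter> T = {}"
      using finite_subset[OF T(1)] finite_hball[OF sibling_Omega] hball_sub_Omega D sibling_disj by blast+
    have m1: "{\<omega>' \<in> ?M. \<exists>e\<in>cross_edges D (V m - V n). \<omega>' e} \<in> events"
      unfolding D_def by (rule depends_on_measurable[OF d1 F])
    have m2: "{\<omega>' \<in> ?M. \<forall>e\<in>cross_edges D T. \<not> \<omega>' e} \<in> events"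
      unfolding D_def T_def by (rule depends_on_measurable[OF d2 F])
    \<comment> \<open>If \<open>D\<close> has few expected exits, having any open exit is already
      unlikely. Otherwise \<open>eta\<close> converts the many expected exits into at least eta / 2
      expected edges to \<open>T\<close>, and having none of them is unlikely.\<close>
    have "prob {\<omega>' \<in> ?M. ?Q (D, T) \<omega>'} \<le> \<rho>"
    proof (cases "real (card D) * edge_tail (K n) \<le> 1/2")
      case True
      have "prob {\<omega>' \<in> ?M. ?Q (D, T) \<omega>'} \<le> prob {\<omega>' \<in> ?M. \<exists>e\<in>cross_edges D (V m - V n). \<omega>' e}"
        by (rule finite_measure_mono[OF _ m1]) auto
      also have "{\<omega>' \<in> ?M. \<exists>e\<in>cross_edges D (V m - V n). \<omega>' e} = {\<omega>' \<in> ?M. \<exists>a\<in>D. \<exists>b\<in>V m - V n. \<omega>' {a, b}}"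
        unfolding cross_edges_def by auto
      also have "prob \<dots> \<le> (\<Sum>a\<in>D. prob {\<omega>' \<in> ?M. \<exists>b\<in>V m - V n. \<omega>' {a, b}})"
      proof (rule prob_ex_le[OF D(2)])
        fix a assume a: "a \<in> D"
        have "depends_on ?F (\<lambda>\<omega>'. \<exists>b\<in>V m - V n. \<omega>' {a, b})"
          by (intro depends_on_ex depends_on_edge cross_edges_I) (use a D(1) in blast)+
        then show "{\<omega>' \<in> ?M. \<exists>b\<in>V m - V n. \<omega>' {a, b}} \<in> events" by (rule depends_on_measurable[OF _ F])
      qed
      also have "\<dots> \<le> (\<Sum>a\<in>D. edge_tail (K n))"
      proof (rule sum_mono, rule exit_finite)
        fix a assume a: "a \<in> D"
        show "a \<in> Omega N" using a D by blast
        show "finite (V m - V n)" "V m - V n \<subseteq> Omega N" using V_props by blast+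
        fix b assume "b \<in> V m - V n"
        then show "K n < hdist a b" using a D V_props(2) by (intro hdist_gt[OF N1]) blast+
      qed
      also have "\<dots> = real (card D) * edge_tail (K n)" by simp
      also have "\<dots> \<le> \<rho>" using True by (simp add: \<rho>_def)
      finally show ?thesis .
    next
      case False
      let ?h = "c (Suc (K n)) / real N ^ (2 * Suc (K n))"
      have h0: "0 \<le> ?h" using c_nonneg[of "Suc (K n)"] by simp
      have "prob {\<omega>' \<in> ?M. ?Q (D, T) \<omega>'} \<le> prob {\<omega>' \<in> ?M. \<forall>e\<in>cross_edges D T. \<not> \<omega>' e}"
        by (rule finite_measure_mono[OF _ m2]) auto
      also have "\<dots> \<le> exp (- (?h * card (cross_edges D T)))"
      proof (rule prob_no_edge_le)
        show "finite (cross_edges D T)" using D T' by (simp add: finite_cross_edges)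
        show "cross_edges D T \<subseteq> edges N" using cross_edges_edges[OF D(3) T'(2,3)] .
        fix e assume "e \<in> cross_edges D T"
        then obtain a b where ab: "a \<in> D" "b \<in> T" "e = {a, b}" using cross_edges_E by blast
        then have "edist e = Suc (K n)" using sibling_dist[of a n b] D(1) T(1) by (auto simp: edist_pair)
        then show "?h \<le> c (edist e) / real N ^ (2 * edist e)" by simp
      qed
      also have "\<dots> \<le> exp (- (eta / 2))"
      proof -
        have "eta / 2 \<le> eta * (real (card D) * edge_tail (K n))" using False eta_pos by simp
        also have "\<dots> = real (card D) * (eta * edge_tail (K n))" by simp
        also have "\<dots> \<le> real (card D) * (real (core_size N K n) * ?h)" by (intro mult_left_mono eta) simp
        also have "\<dots> \<le> real (card D) * (real (card T) * ?h)"
          using T(2) h0 by (intro mult_left_mono mult_right_mono) auto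
        also have "\<dots> = ?h * card (cross_edges D T)" by (simp add: card_cross_edges[OF T'(3)])
        finally show ?thesis by simp
      qed
      also have "\<dots> \<le> \<rho>" by (simp add: \<rho>_def)
      finally show ?thesis .
    qed
    then show "prob {\<omega>' \<in> ?M. ?Q (?X \<omega>) \<omega>'} \<le> \<rho>" by (simp add: D_def T_def)
  qed
  also have "\<dots> \<le> \<rho> * prob {\<omega> \<in> ?M. A \<omega>}"
    using depends_on_measurable[OF dA0 E] by (intro mult_left_mono finite_measure_mono \<rho>) auto
  also have "{\<omega> \<in> ?M. ?A \<omega> \<and> ?Q (?X \<omega>) \<omega>} = {\<omega> \<in> ?M. A \<omega> \<and> escapes x n (V m) \<omega>}"
    unfolding escapes_def by auto
  finally show ?thesis .
qed

section \<open>Repeated exits along separated scales\<close>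

lemma escapes_chain_depends_on:
  assumes "strict_mono f"
  shows "depends_on (inner_edges (V (f L))) (\<lambda>\<omega>. \<forall>j\<in>{..<L}. escapes x (f j) (V (f (Suc j))) \<omega>)"
proof (rule depends_on_all)
  fix j assume j: "j \<in> {..<L}"
  have "depends_on (inner_edges (V (f (Suc j)))) (escapes x (f j) (V (f (Suc j))))"
    using assms by (intro escapes_depends_on) (simp add: strict_mono_Suc_iff)
  moreover have "f (Suc j) \<le> f L" using assms j by (simp add: strict_mono_less_eq)
  ultimately show "depends_on (inner_edges (V (f L))) (escapes x (f j) (V (f (Suc j))))"
    using depends_on_mono inner_edges_mono V_props(3) by blast
qed

text \<open>The first L events are determined inside the ball of level f L, so they can be the
  history \<open>A\<close> in the next application of \<open>escapes_bound\<close>.\<close>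

lemma escapes_chain:
  assumes "strict_mono f"
  shows "prob {\<omega> \<in> space (perc_space N c). \<forall>j\<in>{..<L}. escapes x (f j) (V (f (Suc j))) \<omega>} \<le> \<rho> ^ L"
proof (induction L)
  case (Suc L)
  have eq: "{\<omega> \<in> space (perc_space N c). \<forall>j\<in>{..<Suc L}. escapes x (f j) (V (f (Suc j))) \<omega>}
    = {\<omega> \<in> space (perc_space N c). (\<forall>j\<in>{..<L}. escapes x (f j) (V (f (Suc j))) \<omega>) \<and> escapes x (f L) (V (f (Suc L))) \<omega>}"
    by (auto simp: lessThan_Suc)
  have "f L < f (Suc L)" using assms by (simp add: strict_mono_Suc_iff)
  note escapes_bound[OF this escapes_chain_depends_on[OF assms], of x x]
  also have "\<rho> * prob {\<omega> \<in> space (perc_space N c). \<forall>j\<in>{..<L}. escapes x (f j) (V (f (Suc j))) \<omega>} \<le> \<rho> * \<rho> ^ L"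
    by (rule mult_left_mono[OF Suc \<rho>(1)])
  finally show ?case unfolding eq by simp
qed simp

lemma AE_not_isolated:
  "AE \<omega> in perc_space N c. \<not> (\<forall>n\<ge>n1. escapes x n (Omega N) \<omega>)"
proof (rule AE_of_small)
  fix \<epsilon> :: real assume \<epsilon>: "\<epsilon> > 0"
  let ?M = "space (perc_space N c)"
  have "(\<lambda>L. \<rho> ^ L) \<longlonglongrightarrow> 0" using \<rho> by (intro LIMSEQ_realpow_zero) auto
  from order_tendstoD(2)[OF this, of "\<epsilon> / 2"] \<epsilon> obtain L where L: "\<rho> ^ L < \<epsilon> / 2"
    by (auto simp: eventually_sequentially)
  define \<delta> where "\<delta> = \<epsilon> / (2 * (real L + 1))"
  have \<delta>: "\<delta> > 0" using \<epsilon> by (simp add: \<delta>_def)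
  have Kinf: "n \<le> K n" for n by (induction n) (use K_less Suc_leI le_less_trans in blast)+
  \<comment> \<open>Next scale so far out that an open edge from the ball of level n reaching beyond
    it has probability at most \<delta>. The L steps together then spend at most \<epsilon> /
    2.\<close>
  have "\<exists>m>n. real N ^ K n * edge_tail (K m) \<le> \<delta>" for n
  proof -
    have N0: "real N ^ K n > 0" using N2 by simp
    from order_tendstoD(2)[OF edge_tail_tendsto, of "\<delta> / real N ^ K n"] \<delta> N0 obtain m0
      where m0: "\<And>m. m \<ge> m0 \<Longrightarrow> edge_tail m < \<delta> / real N ^ K n" by (auto simp: eventually_sequentially)
    have "edge_tail (K (max m0 (Suc n))) < \<delta> / real N ^ K n"
      using m0 Kinf[of "max m0 (Suc n)"] by simp
    then have "real N ^ K n * edge_tail (K (max m0 (Suc n))) \<le> \<delta>" using N0 by (simp add: field_simps)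
    then show ?thesis by (intro exI[of _ "max m0 (Suc n)"]) simp
  qed
  then obtain nx where nx: "\<And>n. nx n > n" "\<And>n. real N ^ K n * edge_tail (K (nx n)) \<le> \<delta>" by metis
  define f where "f j = (nx ^^ j) n1" for j
  have f: "strict_mono f" "f 0 = n1" by (auto simp: strict_mono_Suc_iff f_def nx)
  have fS: "f (Suc j) = nx (f j)" for j by (simp add: f_def)
  have f1: "n1 \<le> f j" for j using f by (metis strict_mono_less_eq zero_le)
  define B1 where "B1 = {\<omega> \<in> ?M. \<forall>j\<in>{..<L}. escapes x (f j) (V (f (Suc j))) \<omega>}"
  define G where "G j = {\<omega> \<in> ?M. \<exists>a\<in>V (f j). \<exists>b\<in>Omega N. K (f (Suc j)) < hdist a b \<and> \<omega> {a, b}}" for j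
  define B2 where "B2 = (\<Union>j\<in>{..<L}. G j)"
  have Kf: "K (f j) \<le> K (f (Suc j))" for j using f by (intro K_mono) (simp add: strict_mono_less_eq)
  have B1: "B1 \<in> events" unfolding B1_def by (rule depends_on_measurable[OF escapes_chain_depends_on[OF f(1)]]) (simp_all add: inner_edges_ball)
  have P1: "prob B1 \<le> \<epsilon> / 2" using escapes_chain[OF f(1), where x = x and L = L] L unfolding B1_def by simp
  have G: "G j \<in> events" "prob (G j) \<le> \<delta>" for j
    unfolding G_def using far_ball[of "K (f j)" "K (f (Suc j))"] nx(2)[of "f j"] fS[of j] by auto
  have B2: "B2 \<in> events" unfolding B2_def by (rule sets.finite_UN) (simp_all add: G)
  have "prob B2 \<le> (\<Sum>j\<in>{..<L}. prob (G j))"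
    unfolding B2_def by (rule finite_measure_subadditive_finite) (use G in auto)
  also have "\<dots> \<le> (\<Sum>j\<in>{..<L}. \<delta>)" by (rule sum_mono) (rule G)
  also have "\<dots> \<le> \<epsilon> / 2" using \<epsilon> by (simp add: \<delta>_def field_simps)
  finally have P2: "prob B2 \<le> \<epsilon> / 2" .
  show "\<exists>B\<in>events. prob B \<le> \<epsilon> \<and> {\<omega> \<in> ?M. \<not> \<not> (\<forall>n\<ge>n1. escapes x n (Omega N) \<omega>)} \<subseteq> B"
  proof (intro bexI[of _ "B1 \<union> B2"] conjI subsetI)
    show "prob (B1 \<union> B2) \<le> \<epsilon>" using measure_Un_le[OF B1 B2] P1 P2 by linarith
    show "B1 \<union> B2 \<in> events" using B1 B2 by blast
    fix \<omega> assume "\<omega> \<in> {\<omega> \<in> ?M. \<not> \<not> (\<forall>n\<ge>n1. escapes x n (Omega N) \<omega>)}"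
    then have \<omega>: "\<omega> \<in> ?M" "\<And>n. n \<ge> n1 \<Longrightarrow> escapes x n (Omega N) \<omega>" by auto
    show "\<omega> \<in> B1 \<union> B2"
    proof (rule ccontr)
      assume no: "\<omega> \<notin> B1 \<union> B2"
      then obtain j where j: "j < L" "\<not> escapes x (f j) (V (f (Suc j))) \<omega>" using \<omega> by (auto simp: B1_def)
      have h: "escapes x (f j) (Omega N) \<omega>" using \<omega>(2) f1 by blast
      then obtain e where e: "e \<in> cross_edges (local_cluster x (f j) \<omega>) (Omega N - V (f j))" "\<omega> e" unfolding escapes_def by blast
      then obtain a b where ab: "a \<in> local_cluster x (f j) \<omega>" "b \<in> Omega N - V (f j)" "e = {a, b}" using cross_edges_E by blast
      have "b \<notin> V (f (Suc j))"
      proof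
        assume "b \<in> V (f (Suc j))"
        then have "e \<in> cross_edges (local_cluster x (f j) \<omega>) (V (f (Suc j)) - V (f j))" using ab cross_edges_I by blast
        then show False using h j(2) e(2) unfolding escapes_def by blast
      qed
      moreover have aV: "a \<in> V (f j)" using ab local_cluster_sub by blast
      then have "a \<in> V (f (Suc j))" using hball_mono[OF Kf] by blast
      ultimately have "K (f (Suc j)) < hdist a b" using ab by (intro hdist_gt[OF N1]) auto
      then have "\<omega> \<in> G j" using \<omega> aV ab e unfolding G_def by blast
      then show False using no j by (auto simp: B2_def)
    qed
  qed
qed

lemma AE_eventually_good:
  assumes "\<And>n. y n \<in> Omega N"
  shows "AE \<omega> in perc_space N c. eventually (\<lambda>n. core N K n (y n) \<omega> \<noteq> {}) sequentially"
proof -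
  let ?B = "\<lambda>n. {\<omega> \<in> space (perc_space N c). core N K n (y n) \<omega> = {}}"
  have m: "?B n \<in> events" for n by (rule core_empty_measurable[OF assms])
  have "summable (\<lambda>n. prob (?B n))"
    by (rule summable_comparison_test'[OF eps_sum(1), of 0]) (simp add: prob_bad[OF assms])
  then have "AE \<omega> in perc_space N c. eventually (\<lambda>n. \<omega> \<in> space (perc_space N c) - ?B n) sequentially"
    using m by (intro borel_cantelli_AE1) (auto simp: emeasure_eq_measure)
  then show ?thesis
  proof (rule eventually_mono)
    fix \<omega> assume "eventually (\<lambda>n. \<omega> \<in> space (perc_space N c) - ?B n) sequentially"
    then show "eventually (\<lambda>n. core N K n (y n) \<omega> \<noteq> {}) sequentially" by (rule eventually_mono) blast
  qed
qed

text \<open>Past the last bad level, every infinite cluster hits a sibling core, hence the core of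
  the next ball around the origin. These cores all contain the fixed point \<open>u\<close>, so
  every infinite cluster is the cluster of \<open>u\<close>.\<close>

theorem uniqueness: "unique_infinite_cluster N c"
proof -
  have "AE \<omega> in perc_space N c. \<forall>x\<in>Omega N. \<forall>n1. \<not> (\<forall>n\<ge>n1. escapes x n (Omega N) \<omega>)"
    using countable_Omega[OF N1] AE_not_isolated by (simp add: AE_ball_countable AE_all_countable)
  with AE_short AE_eventually_good[of "\<lambda>_. zero_seq", OF zero_seq_in] AE_eventually_good[of sibling, OF sibling_Omega]
  show ?thesis
    unfolding unique_infinite_cluster_def
  proof eventually_elim
    case (elim \<omega>)
    have short: "\<And>a b. a \<in> Omega N \<Longrightarrow> b \<in> Omega N \<Longrightarrow> a \<noteq> b \<Longrightarrow> hdist a b \<le> K 0 \<Longrightarrow> \<omega> {a, b}"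
      using elim(1) by blast
    obtain n2 where n2: "\<And>n. n \<ge> n2 \<Longrightarrow> core N K n zero_seq \<omega> \<noteq> {}" "\<And>n. n \<ge> n2 \<Longrightarrow> core N K n (sibling n) \<omega> \<noteq> {}"
      using eventually_conj[OF elim(2,3)] by (auto simp: eventually_sequentially)
    then obtain u where u: "u \<in> core N K n2 zero_seq \<omega>" by blast
    have main: "cluster N \<omega> x = cluster N \<omega> u" if x: "x \<in> Omega N" "infinite (cluster N \<omega> x)" for x
    proof -
      obtain n3 where n3: "x \<in> hball N n3 zero_seq" using x(1) Omega_UN_hball[OF N1] by auto
      have Kinf: "n \<le> K n" for n by (induction n) (use K_less Suc_leI le_less_trans in blast)+
      have "\<not> (\<forall>n\<ge>max n2 n3. escapes x n (Omega N) \<omega>)" using elim(4) x by blast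
      then obtain n where n: "n \<ge> n2" "n \<ge> n3" "\<not> escapes x n (Omega N) \<omega>" by auto
      have "n3 \<le> K n" using n(2) Kinf[of n] by simp
      then have xV: "x \<in> V n" using n3 hball_mono by blast
      obtain a b where ab: "a \<in> V n" "conn_in (V n) \<omega> x a" "b \<in> Omega N - V n" "\<omega> {a, b}"
        using cluster_exit[OF V_props(1) xV V_props(2) x(2)] by blast
      then have "{a, b} \<in> cross_edges (local_cluster x n \<omega>) (Omega N - V n)" by (intro cross_edges_I) (auto simp: local_cluster_def)
      then obtain e where e: "e \<in> cross_edges (local_cluster x n \<omega>) (core N K n (sibling n) \<omega>)" "\<omega> e"
        using n n2 ab unfolding escapes_def by blast
      then obtain a' b' where ab': "a' \<in> local_cluster x n \<omega>" "b' \<in> core N K n (sibling n) \<omega>" "e = {a', b'}" using cross_edges_E by blast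
      have O: "a' \<in> Omega N" "b' \<in> Omega N" using ab' local_cluster_sub core_sub hball_sub_Omega by blast+
      have "a' \<in> cluster N \<omega> x" using ab' conn_in_cluster[OF V_props(2)] by (auto simp: local_cluster_def)
      moreover have "b' \<in> cluster N \<omega> a'" using cluster_edge[OF _ O] e ab' by blast
      ultimately have bx: "b' \<in> cluster N \<omega> x" using cluster_trans by blast
      have ne: "core N K (Suc n) zero_seq \<omega> \<noteq> {}" by (rule n2(1)) (use n in simp)
      have "b' \<in> core N K (Suc n) zero_seq \<omega>" using core_step[OF ne sibling_R] ab' by blast
      moreover have "u \<in> core N K (Suc n) zero_seq \<omega>"
      proof -
        have "core N K n2 zero_seq \<omega> \<subseteq> core N K (Suc n) zero_seq \<omega>"
          by (rule core_mono_zero[OF n2(1)]) (use n in simp_all)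
        then show ?thesis using u by blast
      qed
      ultimately have "b' \<in> cluster N \<omega> u" using core_cluster[of \<omega>, OF short zero_seq_in] by blast
      then show ?thesis using bx cluster_eq by blast
    qed
    show ?case using main by blast
  qed
qed

end

section \<open>Choice of the scales\<close>

text \<open>Half of D = (2t)^-r is allotted to each term. The choice r = 2a + 1 gives t^(2a) t^(-2r)
  = t^(-r) / t, and the spare factor 1/t absorbs \<open>M\<close>; the logarithmic hypothesis
  handles the exponential. Finally t + 1 \<le> 2t.\<close>

lemma scale_step:
  fixes t a r \<kappa> \<beta> M N :: real
  assumes "N > 0" and r: "r = 2 * a + 1" and M: "M = 2 * N\<^sup>2 * 2 powr r" and t: "t \<ge> 1" "t \<ge> M" and r0: "r \<ge> 0"
    and ln: "ln M + (2 * a + r) * ln t \<le> \<kappa> * t powr \<beta>"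
  shows "(N * t powr a)\<^sup>2 * ((t powr - r)\<^sup>2 + exp (- (\<kappa> * t powr \<beta>))) \<le> (t + 1) powr - r"
proof -
  have M0: "M > 0" using assms by simp
  define D where "D = (2 * t) powr - r"
  have D: "D = 2 powr - r * t powr - r" using t by (simp add: D_def powr_mult)
  have N2: "N\<^sup>2 = M * 2 powr - r / 2" using M by (simp add: powr_minus field_simps)
  have ta: "(t powr a)\<^sup>2 = t powr (2 * a)" using t by (simp add: power2_eq_square powr_add[symmetric])
  have tr: "(t powr - r)\<^sup>2 = t powr (- 2 * r)" using t by (simp add: power2_eq_square powr_add[symmetric])
  have "t powr (2 * a) * t powr (- 2 * r) = t powr - r * t powr (- 1)"
    unfolding powr_add[symmetric] using r by (simp add: algebra_simps)
  also have "t powr (- 1) = 1 / t" using t by (simp add: powr_minus divide_inverse)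
  finally have e1: "(N * t powr a)\<^sup>2 * (t powr - r)\<^sup>2 = (M / t) * (D / 2)"
    unfolding power_mult_distrib ta tr mult.assoc by (simp add: N2 D)
  have "(M / t) * (D / 2) \<le> 1 * (D / 2)"
    using t M0 by (intro mult_right_mono) (auto simp: D_def field_simps)
  then have p1: "(N * t powr a)\<^sup>2 * (t powr - r)\<^sup>2 \<le> D / 2" using e1 by simp
  have "exp (- (\<kappa> * t powr \<beta>)) \<le> exp (- (ln M + (2 * a + r) * ln t))" using ln by simp
  also have "\<dots> = 1 / M * t powr (- (2 * a + r))"
    using M0 t by (simp add: exp_diff exp_minus powr_def field_simps exp_add)
  finally have "(N * t powr a)\<^sup>2 * exp (- (\<kappa> * t powr \<beta>)) \<le> (N * t powr a)\<^sup>2 * (1 / M * t powr (- (2 * a + r)))"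
    by (rule mult_left_mono) simp
  also have "\<dots> = N\<^sup>2 / M * (t powr (2 * a) * t powr (- (2 * a + r)))"
    unfolding power_mult_distrib ta by simp
  also have "t powr (2 * a) * t powr (- (2 * a + r)) = t powr - r" unfolding powr_add[symmetric] by simp
  also have "N\<^sup>2 / M * t powr - r = D / 2" using M0 by (simp add: N2 D)
  finally have p2: "(N * t powr a)\<^sup>2 * exp (- (\<kappa> * t powr \<beta>)) \<le> D / 2" .
  have "(N * t powr a)\<^sup>2 * ((t powr - r)\<^sup>2 + exp (- (\<kappa> * t powr \<beta>))) \<le> D"
    unfolding distrib_left using p1 p2 by simp
  also have "D \<le> (t + 1) powr - r" unfolding D_def using t r0 by (intro powr_mono2') auto
  finally show ?thesis .
qed

text \<open>Rounding a log_N t up to an integer costs at most a factor N.\<close>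

lemma ex_gap:
  fixes N t :: nat and a :: real
  assumes N: "N \<ge> 2" and t: "t \<ge> 2" and a: "a > 0"
  shows "\<exists>g\<ge>1. real t powr a \<le> real N ^ g \<and> real N ^ g \<le> real N * real t powr a"
proof -
  define y where "y = a * log N t"
  have y: "y > 0" using assms by (simp add: y_def)
  have ty: "real t powr a = real N powr y"
  proof -
    have "real N powr y = (real N powr log N t) powr a" by (simp add: y_def powr_powr mult.commute)
    then show ?thesis using assms by simp
  qed
  define g where "g = nat \<lceil>y\<rceil>"
  have g: "y \<le> real g" "real g \<le> y + 1" "g \<ge> 1" using y unfolding g_def by linarith+
  have Ng: "real N ^ g = real N powr real g" using N by (simp add: powr_realpow)
  have "real N powr y \<le> real N powr real g" using g N by (intro powr_mono) auto
  moreover have "real N powr real g \<le> real N powr (y + 1)" using g N by (intro powr_mono) auto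
  moreover have "real N powr (y + 1) = real N * real N powr y" using N by (simp add: powr_add)
  ultimately show ?thesis using g(3) unfolding ty Ng[symmetric] by (intro exI[of _ g]) auto
qed

text \<open>From j + k + 1 \<le> (j + 1)(k + 1): powers factor and logarithms add. C_0 \<ge> 1 makes
  the weight at k + 1 at least one, so the additive logarithmic term can be turned into a multiple
  of it. Hence \<open>edge_tail\<close> is comparable with its first term.\<close>

lemma ck_growth:
  assumes C: "C0 \<ge> 1" "C1 \<ge> 0" "C2 \<ge> 0" and \<alpha>: "\<alpha> \<ge> 0"
  shows "ck C0 C1 C2 \<alpha> (j + Suc k) \<le> ck C0 C1 C2 \<alpha> (Suc k) * (real (Suc j) powr \<alpha> + C1 * real (Suc j))"
proof -
  define u v x where "u = real (Suc k)" and "v = real (Suc j)" and "x = real (j + Suc k)"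
  define b where "b = ck C0 C1 C2 \<alpha> (Suc k)"
  have b: "b = C0 + C1 * ln u + C2 * u powr \<alpha>" by (simp add: b_def ck_def u_def)
  have uv: "u \<ge> 1" "v \<ge> 1" "x > 0" "x \<le> u * v" by (simp_all add: u_def v_def x_def algebra_simps)
  have "ln x \<le> ln (u * v)" using uv by simp
  also have "\<dots> = ln u + ln v" using uv by (simp add: ln_mult)
  also have "\<dots> \<le> ln u + v" using ln_le_minus_one[of v] uv by simp
  finally have l: "C1 * ln x \<le> C1 * (ln u + v)" using C by (intro mult_left_mono) auto
  have "x powr \<alpha> \<le> (u * v) powr \<alpha>" using uv \<alpha> by (intro powr_mono2) auto
  also have "\<dots> = u powr \<alpha> * v powr \<alpha>" by (rule powr_mult)
  finally have p: "C2 * x powr \<alpha> \<le> C2 * (u powr \<alpha> * v powr \<alpha>)" using C by (intro mult_left_mono) auto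
  have v1: "1 \<le> v powr \<alpha>" using \<alpha> uv by (intro ge_one_powr_ge_zero) auto
  have cu: "0 \<le> C1 * ln u" "0 \<le> C2 * u powr \<alpha>" using C uv by auto
  then have b1: "1 \<le> b" using C unfolding b by linarith
  have m1: "(C0 + C1 * ln u) * 1 \<le> (C0 + C1 * ln u) * v powr \<alpha>" using C cu v1 by (intro mult_left_mono) auto
  have m2: "1 * (C1 * v) \<le> b * (C1 * v)" using b1 C uv by (intro mult_right_mono) auto
  have "C0 + C1 * ln x + C2 * x powr \<alpha> \<le> (C0 + C1 * ln u) * 1 + 1 * (C1 * v) + C2 * (u powr \<alpha> * v powr \<alpha>)"
    using l p by (simp add: distrib_left)
  also have "\<dots> \<le> (C0 + C1 * ln u) * v powr \<alpha> + b * (C1 * v) + C2 * (u powr \<alpha> * v powr \<alpha>)"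
    by (intro add_mono m1 m2 order_refl)
  also have "\<dots> = b * (v powr \<alpha> + C1 * v)"
  proof -
    have "b * v powr \<alpha> = (C0 + C1 * ln u) * v powr \<alpha> + C2 * (u powr \<alpha> * v powr \<alpha>)"
      by (simp add: b algebra_simps)
    then show ?thesis by (simp add: distrib_left)
  qed
  finally have "C0 + C1 * ln x + C2 * x powr \<alpha> \<le> b * (v powr \<alpha> + C1 * v)" .
  then show ?thesis by (simp add: ck_def b_def u_def v_def x_def)
qed

theorem percolation_and_uniqueness_ck:
  fixes N :: nat assumes N: "N \<ge> 2" and \<alpha>: "\<alpha> > 2" and C1: "C1 \<ge> 0"
  shows "\<exists>C0s>0. \<exists>C2s>0. \<forall>C0 C2. C0 > C0s \<and> C2 > C2s \<longrightarrow>
     percolates N (ck C0 C1 C2 \<alpha>) \<and> unique_infinite_cluster N (ck C0 C1 C2 \<alpha>)"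
proof -
  \<comment> \<open>The midpoint of 1 and \<alpha>/2; then \<beta> = \<alpha> - 2a is positive and
    governs the exponential estimate. The constant \<kappa> collects a factor 4 from squaring the
    half-size of cores and N^2 from rounding the gaps.\<close>
  define a where "a = (\<alpha> + 2) / 4"
  define \<beta> where "\<beta> = (\<alpha> - 2) / 2"
  define r where "r = 2 * a + 1"
  define \<kappa> where "\<kappa> = 1 / (4 * (real N)\<^sup>2)"
  define M where "M = 2 * (real N)\<^sup>2 * 2 powr r"
  have a: "a > 1" and \<beta>: "\<beta> > 0" "\<alpha> = 2 * a + \<beta>" using \<alpha> by (auto simp: a_def \<beta>_def field_simps)
  have \<kappa>: "\<kappa> > 0" using N by (simp add: \<kappa>_def)
  have r: "r > a" "r \<ge> 0" using a by (auto simp: r_def)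
  have sa: "summable (\<lambda>i. real i powr - a)" using a by (subst summable_real_powr_iff) auto
  have sr: "summable (\<lambda>i. real i powr - r)" using a r by (subst summable_real_powr_iff) auto
  \<comment> \<open>A tail below 1/2 ensures that the fractions of a ball lost over all levels add
    up to less than one half.\<close>
  obtain n1 where n1: "\<And>n. n \<ge> n1 \<Longrightarrow> norm (\<Sum>i. real (i + n) powr - a) < 1/2"
    using suminf_exist_split[OF _ sa, of "1/2"] by auto
  have "eventually (\<lambda>t::nat. ln M + (2 * a + r) * ln (real t) \<le> \<kappa> * real t powr \<beta>) sequentially"
  proof -
    have l1: "(\<lambda>t::nat. ln (real t) / real t powr \<beta>) \<longlonglongrightarrow> 0" by (rule lim_ln_over_power) (rule \<beta>(1))
    have "(\<lambda>t::nat. real t powr - \<beta>) \<longlonglongrightarrow> 0"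
      using \<beta> by (intro tendsto_neg_powr filterlim_real_sequentially) auto
    from tendsto_mult_left[OF this, of "ln M"]
    have l2: "(\<lambda>t::nat. ln M / real t powr \<beta>) \<longlonglongrightarrow> 0" by (simp add: powr_minus divide_inverse)
    have "(\<lambda>t::nat. ln M / real t powr \<beta> + (2 * a + r) * (ln (real t) / real t powr \<beta>)) \<longlonglongrightarrow> 0 + (2 * a + r) * 0"
      by (intro tendsto_intros l1 l2)
    then have "eventually (\<lambda>t::nat. ln M / real t powr \<beta> + (2 * a + r) * (ln (real t) / real t powr \<beta>) < \<kappa>) sequentially"
      using \<kappa> by (intro order_tendstoD(2)) auto
    then show ?thesis using eventually_gt_at_top[of 0]
    proof eventually_elim
      case (elim t)
      then have "real t powr \<beta> > 0" by simp
      with elim(1) show ?case by (simp add: field_simps)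
    qed
  qed
  then obtain n2 where n2: "\<And>t. t \<ge> n2 \<Longrightarrow> ln M + (2 * a + r) * ln (real t) \<le> \<kappa> * real t powr \<beta>"
    by (auto simp: eventually_sequentially)
  obtain n3 :: nat where n3: "M \<le> real n3" using real_arch_simple by blast
  define n0 where "n0 = max (max n1 n2) (max n3 2)"
  have n0: "n0 \<ge> n1" "n0 \<ge> n2" "n0 \<ge> n3" "n0 \<ge> 2" by (auto simp: n0_def)
  have "\<exists>g\<ge>1. real t powr a \<le> real N ^ g \<and> real N ^ g \<le> real N * real t powr a" if "t \<ge> 2" for t :: nat
    using ex_gap[OF N that, of a] a by simp
  then have "\<exists>\<gamma>. \<forall>t\<ge>2. \<gamma> t \<ge> 1 \<and> real t powr a \<le> real N ^ \<gamma> t \<and> real N ^ \<gamma> t \<le> real N * real t powr a"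
    by metis
  then obtain \<gamma> where \<gamma>: "\<And>t. t \<ge> 2 \<Longrightarrow> \<gamma> t \<ge> (1::nat)" "\<And>t. t \<ge> 2 \<Longrightarrow> real t powr a \<le> real N ^ \<gamma> t"
    "\<And>t. t \<ge> 2 \<Longrightarrow> real N ^ \<gamma> t \<le> real N * real t powr a" by blast
  define K where "K n = n0 + (\<Sum>i<n. \<gamma> (i + n0))" for n
  have KS: "K (Suc n) = K n + \<gamma> (n + n0)" for n by (simp add: K_def)
  have \<gamma>1: "\<gamma> (n + n0) \<ge> 1" for n using \<gamma>(1)[of "n + n0"] n0 by simp
  have Kge: "n + n0 \<le> K n" for n
  proof (induction n)
    case (Suc n) then show ?case using KS[of n] \<gamma>1[of n] by simp
  qed (simp add: K_def)
  have gap: "real N ^ (K (Suc n) - K n) = real N ^ \<gamma> (n + n0)" for n by (simp add: KS)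
  define G where "G n = real N ^ \<gamma> (n + n0)" for n
  have G: "real (n + n0) powr a \<le> G n" "G n \<le> real N * real (n + n0) powr a" "G n > 0" for n
    using \<gamma>(2,3)[of "n + n0"] n0 N by (auto simp: G_def)
  define eps where "eps n = real (n + n0) powr - r" for n
  \<comment> \<open>Uses j > K n \<ge> n + n0 and C_2 > 1 to bound c_j from below by (n +
    n0)^\<alpha>, and j \<le> K (n+1) in the denominator.\<close>
  define q where "q n = real (n + n0) powr \<alpha> / real N ^ (2 * K (Suc n))" for n
  have sa': "summable (\<lambda>i. real (i + n0) powr - a)" using summable_ignore_initial_segment[OF sa] .
  have tail: "(\<Sum>i. real (i + n0) powr - a) < 1/2" using n1[OF n0(1)] by simp
  have Ginv: "1 / G n \<le> real (n + n0) powr - a" for n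
    using le_imp_inverse_le[OF G(1)[of n]] n0 by (simp add: powr_minus inverse_eq_divide)
  \<comment> \<open>The product of the factors 1 - 1/G is bounded below by one minus the sum of the
    1/G, each at most (i + n0)^-a.\<close>
  have core_size: "real N ^ K n * (1 - (\<Sum>i<n. real (i + n0) powr - a)) \<le> real (core_size N K n)" for n
  proof (induction n)
    case 0 then show ?case by simp
  next
    case (Suc n)
    let ?s = "\<Sum>i<n. real (i + n0) powr - a" and ?x = "real (n + n0) powr - a"
    have s: "0 \<le> ?s" by (intro sum_nonneg) simp
    have "N ^ (K (Suc n) - K n) \<ge> 1" using N by simp
    then have eq: "real (core_size N K (Suc n)) = (G n - 1) * real (core_size N K n)"
      using gap[of n] by (simp add: of_nat_diff G_def)
    have x1: "?x \<le> 1"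
    proof -
      have "1 powr a \<le> real (n + n0) powr a" using n0 a by (intro powr_mono2) auto
      then show ?thesis using n0 by (simp add: powr_minus divide_simps)
    qed
    have Gx: "G n * (1 - ?x) \<le> G n - 1" using Ginv[of n] G(3)[of n] by (simp add: field_simps)
    have "real N ^ K (Suc n) * (1 - (?s + ?x)) \<le> real N ^ K (Suc n) * ((1 - ?s) * (1 - ?x))"
      using s by (intro mult_left_mono) (simp_all add: algebra_simps)
    also have "\<dots> = (G n * (1 - ?x)) * (real N ^ K n * (1 - ?s))" by (simp add: KS G_def power_add)
    also have "\<dots> \<le> (G n * (1 - ?x)) * real (core_size N K n)"
      using Suc G(3)[of n] x1 by (intro mult_left_mono) auto
    also have "\<dots> \<le> (G n - 1) * real (core_size N K n)" using Gx by (intro mult_right_mono) auto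
    finally show ?case unfolding eq sum.lessThan_Suc .
  qed
  have core_size_half: "real N ^ K n / 2 \<le> real (core_size N K n)" for n
  proof -
    have "(\<Sum>i<n. real (i + n0) powr - a) \<le> (\<Sum>i. real (i + n0) powr - a)"
      using sa' by (intro sum_le_suminf) auto
    then have "1/2 \<le> 1 - (\<Sum>i<n. real (i + n0) powr - a)" using tail by simp
    then have "real N ^ K n * (1/2) \<le> real N ^ K n * (1 - (\<Sum>i<n. real (i + n0) powr - a))"
      by (intro mult_left_mono) auto
    then show ?thesis using core_size[of n] by simp
  qed
  have eps_step: "(real N ^ (K (Suc n) - K n))\<^sup>2 * ((eps n)\<^sup>2 + exp (- (q n * (real (core_size N K n))\<^sup>2))) \<le> eps (Suc n)" for n
  proof -
    let ?t = "real (n + n0)"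
    have t: "?t \<ge> 1" "?t \<ge> M" "n + n0 \<ge> n2" using n0 n3 by auto
    have qs: "\<kappa> * ?t powr \<beta> \<le> q n * (real (core_size N K n))\<^sup>2"
    proof -
      have "(G n)\<^sup>2 \<le> (real N * ?t powr a)\<^sup>2" using G[of n] by (intro power_mono) auto
      also have "\<dots> = (real N)\<^sup>2 * ?t powr (2 * a)"
        using t by (simp add: power_mult_distrib power2_eq_square powr_add[symmetric])
      finally have g: "(G n)\<^sup>2 \<le> (real N)\<^sup>2 * ?t powr (2 * a)" .
      have "?t powr \<alpha> = ?t powr (2 * a) * ?t powr \<beta>" using \<beta>(2) by (simp add: powr_add)
      then have "\<kappa> * ?t powr \<beta> = ?t powr \<alpha> / (4 * ((real N)\<^sup>2 * ?t powr (2 * a)))"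
        using t N by (simp add: \<kappa>_def field_simps)
      also have "\<dots> \<le> ?t powr \<alpha> / (4 * (G n)\<^sup>2)"
        using g G(3)[of n] t N by (intro divide_left_mono mult_left_mono mult_pos_pos) auto
      also have "\<dots> = q n * (real N ^ K n / 2)\<^sup>2"
        using N by (simp add: q_def KS G_def power_add power_divide power_mult[symmetric] mult.commute field_simps)
      also have "\<dots> \<le> q n * (real (core_size N K n))\<^sup>2"
        using core_size_half[of n] by (intro mult_left_mono power_mono) (auto simp: q_def)
      finally show ?thesis .
    qed
    have "(real N ^ (K (Suc n) - K n))\<^sup>2 * ((eps n)\<^sup>2 + exp (- (q n * (real (core_size N K n))\<^sup>2)))
      \<le> (real N * ?t powr a)\<^sup>2 * ((?t powr - r)\<^sup>2 + exp (- (\<kappa> * ?t powr \<beta>)))"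
      using G[of n] qs unfolding gap G_def[symmetric] eps_def
      by (intro mult_mono power_mono add_mono) auto
    also have "\<dots> \<le> (?t + 1) powr - r"
      by (rule scale_step[OF _ r_def M_def t(1,2) r(2) n2[OF t(3)]]) (use N in simp)
    also have "\<dots> = eps (Suc n)" by (simp add: eps_def add.commute)
    finally show ?thesis .
  qed
  have eps_sum: "summable eps" unfolding eps_def using summable_ignore_initial_segment[OF sr] .
  have eps_tail: "(\<Sum>n. eps (Suc n)) < 1"
  proof -
    have "(\<Sum>n. eps (Suc n)) \<le> (\<Sum>i. real (i + n0) powr - a)"
    proof (rule suminf_le[OF _ _ sa'])
      fix n
      have "eps (Suc n) \<le> real (n + n0) powr - r" unfolding eps_def using n0 r by (intro powr_mono2') auto
      also have "\<dots> \<le> real (n + n0) powr - a" using n0 r by (intro powr_mono) auto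
      finally show "eps (Suc n) \<le> real (n + n0) powr - a" .
    qed (use eps_sum in \<open>simp add: summable_Suc_iff\<close>)
    then show ?thesis using tail by simp
  qed
  define Zf where "Zf j = (real j powr \<alpha> + C1 * real j) / real N ^ j" for j
  have "summable Zf"
    using summable_add[OF summable_ck_aux(1)[OF N, of \<alpha>] summable_mult[OF summable_ck_aux(4)[OF N], of C1]]
    unfolding Zf_def by (simp add: add_divide_distrib)
  then have sZ: "summable (\<lambda>j. Zf (Suc j))" by (simp add: summable_Suc_iff)
  define Z where "Z = (\<Sum>j. Zf (Suc j))"
  have Z0: "Z \<ge> 0" unfolding Z_def by (rule suminf_nonneg[OF sZ]) (use C1 in \<open>simp add: Zf_def\<close>)
  \<comment> \<open>The factor 2 comes from the half-size of the core, N^2 from the extra step in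
    the exponent 2 (K n + 1), and Z + 1 from bounding the tail by its first term.\<close>
  define eta where "eta = 1 / (2 * (real N)\<^sup>2 * (Z + 1))"
  \<comment> \<open>C_0 > N^(2 n0) makes the edges of length up to K 0 = n0 certain, and C_2 > 1
    gives c_j \<ge> j^\<alpha>.\<close>
  show ?thesis
  proof (rule exI[of _ "real N ^ (2 * n0)"], rule conjI, use N in simp, rule exI[of _ 1], rule conjI, simp,
      intro allI impI)
    fix C0 C2 :: real assume C: "real N ^ (2 * n0) < C0 \<and> 1 < C2"
    have "1 \<le> real N ^ (2 * n0)" using N by (intro one_le_power) auto
    then have C0: "C0 \<ge> 1" "C0 \<ge> 0" "C2 \<ge> 1" "C2 \<ge> 0" using C by auto
    let ?c = "ck C0 C1 C2 \<alpha>"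
    interpret hs: hperc_sum N ?c using hperc_sum_ck[OF N C0(2) C1 C0(4)] .
    have cge: "C0 \<le> ?c j" "real j powr \<alpha> \<le> ?c j" if "1 \<le> j" for j
    proof -
      have 1: "0 \<le> C1 * ln (real j)" using C1 that by simp
      have 2: "1 * real j powr \<alpha> \<le> C2 * real j powr \<alpha>" using C0 by (intro mult_right_mono) auto
      have 3: "0 \<le> real j powr \<alpha>" by simp
      show "C0 \<le> ?c j" "real j powr \<alpha> \<le> ?c j" unfolding ck_def using 1 2 3 C0 by linarith+
    qed
    interpret renorm_exit N ?c K eps q eta
    proof unfold_locales
      fix n j :: nat
      show "K n < K (Suc n)" using KS[of n] \<gamma>1[of n] by simp
      show "0 \<le> eps n" "0 \<le> q n" by (simp_all add: eps_def q_def)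
      show "q n \<le> ?c j / real N ^ (2 * j)" if "K n < j" "j \<le> K (Suc n)"
      proof -
        have "real (n + n0) powr \<alpha> \<le> real j powr \<alpha>"
          using Kge[of n] that \<alpha> by (intro powr_mono2) auto
        also have "\<dots> \<le> ?c j" using that by (intro cge) auto
        finally have "real (n + n0) powr \<alpha> \<le> ?c j" .
        moreover have "0 \<le> ?c j" using cge(1)[of j] that C0 by simp
        ultimately show ?thesis unfolding q_def using that N by (intro frac_le power_increasing) auto
      qed
      show "(real N ^ (K (Suc n) - K n))\<^sup>2 * ((eps n)\<^sup>2 + exp (- (q n * (real (core_size N K n))\<^sup>2))) \<le> eps (Suc n)"
        by (rule eps_step)
      show "real N ^ (2 * j) \<le> ?c j" if "1 \<le> j" "j \<le> K 0"
      proof -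
        have "real N ^ (2 * j) \<le> real N ^ (2 * n0)" using that N by (intro power_increasing) (auto simp: K_def)
        also have "\<dots> \<le> ?c j" using cge(1)[OF that(1)] C by simp
        finally show ?thesis .
      qed
      show "real N ^ K n / 2 \<le> real (core_size N K n)" by (rule core_size_half)
      show "summable eps" "(\<Sum>n. eps (Suc n)) < 1" by (rule eps_sum, rule eps_tail)
      show "0 < eta" using N Z0 by (simp add: eta_def)
      show "eta * hs.edge_tail (K n) \<le> real (core_size N K n) * (?c (Suc (K n)) / real N ^ (2 * Suc (K n)))"
      proof -
        let ?k = "K n" and ?b = "?c (Suc (K n))"
        have b0: "0 \<le> ?b" using cge(1)[of "Suc ?k"] C0 by simp
        have "hs.edge_tail ?k \<le> (\<Sum>j. ?b / real N ^ ?k * Zf (Suc j))"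
          unfolding hs.edge_tail_def
        proof (rule suminf_le[OF _ hs.edge_tail_summable summable_mult[OF sZ]])
          fix j
          have "?c (j + Suc ?k) / real N ^ (j + Suc ?k)
            \<le> ?b * (real (Suc j) powr \<alpha> + C1 * real (Suc j)) / real N ^ (j + Suc ?k)"
            using C0 C1 \<alpha> by (intro divide_right_mono ck_growth) auto
          also have "\<dots> = ?b / real N ^ ?k * Zf (Suc j)" by (simp add: Zf_def power_add)
          finally show "?c (j + Suc ?k) / real N ^ (j + Suc ?k) \<le> ?b / real N ^ ?k * Zf (Suc j)" .
        qed
        also have "\<dots> = ?b / real N ^ ?k * Z" unfolding Z_def by (rule suminf_mult[OF sZ])
        also have "\<dots> \<le> ?b / real N ^ ?k * (Z + 1)" using b0 by (intro mult_left_mono) auto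
        finally have "eta * hs.edge_tail ?k \<le> eta * (?b / real N ^ ?k * (Z + 1))"
          using Z0 by (intro mult_left_mono) (auto simp: eta_def)
        also have "\<dots> = (real N ^ ?k / 2) * (?b / real N ^ (2 * Suc ?k))"
        proof -
          define y x where "y = Z + 1" and "x = real N ^ ?k"
          have "y \<noteq> 0" "x \<noteq> 0" "real N \<noteq> 0" using Z0 N by (auto simp: y_def x_def)
          moreover have pw: "real N ^ (2 * Suc ?k) = (real N)\<^sup>2 * (x * x)"
            by (simp add: x_def power2_eq_square mult_2 power_add)
          ultimately show ?thesis unfolding eta_def pw y_def[symmetric] x_def[symmetric] by (simp add: field_simps)
        qed
        also have "\<dots> \<le> real (core_size N K n) * (?b / real N ^ (2 * Suc ?k))"
          using b0 by (intro mult_right_mono core_size_half) auto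
        finally show ?thesis .
      qed
    qed
    show "percolates N ?c \<and> unique_infinite_cluster N ?c" using percolation uniqueness by blast
  qed
qed

theorem theorem3p3:
  fixes N :: nat
  assumes "N \<ge> 2"
  shows
    "(\<forall>\<alpha>::real. \<alpha> > 2 \<longrightarrow> (\<forall>C1::real. C1 \<ge> 0 \<longrightarrow>
        (\<exists>C0s>0. \<exists>C2s>0. \<forall>C0 C2. C0 > C0s \<and> C2 > C2s \<longrightarrow>
           percolates N (ck C0 C1 C2 \<alpha>) \<and> unique_infinite_cluster N (ck C0 C1 C2 \<alpha>))))
   \<and> (\<forall>\<alpha>::real. \<forall>C0 C1::real. \<alpha> \<ge> 0 \<and> C0 \<ge> 0 \<and> C1 \<ge> 0 \<and> C1 < real N \<longrightarrow>
        no_percolation N (ck C0 C1 0 \<alpha>))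
   \<and> (\<forall>\<alpha>::real. \<alpha> > 2 \<longrightarrow>
        (\<exists>Cs>0. \<forall>C0 C1 C2::real. C0 \<ge> 0 \<and> C1 \<ge> 0 \<and> C2 \<ge> 0 \<and> max C0 (max C1 C2) < Cs \<longrightarrow>
           no_percolation N (ck C0 C1 C2 \<alpha>)))"
  using percolation_and_uniqueness_ck[OF assms] no_percolation_log_weights[OF assms] no_percolation_small_constants[OF assms] by blast

end
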